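(* Let $n\ge 3$ and $d\ge 3$. The parameter space $\mathscr V_{n,d}$ of Veronese-Avoiding hypersurfaces is a locally closed subvariety of $\mathbb{P}(R_d)$. More precisely, \[ \mathscr V_{n,d}=\gamma_{n,d}^{-1}(\Omega_{n,d})\subseteq \mathscr C_{n,d}. \] In particular, the Veronese-avoidance condition $\mathbb{P}((J_f)_{T-1})\cap V_n^{T-1}=\emptyset$ is open on the stratum $\mathscr C_{n,d}$ where the gradient-generic condition $\mathrm{codim}_{\mathbb{P}(R_{T-1})}\mathbb{P}((J_f)_{T-1})=n$ holds.
   Context: $k$ is an algebraically closed field of characteristic zero, $R=k[x_1,\ldots,x_n]$ is the standard graded polynomial ring with graded pieces $R_m$, and for $f\in R_d$ the gradient ideal is $J_f=(\partial f/\partial x_1,\ldots,\partial f/\partial x_n)$, with degree-$e$ piece $(J_f)_e$. Set $T=n(d-2)$ and $m=\dim_k R_{T-1}$. $\mathbb{P}((J_f)_e)\subseteq\mathbb{P}(R_e)$ is the projective linear subspace attached to $(J_f)_e$, of codimension $\dim_k R_e-\dim_k (J_f)_e$. The Veronese variety $V_n^e\subseteq \mathbb{P}(R_e)$ is the image of $\mathbb{P}(R_1)\to\mathbb{P}(R_e)$, $[\ell]\mapsto[\ell^e]$. A reduced hypersurface $V(f)\subseteq\mathbb{P}_k^{n-1}$ is called Veronese-Avoiding if (I) $\mathrm{codim}_{\mathbb{P}(R_{T-1})}\mathbb{P}((J_f)_{T-1})=n$ (gradient-generic condition) and (II) $\mathbb{P}((J_f)_{T-1})\cap V_n^{T-1}=\emptyset$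 (Veronese-avoidance condition). Define: - $\mathscr V_{n,d}=\{[f]\in\mathbb{P}(R_d)\mid V(f)\subseteq\mathbb{P}_k^{n-1}\text{ is Veronese-Avoiding}\}$; - $\mathscr C_{n,d}=\{[f]\in \mathbb{P}(R_d)\mid \mathrm{codim}_{\mathbb{P}(R_{T-1})}\mathbb{P}((J_f)_{T-1})=n\}$, a locally closed subvariety of $\mathbb{P}(R_d)$; - $G=\mathrm{Gr}(m-n,R_{T-1})$, the Grassmannian of $(m-n)$-dimensional vector subspaces of $R_{T-1}$; - $\gamma_{n,d}:\mathscr C_{n,d}\to G$, the morphism $[f]\mapsto (J_f)_{T-1}$; - $\Sigma_{n,d}=\{L\in G\mid \mathbb{P}(L)\cap V_n^{T-1}\neq\emptyset\}$ and $\Omega_{n,d}=G\setminus\Sigma_{n,d}$. *)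

theory Defs
  imports "HOL-Analysis.Analysis" "HOL-Library.Poly_Mapping"
    "HOL-Computational_Algebra.Polynomial"
begin

section \<open>Polynomials and graded pieces\<close>

text \<open>Polynomials in variables indexed by \<open>'v\<close>: finitely supported coefficient functions on
  exponent vectors. With \<open>'v\<close> a finite type \<open>'n\<close> this is \<open>R = k[x\<^sub>1,\<dots>,x\<^sub>n]\<close>, \<open>n = CARD('n)\<close>.\<close>

type_synonym ('v, 'k) mpol = "('v \<Rightarrow>\<^sub>0 nat) \<Rightarrow>\<^sub>0 'k"

definition pscale :: "'k::comm_ring_1 \<Rightarrow> ('v, 'k) mpol \<Rightarrow> ('v, 'k) mpol" where
  "pscale c p = Poly_Mapping.single 0 c * p"

lemma single_const_mult:
  "Poly_Mapping.single 0 (a * b) = (Poly_Mapping.single 0 a * Poly_Mapping.single 0 b :: ('v, 'k::comm_ring_1) mpol)"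
  by (simp add: mult_single)

global_interpretation pvs: vector_space "pscale :: 'k::field \<Rightarrow> ('v, 'k) mpol \<Rightarrow> ('v, 'k) mpol"
  by unfold_locales
    (simp_all add: pscale_def algebra_simps single_add single_const_mult)

definition mdeg :: "('v \<Rightarrow>\<^sub>0 nat) \<Rightarrow> nat" where
  "mdeg m = (\<Sum>v\<in>Poly_Mapping.keys m. Poly_Mapping.lookup m v)"

definition graded :: "nat \<Rightarrow> ('v, 'k::comm_ring_1) mpol set" where
  "graded e = {p. \<forall>m\<in>Poly_Mapping.keys p. mdeg m = e}"

definition peval :: "('v, 'k::comm_ring_1) mpol \<Rightarrow> ('v \<Rightarrow> 'k) \<Rightarrow> 'k" where
  "peval p a = (\<Sum>m\<in>Poly_Mapping.keys p. Poly_Mapping.lookup p m *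
      (\<Prod>v\<in>Poly_Mapping.keys m. a v ^ Poly_Mapping.lookup m v))"

text \<open>If \<open>x\<^sub>i\<close> does not occur in \<open>m\<close>, the truncated exponent is harmless: the coefficient is 0.\<close>

definition pd :: "'v \<Rightarrow> ('v, 'k::comm_ring_1) mpol \<Rightarrow> ('v, 'k) mpol" where
  "pd i p = (\<Sum>m\<in>Poly_Mapping.keys p.
      Poly_Mapping.single (m - Poly_Mapping.single i 1)
        (of_nat (Poly_Mapping.lookup m i) * Poly_Mapping.lookup p m))"

text \<open>The ideal generated by \<open>S\<close> is the span of \<open>S\<close> in the ring seen as a module over itself.\<close>

definition ideal_gen :: "'a::comm_ring_1 set \<Rightarrow> 'a set" where
  "ideal_gen S = module.span (*) S"

definition gradient_ideal :: "('n::finite, 'k::field) mpol \<Rightarrow> ('n, 'k) mpol set" where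
  "gradient_ideal f = ideal_gen {pd i f | i. True}"

definition gradient_piece :: "nat \<Rightarrow> ('n::finite, 'k::field) mpol \<Rightarrow> ('n, 'k) mpol set" where
  "gradient_piece e f = gradient_ideal f \<inter> graded e"


section \<open>Projective spaces and the Zariski topology\<close>

text \<open>The point \<open>[f]\<close> is the line spanned by \<open>f\<close>; \<open>\<P>(W)\<close> is the set of lines in \<open>W\<close>.\<close>

definition pt :: "('v, 'k::field) mpol \<Rightarrow> ('v, 'k) mpol set" where
  "pt f = pvs.span {f}"

definition proj :: "('v, 'k::field) mpol set \<Rightarrow> ('v, 'k) mpol set set" where
  "proj W = {pt f | f. f \<in> W \<and> f \<noteq> 0}"

text \<open>Codimension of \<open>\<P>(L)\<close> in \<open>\<P>(W)\<close>, for \<open>L \<subseteq> W\<close> finite-dimensional.\<close>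

definition proj_codim :: "('v, 'k::field) mpol set \<Rightarrow> ('v, 'k) mpol set \<Rightarrow> nat" where
  "proj_codim W L = pvs.dim W - pvs.dim L"

text \<open>The homogeneous coordinates of \<open>[f] \<in> \<P>(R\<^sub>d)\<close> are the coefficients of \<open>f\<close>, so the forms on
  \<open>\<P>(R\<^sub>d)\<close> are homogeneous polynomials in variables indexed by monomials. Variables belonging to
  monomials of degree other than \<open>d\<close> vanish on \<open>R\<^sub>d\<close>.\<close>

definition coord_forms :: "('n \<Rightarrow>\<^sub>0 nat, 'k::field) mpol set" where
  "coord_forms = (\<Union>e. graded e)"

definition zero_locus ::
    "nat \<Rightarrow> ('n \<Rightarrow>\<^sub>0 nat, 'k::field) mpol set \<Rightarrow> ('n, 'k) mpol set set" where
  "zero_locus d S = {pt f | f. f \<in> graded d \<and> f \<noteq> 0 \<and>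
      (\<forall>F\<in>S. peval F (Poly_Mapping.lookup f) = 0)}"

definition zariski :: "nat \<Rightarrow> ('n, 'k::field) mpol set topology" where
  "zariski d = topology (\<lambda>U. \<exists>S\<subseteq>coord_forms. U = proj (graded d) - zero_locus d S)"

definition locally_closedin :: "'a topology \<Rightarrow> 'a set \<Rightarrow> bool" where
  "locally_closedin X A \<longleftrightarrow> (\<exists>U Z. openin X U \<and> closedin X Z \<and> A = U \<inter> Z)"


section \<open>Veronese-avoiding hypersurfaces\<close>

definition Tdeg :: "'n::finite itself \<Rightarrow> nat \<Rightarrow> nat" where
  "Tdeg _ d = CARD('n) * (d - 2)"

definition veronese :: "nat \<Rightarrow> ('n::finite, 'k::field) mpol set set" where
  "veronese e = {pt (l ^ e) | l. l \<in> graded 1 \<and> l \<noteq> 0}"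

text \<open>\<open>V(f)\<close> is reduced: \<open>R/(f)\<close> has no nonzero nilpotent elements.\<close>

definition reduced_hypersurface :: "('n::finite, 'k::field) mpol \<Rightarrow> bool" where
  "reduced_hypersurface f \<longleftrightarrow> f \<noteq> 0 \<and> (\<forall>g r. f dvd g ^ r \<longrightarrow> f dvd g)"

definition gradient_generic :: "nat \<Rightarrow> ('n::finite, 'k::field) mpol \<Rightarrow> bool" where
  "gradient_generic d f \<longleftrightarrow>
     proj_codim (graded (Tdeg TYPE('n) d - 1)) (gradient_piece (Tdeg TYPE('n) d - 1) f) = CARD('n)"

definition veronese_avoidance :: "nat \<Rightarrow> ('n::finite, 'k::field) mpol \<Rightarrow> bool" where
  "veronese_avoidance d f \<longleftrightarrow>
     proj (gradient_piece (Tdeg TYPE('n) d - 1) f) \<inter> veronese (Tdeg TYPE('n) d - 1) = {}"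

definition Veronese_Avoiding :: "nat \<Rightarrow> ('n::finite, 'k::field) mpol \<Rightarrow> bool" where
  "Veronese_Avoiding d f \<longleftrightarrow>
     reduced_hypersurface f \<and> gradient_generic d f \<and> veronese_avoidance d f"

definition VA_space :: "nat \<Rightarrow> ('n::finite, 'k::field) mpol set set" where
  "VA_space d = {pt f | f. f \<in> graded d \<and> f \<noteq> 0 \<and> Veronese_Avoiding d f}"

definition C_space :: "nat \<Rightarrow> ('n::finite, 'k::field) mpol set set" where
  "C_space d = {pt f | f. f \<in> graded d \<and> f \<noteq> 0 \<and> gradient_generic d f}"

definition Grassmannian :: "nat \<Rightarrow> ('v, 'k::field) mpol set \<Rightarrow> ('v, 'k) mpol set set" where
  "Grassmannian r W = {L. pvs.subspace L \<and> L \<subseteq> W \<and> pvs.dim L = r}"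

definition G_space :: "nat \<Rightarrow> ('n::finite, 'k::field) mpol set set" where
  "G_space d =
     (let R = graded (Tdeg TYPE('n) d - 1) in Grassmannian (pvs.dim R - CARD('n)) R)"

text \<open>The representative \<open>f\<close> of the point does not matter, see \<open>gamma_pt\<close> below.\<close>

definition gamma :: "nat \<Rightarrow> ('n::finite, 'k::field) mpol set \<Rightarrow> ('n, 'k) mpol set" where
  "gamma d p = (THE L. \<exists>f. f \<noteq> 0 \<and> p = pt f \<and> L = gradient_piece (Tdeg TYPE('n) d - 1) f)"

definition Sigma_space :: "nat \<Rightarrow> ('n::finite, 'k::field) mpol set set" where
  "Sigma_space d = {L \<in> G_space d. proj L \<inter> veronese (Tdeg TYPE('n) d - 1) \<noteq> {}}"

definition Omega_space :: "nat \<Rightarrow> ('n::finite, 'k::field) mpol set set" where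
  "Omega_space d = G_space d - Sigma_space d"


section \<open>Well-definedness\<close>

lemma module_times: "module ((*) :: 'a::comm_ring_1 \<Rightarrow> 'a \<Rightarrow> 'a)"
  by unfold_locales (simp_all add: algebra_simps)

lemma lookup_pscale: "Poly_Mapping.lookup (pscale c p) m = c * Poly_Mapping.lookup p m"
proof -
  have "pscale c p = Poly_Mapping.map ((*) c) p"
    by (simp add: pscale_def mult_map_scale_conv_mult)
  then show ?thesis by (simp add: map.rep_eq when_def)
qed

lemma keys_pscale: "c \<noteq> 0 \<Longrightarrow> Poly_Mapping.keys (pscale c p) = Poly_Mapping.keys (p :: ('v, 'k::field) mpol)"
  by (auto simp: in_keys_iff lookup_pscale)

lemma pt_eq_iff:
  fixes f g :: "('v, 'k::field) mpol"
  assumes "f \<noteq> 0" "g \<noteq> 0"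
  shows "pt f = pt g \<longleftrightarrow> (\<exists>c. c \<noteq> 0 \<and> f = pscale c g)"
proof
  assume "pt f = pt g"
  then have "f \<in> pvs.span {g}" unfolding pt_def using pvs.span_base by blast
  then obtain c where c: "f = pscale c g"
    by (auto simp: pvs.span_singleton)
  with assms have "c \<noteq> 0" by (metis pvs.scale_zero_left)
  with c show "\<exists>c. c \<noteq> 0 \<and> f = pscale c g" by blast
next
  assume "\<exists>c. c \<noteq> 0 \<and> f = pscale c g"
  then obtain c where c: "c \<noteq> 0" "f = pscale c g" by blast
  then have "g = pscale (1 / c) f" by (simp add: pvs.scale_scale)
  then have "g \<in> pvs.span {f}" "f \<in> pvs.span {g}"
    using c by (metis pvs.span_scale pvs.span_base singletonI)+
  then show "pt f = pt g" unfolding pt_def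
    by (metis pvs.span_eq singletonD subsetI)
qed

lemma pd_pscale:
  fixes f :: "('v, 'k::field) mpol"
  assumes "c \<noteq> 0"
  shows "pd i (pscale c f) = pscale c (pd i f)"
  unfolding pd_def keys_pscale[OF assms] lookup_pscale
  by (simp add: pscale_def sum_distrib_left mult_single algebra_simps)

lemma ideal_gen_mono_aux:
  fixes c :: "'k::field" and h :: "'i \<Rightarrow> ('v, 'k) mpol"
  shows "ideal_gen {pscale c (h i) | i. True} \<subseteq> ideal_gen {h i | i. True}"
  unfolding ideal_gen_def
proof (rule module.span_minimal[OF module_times])
  show "module.subspace (*) (module.span (*) {h i | i. True})"
    by (rule module.subspace_span[OF module_times])
  have "pscale c (h i) \<in> module.span (*) {h i | i. True}" for i
    unfolding pscale_def
    by (rule module.span_scale[OF module_times], rule module.span_base[OF module_times]) blast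
  then show "{pscale c (h i) | i. True} \<subseteq> module.span (*) {h i | i. True}" by blast
qed

lemma gradient_ideal_pscale:
  fixes f :: "('n::finite, 'k::field) mpol"
  assumes "c \<noteq> 0"
  shows "gradient_ideal (pscale c f) = gradient_ideal f"
proof
  show "gradient_ideal (pscale c f) \<subseteq> gradient_ideal f"
    unfolding gradient_ideal_def pd_pscale[OF assms] by (rule ideal_gen_mono_aux)
  have "ideal_gen {pscale (1/c) (pd i (pscale c f)) | i. True} \<subseteq> ideal_gen {pd i (pscale c f) | i. True}"
    by (rule ideal_gen_mono_aux)
  then show "gradient_ideal f \<subseteq> gradient_ideal (pscale c f)"
    using assms by (simp add: gradient_ideal_def pd_pscale pvs.scale_scale)
qed

lemma gradient_piece_cong:
  assumes "f \<noteq> 0" "g \<noteq> 0" "pt f = pt g"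
  shows "gradient_piece e f = gradient_piece e g"
  using assms by (metis pt_eq_iff gradient_ideal_pscale gradient_piece_def)

lemma gamma_pt:
  fixes f :: "('n::finite, 'k::field) mpol"
  assumes "f \<noteq> 0"
  shows "gamma d (pt f) = gradient_piece (Tdeg TYPE('n) d - 1) f"
  unfolding gamma_def
  by (rule the_equality) (use assms gradient_piece_cong in blast)+

lemma subspace_gradient_piece:
  fixes f :: "('n::finite, 'k::field) mpol"
  shows "pvs.subspace (gradient_piece e f)"
proof -
  have 1: "pvs.subspace (graded e :: ('n, 'k) mpol set)"
    unfolding pvs.subspace_def graded_def
    by (auto simp: in_keys_iff lookup_add lookup_pscale)
  have 2: "pvs.subspace (gradient_ideal f)"
    unfolding pvs.subspace_def gradient_ideal_def ideal_gen_def pscale_def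
    by (auto intro: module.span_zero[OF module_times] module.span_add[OF module_times]
        module.span_scale[OF module_times])
  show ?thesis unfolding gradient_piece_def by (intro pvs.subspace_inter 1 2)
qed

lemma gamma_in_G_space:
  fixes p :: "('n::finite, 'k::field) mpol set"
  assumes "p \<in> C_space d"
  shows "gamma d p \<in> G_space d"
proof -
  let ?e = "Tdeg TYPE('n) d - 1"
  obtain f where f: "p = pt f" "f \<noteq> 0" "gradient_generic d f"
    using assms unfolding C_space_def by blast
  have "0 < CARD('n)" by simp
  then have "pvs.dim (gradient_piece ?e f) = pvs.dim (graded ?e :: ('n, 'k) mpol set) - CARD('n)"
    using f(3) unfolding gradient_generic_def proj_codim_def by linarith
  moreover have "gradient_piece ?e f \<subseteq> graded ?e" by (simp add: gradient_piece_def)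
  ultimately show ?thesis
    using f subspace_gradient_piece
    by (simp add: gamma_pt G_space_def Grassmannian_def Let_def)
qed

lemma peval_superset:
  assumes "finite A" "Poly_Mapping.keys p \<subseteq> A"
  shows "peval p a = (\<Sum>m\<in>A. Poly_Mapping.lookup p m *
      (\<Prod>v\<in>Poly_Mapping.keys m. a v ^ Poly_Mapping.lookup m v))"
  unfolding peval_def by (rule sum.mono_neutral_left) (use assms in \<open>auto simp: in_keys_iff\<close>)

lemma peval_add: "peval (p + q) a = peval p a + peval q a"
proof -
  let ?A = "Poly_Mapping.keys p \<union> Poly_Mapping.keys q"
  have "Poly_Mapping.keys (p + q) \<subseteq> ?A" by (rule Poly_Mapping.keys_add)
  then show ?thesis
    using peval_superset[of ?A p a] peval_superset[of ?A q a] peval_superset[of ?A "p + q" a]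
    by (simp add: lookup_add algebra_simps sum.distrib)
qed

lemma monom_eval_add:
  fixes a :: "'v \<Rightarrow> 'k::comm_ring_1"
  shows "(\<Prod>v\<in>Poly_Mapping.keys (m + m'). a v ^ Poly_Mapping.lookup (m + m') v) =
    (\<Prod>v\<in>Poly_Mapping.keys m. a v ^ Poly_Mapping.lookup m v) *
    (\<Prod>v\<in>Poly_Mapping.keys m'. a v ^ Poly_Mapping.lookup m' v)"
proof -
  let ?A = "Poly_Mapping.keys m \<union> Poly_Mapping.keys m'"
  have "(\<Prod>v\<in>Poly_Mapping.keys u. a v ^ Poly_Mapping.lookup u v) =
      (\<Prod>v\<in>?A. a v ^ Poly_Mapping.lookup u v)" if "Poly_Mapping.keys u \<subseteq> ?A" for u
    by (rule prod.mono_neutral_left) (use that in \<open>auto simp: in_keys_iff\<close>)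
  from this[of m] this[of m'] this[of "m + m'"] show ?thesis
    by (simp add: Poly_Mapping.keys_add lookup_add power_add prod.distrib)
qed

lemma peval_single:
  "peval (Poly_Mapping.single m c) a = c * (\<Prod>v\<in>Poly_Mapping.keys m. a v ^ Poly_Mapping.lookup m v)"
  by (cases "c = 0") (simp_all add: peval_def)

lemma mpol_induct [case_names zero add]:
  assumes "P 0" "\<And>m c p. P p \<Longrightarrow> P (Poly_Mapping.single m c + p)"
  shows "P (p :: ('v, 'k::comm_ring_1) mpol)"
proof (induction "card (Poly_Mapping.keys p)" arbitrary: p)
  case 0
  then have "p = 0" by simp
  then show ?case using assms(1) by simp
next
  case (Suc n)
  then obtain m where m: "m \<in> Poly_Mapping.keys p" by fastforce
  let ?q = "p - Poly_Mapping.single m (Poly_Mapping.lookup p m)"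
  have "Poly_Mapping.keys ?q = Poly_Mapping.keys p - {m}"
    by (auto simp: in_keys_iff lookup_minus lookup_single when_def split: if_splits)
  then have "n = card (Poly_Mapping.keys ?q)" using Suc(2) m by simp
  then have "P ?q" by (rule Suc(1))
  then show ?case using assms(2)[of ?q m "Poly_Mapping.lookup p m"] by simp
qed

lemma peval_mult: "peval (p * q) a = peval p a * peval q a"
proof (induction p rule: mpol_induct)
  case zero
  then show ?case by (simp add: peval_def)
next
  case (add m c p)
  have "peval (Poly_Mapping.single m c * q) a = peval (Poly_Mapping.single m c) a * peval q a"
  proof (induction q rule: mpol_induct)
    case zero
    then show ?case by (simp add: peval_def)
  next
    case (add m' c' q)
    then show ?case
      by (simp add: distrib_left peval_add mult_single peval_single monom_eval_add algebra_simps)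
  qed
  with add show ?case by (simp add: distrib_right peval_add)
qed

lemma graded_mult:
  assumes "p \<in> graded e" "q \<in> graded e'"
  shows "p * q \<in> graded (e + e')"
proof -
  have mdeg_add: "mdeg (m + m') = mdeg m + mdeg m'" for m m' :: "'a \<Rightarrow>\<^sub>0 nat"
  proof -
    let ?A = "Poly_Mapping.keys m \<union> Poly_Mapping.keys m'"
    have "mdeg u = (\<Sum>v\<in>?A. Poly_Mapping.lookup u v)" if "Poly_Mapping.keys u \<subseteq> ?A" for u
      unfolding mdeg_def by (rule sum.mono_neutral_left) (use that in \<open>auto simp: in_keys_iff\<close>)
    from this[of m] this[of m'] this[of "m + m'"] show ?thesis
      by (simp add: Poly_Mapping.keys_add lookup_add sum.distrib)
  qed
  have "Poly_Mapping.keys (p * q) \<subseteq> {m + m' | m m'. m \<in> Poly_Mapping.keys p \<and> m' \<in> Poly_Mapping.keys q}"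
    using keys_mult[of p q] by auto
  then show ?thesis using assms unfolding graded_def by (fastforce simp: mdeg_add)
qed

lemma peval_scale:
  fixes F :: "('v, 'k::field) mpol"
  assumes "F \<in> graded e"
  shows "peval F (\<lambda>v. c * a v) = c ^ e * peval F a"
proof -
  have "(\<Prod>v\<in>Poly_Mapping.keys m. (c * a v) ^ Poly_Mapping.lookup m v) =
      c ^ e * (\<Prod>v\<in>Poly_Mapping.keys m. a v ^ Poly_Mapping.lookup m v)"
    if "m \<in> Poly_Mapping.keys F" for m
    using that assms by (auto simp: graded_def mdeg_def power_mult_distrib prod.distrib power_sum)
  then show ?thesis unfolding peval_def by (simp add: sum_distrib_left mult_ac cong: sum.cong)
qed

lemma pt_in_zero_locus:
  fixes f :: "('n, 'k::field) mpol"
  assumes "f \<in> graded d" "f \<noteq> 0" "S \<subseteq> coord_forms"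
  shows "pt f \<in> zero_locus d S \<longleftrightarrow> (\<forall>F\<in>S. peval F (Poly_Mapping.lookup f) = 0)"
proof
  assume "pt f \<in> zero_locus d S"
  then obtain g where g: "pt f = pt g" "g \<noteq> 0" "\<forall>F\<in>S. peval F (Poly_Mapping.lookup g) = 0"
    unfolding zero_locus_def by blast
  then obtain c where c: "f = pscale c g" using pt_eq_iff assms(2) by blast
  show "\<forall>F\<in>S. peval F (Poly_Mapping.lookup f) = 0"
  proof
    fix F assume "F \<in> S"
    then obtain e where "F \<in> graded e" using assms(3) unfolding coord_forms_def by blast
    moreover have "Poly_Mapping.lookup f = (\<lambda>m. c * Poly_Mapping.lookup g m)"
      by (auto simp: c lookup_pscale)
    ultimately show "peval F (Poly_Mapping.lookup f) = 0"
      using g(3) \<open>F \<in> S\<close> by (simp add: peval_scale)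
  qed
qed (use assms in \<open>auto simp: zero_locus_def\<close>)

lemma istopology_zariski:
  "istopology (\<lambda>U :: ('n, 'k::field) mpol set set.
     \<exists>S\<subseteq>coord_forms. U = proj (graded d) - zero_locus d S)"
  unfolding istopology_def
proof (intro conjI allI impI)
  fix U V :: "('n, 'k) mpol set set"
  assume "\<exists>S\<subseteq>coord_forms. U = proj (graded d) - zero_locus d S"
    and "\<exists>S\<subseteq>coord_forms. V = proj (graded d) - zero_locus d S"
  then obtain S S' where S: "S \<subseteq> coord_forms" "U = proj (graded d) - zero_locus d S"
    and S': "S' \<subseteq> coord_forms" "V = proj (graded d) - zero_locus d S'" by blast
  let ?P = "{F * F' | F F'. F \<in> S \<and> F' \<in> S'}"
  have P: "?P \<subseteq> coord_forms"
  proof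
    fix H assume "H \<in> ?P"
    then obtain F F' where F: "H = F * F'" "F \<in> S" "F' \<in> S'" by blast
    then obtain e e' where "F \<in> graded e" "F' \<in> graded e'"
      using S(1) S'(1) unfolding coord_forms_def by blast
    then show "H \<in> coord_forms" using F(1) graded_mult unfolding coord_forms_def by blast
  qed
  have "pt f \<in> U \<inter> V \<longleftrightarrow> pt f \<in> proj (graded d) - zero_locus d ?P"
    if f: "f \<in> graded d" "f \<noteq> 0" for f
  proof -
    have "pt f \<in> proj (graded d)" using f by (auto simp: proj_def)
    then have "pt f \<in> U \<inter> V \<longleftrightarrow> (\<exists>F\<in>S. peval F (Poly_Mapping.lookup f) \<noteq> 0) \<and>
        (\<exists>F\<in>S'. peval F (Poly_Mapping.lookup f) \<noteq> 0)"
      using S S' pt_in_zero_locus[OF f] by auto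
    also have "\<dots> \<longleftrightarrow> (\<exists>F\<in>?P. peval F (Poly_Mapping.lookup f) \<noteq> 0)"
      by (auto simp: peval_mult) (metis peval_mult mult_eq_0_iff)+
    finally show ?thesis
      using \<open>pt f \<in> proj (graded d)\<close> pt_in_zero_locus[OF f P] by blast
  qed
  then have "U \<inter> V = proj (graded d) - zero_locus d ?P"
    using S(2) S'(2) unfolding proj_def by blast
  with P show "\<exists>S\<subseteq>coord_forms. U \<inter> V = proj (graded d) - zero_locus d S" by blast
next
  fix \<K> :: "('n, 'k) mpol set set set"
  assume "\<forall>K\<in>\<K>. \<exists>S\<subseteq>coord_forms. K = proj (graded d) - zero_locus d S"
  then obtain S where S: "\<And>K. K \<in> \<K> \<Longrightarrow> S K \<subseteq> coord_forms \<and> K = proj (graded d) - zero_locus d (S K)"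
    by metis
  have P: "(\<Union>K\<in>\<K>. S K) \<subseteq> coord_forms" using S by blast
  have "pt f \<in> \<Union>\<K> \<longleftrightarrow> pt f \<in> proj (graded d) - zero_locus d (\<Union>K\<in>\<K>. S K)"
    if f: "f \<in> graded d" "f \<noteq> 0" for f
  proof -
    have pf: "pt f \<in> proj (graded d)" using f by (auto simp: proj_def)
    have "pt f \<in> K \<longleftrightarrow> (\<exists>F\<in>S K. peval F (Poly_Mapping.lookup f) \<noteq> 0)" if "K \<in> \<K>" for K
      using S[OF that] pt_in_zero_locus[OF f, of "S K"] pf by blast
    then have "pt f \<in> \<Union>\<K> \<longleftrightarrow> (\<exists>F\<in>(\<Union>K\<in>\<K>. S K). peval F (Poly_Mapping.lookup f) \<noteq> 0)"
      by auto
    then show ?thesis using pf by (simp add: pt_in_zero_locus[OF f P])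
  qed
  then have "x \<in> \<Union>\<K> \<longleftrightarrow> x \<in> proj (graded d) - zero_locus d (\<Union>K\<in>\<K>. S K)"
    if "x \<in> proj (graded d)" for x
    using that unfolding proj_def by auto
  moreover have "x \<in> proj (graded d)" if "x \<in> \<Union>\<K>" for x
  proof -
    from that obtain K where "K \<in> \<K>" "x \<in> K" by (rule UnionE)
    then show ?thesis using S[of K] by auto
  qed
  ultimately have "\<Union>\<K> = proj (graded d) - zero_locus d (\<Union>K\<in>\<K>. S K)"
    by (intro set_eqI) (metis DiffD1)
  with P show "\<exists>S\<subseteq>coord_forms. \<Union>\<K> = proj (graded d) - zero_locus d S" by blast
qed

lemma openin_zariski:
  "openin (zariski d) U \<longleftrightarrow> (\<exists>S\<subseteq>coord_forms. U = proj (graded d) - zero_locus d S)"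
  unfolding zariski_def by (simp add: topology_inverse'[OF istopology_zariski])

lemma peval_one: "peval 1 a = 1"
  using peval_single[of 0 1 a] by simp

lemma topspace_zariski: "topspace (zariski d) = proj (graded d)"
proof
  have "zero_locus d {1} = ({} :: ('n, 'k::field) mpol set set)"
    by (auto simp: zero_locus_def peval_one)
  moreover have "{1} \<subseteq> (coord_forms :: ('n \<Rightarrow>\<^sub>0 nat, 'k::field) mpol set)"
    by (auto simp: coord_forms_def graded_def)
  ultimately have "openin (zariski d) (proj (graded d) :: ('n, 'k::field) mpol set set)"
    unfolding openin_zariski by blast
  then show "proj (graded d) \<subseteq> topspace (zariski d :: ('n, 'k::field) mpol set topology)"
    by (rule openin_subset)
qed (auto simp: topspace_def openin_zariski)

lemma closedin_zariski:
  "closedin (zariski d) Z \<longleftrightarrow> (\<exists>S\<subseteq>coord_forms. Z = zero_locus d S)"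
proof -
  have "zero_locus d S \<subseteq> proj (graded d)" for S by (auto simp: zero_locus_def proj_def)
  then show ?thesis
    unfolding closedin_def topspace_zariski openin_zariski
    by (metis Diff_Diff_Int inf.absorb_iff2 Diff_subset)
qed

end

theory Submission
  imports Defs
begin

text \<open>Write \<open>e = T - 1\<close>, \<open>J = (J\<^sub>f)\<^sub>e\<close>, and let \<open>A\<close> be the set of points \<open>[f]\<close> such that \<open>f\<close> satisfies the
gradient-generic and the Veronese-avoidance condition. Since \<open>\<gamma>\<close> sends \<open>[f]\<close> to \<open>J\<close>, the set \<open>A\<close> is
the preimage of \<open>\<Omega>\<close> by definition. Two things have to be proved: that the two conditions
force \<open>f\<close> to be reduced, so that \<open>\<V>\<close> equals \<open>A\<close>, and that avoidance is an open condition on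
the stratum where \<open>J\<close> has codimension \<open>n\<close>.

\<^emph>\<open>Reducedness\<close> (\<open>reduced_if_gradient_generic_avoiding\<close>). Suppose that \<open>f\<close> is not reduced. Choose a
direction \<open>v\<close> with \<open>f(v) \<noteq> 0\<close>, and restrict polynomials to the line \<open>x + s v\<close> through the generic point \<open>x\<close>.
There \<open>f\<close> becomes a polynomial in \<open>s\<close> of degree \<open>d\<close> with a repeated factor \<open>P\<close>, and up to a nonzero
factor that does not involve \<open>s\<close>, all partial derivatives of \<open>f\<close>, hence all elements of \<open>J\<^sub>f\<close>, are divisible by
\<open>P\<close>. Therefore \<open>0\<close> is the only element of \<open>J\<^sub>f\<close> that is constant in the direction \<open>v\<close>. The forms constant in
the direction \<open>v\<close> are the forms in \<open>n - 1\<close> suitable variables \<open>y\<^sub>j\<close>; in degree \<open>e\<close> they span a space of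
dimension at least \<open>n\<close>. As \<open>J\<close> has codimension \<open>n\<close>, it is a complement of that space in \<open>R\<^sub>e\<close>. Reducing
\<open>x\<^sub>i y\<^sub>a\<^bsup>e-1\<^esup>\<close> and \<open>x\<^sub>i y\<^sub>b\<^bsup>e-1\<^esup>\<close> modulo \<open>J\<close> and comparing the results yields a linear
form \<open>\<beta>\<close> in the \<open>y\<^sub>j\<close> with \<open>y\<^sub>a\<^bsup>e-1\<^esup> (x\<^sub>i - \<beta>) \<in> J\<close>, and then \<open>(x\<^sub>i - \<beta>)\<^sup>e \<in> J\<close>. This
contradicts avoidance.

\<^emph>\<open>Openness.\<close> Say that a form \<open>\<Psi>\<close> of degree \<open>N \<ge> e\<close> belongs to the inverse system of \<open>J\<close> if all its partial
derivatives of order \<open>N - e\<close> lie in \<open>J\<close>. If \<open>l\<^sup>e \<in> J\<close>, then \<open>l\<^sup>N\<close> belongs to the inverse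
system. Conversely, if the inverse system is nonzero in every degree \<open>N\<close>, then its annihilator is a homogeneous
ideal that contains no \<open>R\<^sub>N\<close>, and a common zero of this ideal gives a linear form \<open>l\<close> with \<open>l\<^sup>e \<in> J\<close>
(\<open>homogeneous_nullstellensatz\<close>, \<open>no_linear_powers_imp_trivial_inverse_system\<close>). So \<open>f\<close> avoids the
Veronese variety iff the inverse system vanishes in some degree \<open>N\<close>. For fixed \<open>N\<close>, and as long as the dimension
of \<open>J\<close> does not change, this says that a system of linear equations, whose coefficients are constants or linear in
the coefficients of \<open>f\<close>, has only the zero solution; such a condition is open
(\<open>full_col_rank_open\<close>, \<open>trivial_inverse_system_open\<close>).

Finally, the points where \<open>J\<close> has codimension at least \<open>n\<close> form a closed set, and \<open>A\<close> is open in it because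
the dimension of \<open>J\<close> can only grow near a given point. So \<open>A\<close> is locally closed.\<close>


section \<open>Polynomials, substitutions and derivations\<close>

abbreviation coef :: "('a \<Rightarrow>\<^sub>0 'b::zero) \<Rightarrow> 'a \<Rightarrow> 'b" where
  "coef \<equiv> Poly_Mapping.lookup"

abbreviation mon :: "'a \<Rightarrow> 'b::zero \<Rightarrow> 'a \<Rightarrow>\<^sub>0 'b" where
  "mon \<equiv> Poly_Mapping.single"

abbreviation expo :: "'v \<Rightarrow> ('v \<Rightarrow>\<^sub>0 nat)" where
  "expo v \<equiv> mon v (Suc 0)"

abbreviation cst :: "'k::comm_ring_1 \<Rightarrow> ('v, 'k) mpol" where
  "cst c \<equiv> mon 0 c"

abbreviation var :: "'v \<Rightarrow> ('v, 'k::comm_ring_1) mpol" where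
  "var v \<equiv> mon (expo v) 1"

lemma poly_mapping_sum_monomials:
  fixes p :: "'a \<Rightarrow>\<^sub>0 'b::comm_monoid_add"
  shows "p = (\<Sum>m\<in>Poly_Mapping.keys p. mon m (coef p m))"
proof (rule poly_mapping_eqI)
  fix k
  have "(\<Sum>m\<in>Poly_Mapping.keys p. coef (mon m (coef p m)) k)
      = (\<Sum>m\<in>Poly_Mapping.keys p. if m = k then coef p k else 0)"
    by (rule sum.cong) (auto simp: lookup_single when_def)
  also have "\<dots> = coef p k" by (auto simp: in_keys_iff)
  finally show "coef p k = coef (\<Sum>m\<in>Poly_Mapping.keys p. mon m (coef p m)) k"
    by (simp add: lookup_sum)
qed

lemma mon_sum_exponents:
  assumes "finite A"
  shows "mon (\<Sum>v\<in>A. f v) (1::'k::comm_ring_1) = (\<Prod>v\<in>A. mon (f v) 1)"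
  using assms
proof (induction A rule: finite_induct)
  case (insert x A)
  then show ?case by (simp add: mult_single flip: insert.IH)
qed simp

lemma mon_multiple_exponent: "mon (mon v n) (1::'k::comm_ring_1) = var v ^ n"
proof (induction n)
  case (Suc n)
  have "mon v (Suc n) = expo v + mon v n" by (simp flip: single_add)
  then show ?case by (simp add: mult_single flip: Suc)
qed simp

lemma mon_one_eq_prod_vars:
  "mon m (1::'k::comm_ring_1) = (\<Prod>v\<in>Poly_Mapping.keys m. var v ^ coef m v)"
proof -
  have "mon m (1::'k) = mon (\<Sum>v\<in>Poly_Mapping.keys m. mon v (coef m v)) 1"
    using poly_mapping_sum_monomials[of m] by (rule arg_cong)
  also have "\<dots> = (\<Prod>v\<in>Poly_Mapping.keys m. var v ^ coef m v)"
    unfolding mon_sum_exponents[OF finite_keys]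
    by (rule prod.cong[OF refl], rule mon_multiple_exponent)
  finally show ?thesis .
qed

text \<open>Identities between ring homomorphisms or derivations on the polynomial ring need only be checked on constants and
variables.\<close>

lemma mpol_ring_induct [case_names const var add mult]:
  fixes p :: "('v, 'k::comm_ring_1) mpol"
  assumes const: "\<And>c. P (cst c)" and var: "\<And>v. P (var v)"
    and add: "\<And>p q. P p \<Longrightarrow> P q \<Longrightarrow> P (p + q)"
    and mult: "\<And>p q. P p \<Longrightarrow> P q \<Longrightarrow> P (p * q)"
  shows "P p"
proof (induction p rule: mpol_induct)
  case zero
  show ?case using const[of 0] by simp
next
  case (add m c p)
  have one: "P 1" using const[of 1] by simp
  have pow: "P (var v ^ n)" for v n
    by (induction n) (use one var mult in auto)
  have "P (\<Prod>v\<in>A. var v ^ coef m v)" if "finite A" for A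
    using that by (induction A rule: finite_induct) (use one pow mult in auto)
  then have "P (mon m 1)" by (simp only: mon_one_eq_prod_vars[of m] finite_keys)
  then have "P (cst c * mon m 1)" by (rule mult[OF const])
  then show ?case using assms(3)[OF _ add.IH] by (simp add: mult_single)
qed

lemma mdeg_zero [simp]: "mdeg 0 = 0" by (simp add: mdeg_def)

lemma mdeg_superset:
  assumes "finite A" "Poly_Mapping.keys m \<subseteq> A"
  shows "mdeg m = (\<Sum>v\<in>A. coef m v)"
  unfolding mdeg_def by (rule sum.mono_neutral_left) (use assms in \<open>auto simp: in_keys_iff\<close>)

lemma mdeg_add [simp]: "mdeg (m + m') = mdeg m + mdeg m'"
proof -
  let ?A = "Poly_Mapping.keys m \<union> Poly_Mapping.keys m'"
  show ?thesis
    using mdeg_superset[of ?A m] mdeg_superset[of ?A m'] mdeg_superset[of ?A "m + m'"]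
    by (simp add: Poly_Mapping.keys_add lookup_add sum.distrib)
qed

lemma mdeg_mon [simp]: "mdeg (mon v n) = n"
  by (cases "n = 0") (simp_all add: mdeg_def)

lemma mdeg_eq_sum: "mdeg (m :: 'n::finite \<Rightarrow>\<^sub>0 nat) = (\<Sum>v\<in>UNIV. coef m v)"
  by (rule mdeg_superset) auto

lemma coef_le_mdeg: "coef m v \<le> mdeg m"
proof (cases "v \<in> Poly_Mapping.keys m")
  case True
  then show ?thesis unfolding mdeg_def by (intro member_le_sum) auto
next
  case False
  then show ?thesis by (simp add: in_keys_iff)
qed

lemma exponent_split: "0 < coef m v \<Longrightarrow> m = (m - expo v) + expo v"
  by (rule poly_mapping_eqI) (auto simp: lookup_add lookup_minus lookup_single when_def)

lemma mdeg_pos_obtain: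
  assumes "mdeg m = Suc e"
  obtains v m' where "m = m' + expo v" "mdeg m' = e"
proof -
  from assms have "mdeg m \<noteq> 0" by simp
  then obtain v where "coef m v \<noteq> 0"
    unfolding mdeg_def by (metis sum.neutral)
  then have m: "m = (m - expo v) + expo v" by (intro exponent_split) simp
  have "mdeg m = mdeg (m - expo v) + 1"
    using arg_cong[where f = mdeg, OF m] by (simp only: mdeg_add mdeg_mon)
  then show ?thesis using assms that[OF m] by simp
qed

lemma exponent_le_split:
  fixes a m :: "'v \<Rightarrow>\<^sub>0 nat"
  assumes "\<And>v. coef a v \<le> coef m v"
  shows "m = a + (m - a)"
proof (rule poly_mapping_eqI)
  fix v
  show "coef m v = coef (a + (m - a)) v"
    using assms[of v] by (simp add: lookup_add lookup_minus)
qed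

lemma mdeg_eq_zero_iff: "mdeg m = 0 \<longleftrightarrow> m = 0"
proof
  assume "mdeg m = 0"
  then have "coef m v = 0" for v using coef_le_mdeg[of m v] by simp
  then show "m = 0" by (intro poly_mapping_eqI) simp
qed simp

lemma finite_monomials [simp]: "finite {m :: 'n::finite \<Rightarrow>\<^sub>0 nat. mdeg m = e}"
proof (rule finite_imageD)
  have "Poly_Mapping.lookup ` {m :: 'n \<Rightarrow>\<^sub>0 nat. mdeg m = e} \<subseteq> Pi\<^sub>E UNIV (\<lambda>_. {..e})"
    using coef_le_mdeg by (fastforce simp: PiE_def)
  then show "finite (Poly_Mapping.lookup ` {m :: 'n \<Rightarrow>\<^sub>0 nat. mdeg m = e})"
    by (rule finite_subset) (intro finite_PiE, auto)
qed (auto simp: inj_on_def)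

lemma coef_mon_mult: "coef (mon a c * p) (a + m) = (c::'k::comm_ring_1) * coef p (m::'v \<Rightarrow>\<^sub>0 nat)"
  by (induction p rule: mpol_induct)
    (auto simp: distrib_left lookup_add mult_single lookup_single when_def)

lemma coef_mon_mult_zero:
  assumes "\<And>m. k \<noteq> a + m"
  shows "coef (mon a (c::'k::comm_ring_1) * p) (k::'v \<Rightarrow>\<^sub>0 nat) = 0"
  by (induction p rule: mpol_induct)
    (use assms in \<open>auto simp: distrib_left lookup_add mult_single lookup_single when_def\<close>)

lemma graded_zero [simp]: "0 \<in> graded e" by (simp add: graded_def)

lemma graded_add: "p \<in> graded e \<Longrightarrow> q \<in> graded e \<Longrightarrow> p + q \<in> graded e"
  using Poly_Mapping.keys_add[of p q] by (auto simp: graded_def)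

lemma graded_minus: "p \<in> graded e \<Longrightarrow> q \<in> graded e \<Longrightarrow> p - q \<in> graded e"
  unfolding graded_def by (auto simp: in_keys_iff lookup_minus)

lemma graded_sum: "(\<And>x. x \<in> A \<Longrightarrow> f x \<in> graded e) \<Longrightarrow> (\<Sum>x\<in>A. f x) \<in> graded e"
  by (induction A rule: infinite_finite_induct) (auto intro: graded_add)

lemma graded_mon: "mdeg m = e \<Longrightarrow> mon m c \<in> graded e"
  by (cases "c = 0") (auto simp: graded_def)

lemma graded_cst: "cst c \<in> graded 0" by (simp add: graded_mon)

lemma graded_var: "var v \<in> graded 1" by (simp add: graded_mon)

lemma graded_power: "p \<in> graded e \<Longrightarrow> p ^ k \<in> graded (e * k)"
  by (induction k) (use graded_cst[of 1] in \<open>auto intro: graded_mult\<close>)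

lemma graded_coef_zero: "p \<in> graded e \<Longrightarrow> mdeg m \<noteq> e \<Longrightarrow> coef p m = 0"
  by (auto simp: graded_def in_keys_iff)

lemma graded_pscale: "p \<in> graded e \<Longrightarrow> pscale c p \<in> graded e"
  unfolding pscale_def using graded_mult[OF graded_cst, of p e c] by simp

definition comm_hom :: "('a::comm_ring_1 \<Rightarrow> 'b::comm_ring_1) \<Rightarrow> bool" where
  "comm_hom h \<longleftrightarrow> h 1 = 1 \<and> (\<forall>x y. h (x + y) = h x + h y) \<and> (\<forall>x y. h (x * y) = h x * h y)"

lemma comm_homD:
  assumes "comm_hom h"
  shows "h 1 = 1" "h (x + y) = h x + h y" "h (x * y) = h x * h y" "h 0 = 0" "h (- x) = - h x"
    "h (x - y) = h x - h y" "h (x ^ n) = h x ^ n"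
proof -
  show 1: "h 1 = 1" "h (x * y) = h x * h y" for x y using assms by (auto simp: comm_hom_def)
  show a: "h (x + y) = h x + h y" for x y using assms by (auto simp: comm_hom_def)
  show z: "h 0 = 0" using a[of 0 0] by simp
  show m: "h (- x) = - h x" for x using a[of x "- x"] z by (simp add: eq_neg_iff_add_eq_0 add.commute)
  show "h (x - y) = h x - h y" using a[of x "- y"] m by simp
  show "h (x ^ n) = h x ^ n" by (induction n) (simp_all add: 1)
qed

lemma comm_hom_sum: "comm_hom h \<Longrightarrow> h (\<Sum>x\<in>A. f x) = (\<Sum>x\<in>A. h (f x))"
  by (induction A rule: infinite_finite_induct) (simp_all add: comm_homD)

lemma comm_hom_comp: "comm_hom g \<Longrightarrow> comm_hom h \<Longrightarrow> comm_hom (\<lambda>x. g (h x))"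
  by (simp add: comm_hom_def)

lemma comm_hom_dvd: "comm_hom h \<Longrightarrow> x dvd y \<Longrightarrow> h x dvd h y"
  by (auto simp: comm_homD elim!: dvdE)

lemma comm_hom_cst: "comm_hom (cst :: 'k::comm_ring_1 \<Rightarrow> ('v, 'k) mpol)"
  by (simp add: comm_hom_def single_add mult_single)

lemma comm_hom_eqI:
  fixes g h :: "('v, 'k::comm_ring_1) mpol \<Rightarrow> 'b::comm_ring_1"
  assumes "comm_hom g" "comm_hom h" "\<And>c. g (cst c) = h (cst c)" "\<And>v. g (var v) = h (var v)"
  shows "g p = h p"
  by (induction p rule: mpol_ring_induct) (simp_all add: assms comm_homD)

definition substitute :: "('k \<Rightarrow> 'b) \<Rightarrow> ('v \<Rightarrow> 'b) \<Rightarrow> ('v, 'k::comm_ring_1) mpol \<Rightarrow> 'b::comm_ring_1" where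
  "substitute \<kappa> \<theta> p = (\<Sum>m\<in>Poly_Mapping.keys p. \<kappa> (coef p m) * (\<Prod>v\<in>Poly_Mapping.keys m. \<theta> v ^ coef m v))"

lemma substitute_superset:
  assumes "finite A" "Poly_Mapping.keys p \<subseteq> A" "\<kappa> 0 = 0"
  shows "substitute \<kappa> \<theta> p = (\<Sum>m\<in>A. \<kappa> (coef p m) * (\<Prod>v\<in>Poly_Mapping.keys m. \<theta> v ^ coef m v))"
  unfolding substitute_def by (rule sum.mono_neutral_left) (use assms in \<open>auto simp: in_keys_iff\<close>)

context
  fixes \<kappa> :: "'k::comm_ring_1 \<Rightarrow> 'b::comm_ring_1" and \<theta> :: "'v \<Rightarrow> 'b"
  assumes \<kappa>: "comm_hom \<kappa>"
begin

lemma substitute_mon: "substitute \<kappa> \<theta> (mon m c) = \<kappa> c * (\<Prod>v\<in>Poly_Mapping.keys m. \<theta> v ^ coef m v)"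
  by (cases "c = 0") (simp_all add: substitute_def comm_homD[OF \<kappa>])

lemma substitute_cst: "substitute \<kappa> \<theta> (cst c) = \<kappa> c" by (simp add: substitute_mon)

lemma substitute_var: "substitute \<kappa> \<theta> (var v) = \<theta> v"
  by (simp add: substitute_mon comm_homD[OF \<kappa>])

lemma substitute_add: "substitute \<kappa> \<theta> (p + q) = substitute \<kappa> \<theta> p + substitute \<kappa> \<theta> q"
proof -
  let ?A = "Poly_Mapping.keys p \<union> Poly_Mapping.keys q"
  have "Poly_Mapping.keys (p + q) \<subseteq> ?A" by (rule Poly_Mapping.keys_add)
  then show ?thesis
    using substitute_superset[of ?A p \<kappa> \<theta>] substitute_superset[of ?A q \<kappa> \<theta>] substitute_superset[of ?A "p + q" \<kappa> \<theta>]
    by (simp add: lookup_add algebra_simps sum.distrib comm_homD[OF \<kappa>])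
qed

lemma substitute_mon_mult: "substitute \<kappa> \<theta> (mon m c * q) = substitute \<kappa> \<theta> (mon m c) * substitute \<kappa> \<theta> q"
proof (induction q rule: mpol_induct)
  case zero
  then show ?case by (simp add: substitute_def)
next
  case (add m' c' q)
  then show ?case
    by (simp add: distrib_left substitute_add mult_single substitute_mon monom_eval_add comm_homD[OF \<kappa>] algebra_simps)
qed

lemma comm_hom_substitute: "comm_hom (substitute \<kappa> \<theta>)"
proof -
  have "substitute \<kappa> \<theta> (p * q) = substitute \<kappa> \<theta> p * substitute \<kappa> \<theta> q" for p q
  proof (induction p rule: mpol_induct)
    case zero
    then show ?case by (simp add: substitute_def)
  next
    case (add m c p)
    then show ?case by (simp add: distrib_right substitute_add substitute_mon_mult)
  qed
  moreover have "substitute \<kappa> \<theta> 1 = 1" using substitute_cst[of 1] by (simp add: comm_homD[OF \<kappa>])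
  ultimately show ?thesis by (simp add: comm_hom_def substitute_add)
qed

end

lemma comm_hom_id: "comm_hom (\<lambda>x. x)" by (simp add: comm_hom_def)

lemma peval_eq_substitute: "peval p a = substitute (\<lambda>x. x) a p" by (simp add: peval_def substitute_def)

lemma comm_hom_peval: "comm_hom (\<lambda>p. peval p a)"
  unfolding peval_eq_substitute by (rule comm_hom_substitute[OF comm_hom_id])

lemma peval_var [simp]: "peval (var v) a = a v"
  unfolding peval_eq_substitute by (rule substitute_var[OF comm_hom_id])

lemma peval_cst [simp]: "peval (cst c) a = c"
  unfolding peval_eq_substitute by (rule substitute_cst[OF comm_hom_id])

lemma substitute_graded:
  assumes "\<And>v. \<theta> v \<in> graded 1" "p \<in> graded e"
  shows "substitute (cst :: 'k \<Rightarrow> ('w, 'k::comm_ring_1) mpol) \<theta> p \<in> graded e"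
  unfolding substitute_def
proof (rule graded_sum)
  fix m assume m: "m \<in> Poly_Mapping.keys p"
  have "(\<Prod>v\<in>A. \<theta> v ^ coef m v) \<in> graded (\<Sum>v\<in>A. coef m v)" for A
  proof (induction A rule: infinite_finite_induct)
    case (insert x A)
    then show ?case using graded_mult[OF graded_power[OF assms(1)[of x], of "coef m x"] insert.IH]
      by simp
  qed (use graded_cst[of 1] in auto)
  then have "(\<Prod>v\<in>Poly_Mapping.keys m. \<theta> v ^ coef m v) \<in> graded e"
    using m assms(2) by (auto simp: graded_def mdeg_def)
  then show "cst (coef p m) * (\<Prod>v\<in>Poly_Mapping.keys m. \<theta> v ^ coef m v) \<in> graded e"
    using graded_mult[OF graded_cst] by fastforce
qed

text \<open>An exponent \<open>k\<close> with \<open>k - expo i = m\<close> other than \<open>m + expo i\<close> does not involve \<open>i\<close>, so the truncated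
subtraction in \<open>pd\<close> contributes nothing.\<close>

lemma coef_pd: "coef (pd i p) m = of_nat (Suc (coef m i)) * coef p (m + expo i)"
proof -
  have "coef (pd i p) m = (\<Sum>k\<in>Poly_Mapping.keys p.
      (of_nat (coef k i) * coef p k when k - expo i = m))"
    by (simp add: pd_def lookup_sum lookup_single)
  also have "\<dots> = (\<Sum>k\<in>Poly_Mapping.keys p.
      if k = m + expo i then of_nat (Suc (coef m i)) * coef p (m + expo i) else 0)"
  proof (rule sum.cong[OF refl])
    fix k
    show "(of_nat (coef k i) * coef p k when k - expo i = m) =
        (if k = m + expo i then of_nat (Suc (coef m i)) * coef p (m + expo i) else 0)"
    proof (cases "coef k i = 0")
      case True
      then have "k \<noteq> m + expo i" by (auto simp: lookup_add)
      with True show ?thesis by (simp add: when_def)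
    next
      case False
      then have "k = (k - expo i) + expo i" by (intro exponent_split) simp
      then have "k - expo i = m \<longleftrightarrow> k = m + expo i" by auto
      then show ?thesis by (auto simp: when_def lookup_add)
    qed
  qed
  also have "\<dots> = of_nat (Suc (coef m i)) * coef p (m + expo i)"
    by (auto simp: in_keys_iff)
  finally show ?thesis .
qed

lemma pd_add: "pd i (p + q) = pd i p + pd i q"
  by (rule poly_mapping_eqI) (simp add: coef_pd lookup_add algebra_simps)

lemma pd_mon: "pd i (mon m c) = mon (m - expo i) (of_nat (coef m i) * c)"
  by (cases "c = 0") (simp_all add: pd_def)

lemma pd_cst: "pd i (cst c) = 0" by (simp add: pd_mon)

lemma pd_var: "pd i (var j) = (if i = j then 1 else 0)"
  by (simp add: pd_mon lookup_single when_def)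

lemma pd_mon_mult_mon:
  fixes c c' :: "'k::comm_ring_1" and m m' :: "'v \<Rightarrow>\<^sub>0 nat"
  shows "pd i (mon m c * mon m' c') = pd i (mon m c) * mon m' c' + mon m c * pd i (mon m' c')"
proof -
  have shift: "mon (a + b - expo i) (of_nat (coef a i) * x) =
      mon (a - expo i + b) (of_nat (coef a i) * x)" for a b :: "'v \<Rightarrow>\<^sub>0 nat" and x :: 'k
  proof (cases "coef a i = 0")
    case False
    then have "a = (a - expo i) + expo i" by (intro exponent_split) simp
    moreover have "(c + expo i) + b - expo i = c + b" for c
      using add_diff_cancel_right'[of "c + b" "expo i"] by (simp only: add_ac)
    ultimately have "a + b - expo i = a - expo i + b" by metis
    then show ?thesis by simp
  qed simp
  show ?thesis
    using shift[of m m' "c * c'"] shift[of m' m "c * c'"]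
    by (simp add: mult_single pd_mon lookup_add single_add algebra_simps)
qed

lemma pd_zero [simp]: "pd i 0 = 0" by (simp add: pd_def)

lemma pd_mult: "pd i (p * q) = pd i p * q + p * pd i q"
proof (induction p rule: mpol_induct)
  case (add m c p)
  have "pd i (mon m c * q) = pd i (mon m c) * q + mon m c * pd i q"
  proof (induction q rule: mpol_induct)
    case (add m' c' q)
    then show ?case
      by (simp only: pd_add pd_mon_mult_mon distrib_left) (simp only: add_ac)
  qed simp
  with add show ?case
    by (simp only: pd_add distrib_left distrib_right) (simp only: add_ac)
qed simp

lemma pd_graded:
  assumes "f \<in> graded d"
  shows "pd i f \<in> graded (d - 1)"
  unfolding graded_def
proof (intro CollectI ballI)
  fix m assume "m \<in> Poly_Mapping.keys (pd i f)"
  then have "coef f (m + expo i) \<noteq> 0" by (auto simp: in_keys_iff coef_pd)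
  then have "mdeg (m + expo i) = d" using graded_coef_zero[OF assms] by blast
  then show "mdeg m = d - 1" by simp
qed

definition derivation :: "('b::comm_ring_1 \<Rightarrow> 'b) \<Rightarrow> bool" where
  "derivation D \<longleftrightarrow> (\<forall>x y. D (x + y) = D x + D y) \<and> (\<forall>x y. D (x * y) = D x * y + x * D y)"

text \<open>Both sides are derivations along \<open>h\<close>, and they agree on constants and variables. This transports partial derivatives
through substitutions.\<close>

lemma derivation_hom:
  fixes h :: "('v, 'k::comm_ring_1) mpol \<Rightarrow> 'b::comm_ring_1"
  assumes "comm_hom h" "derivation D" "\<And>c. D (h (cst c)) = 0"
    and "\<And>v. D (h (var v)) = (if v = j then 1 else 0)"
  shows "D (h p) = h (pd j p)"
  by (induction p rule: mpol_ring_induct)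
    (use assms(2) in \<open>auto simp: assms(3,4) pd_cst pd_var comm_homD[OF assms(1)] pd_add pd_mult derivation_def\<close>)

section \<open>Independence and rank as open conditions\<close>

definition full_col_rank :: "'x set \<Rightarrow> 'y set \<Rightarrow> ('x \<Rightarrow> 'y \<Rightarrow> 'k::field) \<Rightarrow> bool" where
  "full_col_rank X Y M \<longleftrightarrow> (\<forall>c. (\<forall>x\<in>X. (\<Sum>y\<in>Y. M x y * c y) = 0) \<longrightarrow> (\<forall>y\<in>Y. c y = 0))"

text \<open>One step of Gaussian elimination with pivot \<open>M x0 y0\<close>, with the denominators cleared so that the entries of the
new matrix are polynomials in the old ones.\<close>

lemma full_col_rank_eliminate:
  assumes "finite Y" "y0 \<notin> Y" "x0 \<in> X" and piv: "M x0 y0 \<noteq> 0"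
  shows "full_col_rank X (insert y0 Y) M \<longleftrightarrow>
    full_col_rank X Y (\<lambda>x y. M x0 y0 * M x y - M x y0 * M x0 y)"
    (is "_ \<longleftrightarrow> full_col_rank X Y ?M'")
proof -
  have elim: "(\<Sum>y\<in>Y. ?M' x y * c y) =
      M x0 y0 * (\<Sum>y\<in>Y. M x y * c y) - M x y0 * (\<Sum>y\<in>Y. M x0 y * c y)" for x c
    by (simp add: sum_distrib_left sum_subtractf[symmetric] algebra_simps)
  show ?thesis
  proof
    assume L: "full_col_rank X (insert y0 Y) M"
    show "full_col_rank X Y ?M'"
      unfolding full_col_rank_def
    proof (intro allI impI)
      fix c assume c: "\<forall>x\<in>X. (\<Sum>y\<in>Y. ?M' x y * c y) = 0"
      define c' where "c' = c(y0 := - (\<Sum>y\<in>Y. M x0 y * c y) / M x0 y0)"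
      have eq: "(\<Sum>y\<in>Y. M x y * c' y) = (\<Sum>y\<in>Y. M x y * c y)" for x
        by (rule sum.cong) (use assms(2) in \<open>auto simp: c'_def\<close>)
      have "(\<Sum>y\<in>insert y0 Y. M x y * c' y) = 0" if "x \<in> X" for x
      proof -
        have "M x0 y0 * (\<Sum>y\<in>insert y0 Y. M x y * c' y) = (\<Sum>y\<in>Y. ?M' x y * c y)"
          using assms(1,2) piv by (simp only: elim) (simp add: eq, simp add: c'_def field_simps)
        then show ?thesis using c that piv by simp
      qed
      then have "\<forall>y\<in>insert y0 Y. c' y = 0" using L unfolding full_col_rank_def by blast
      then show "\<forall>y\<in>Y. c y = 0" using assms(2) by (auto simp: c'_def split: if_splits)
    qed
  next
    assume R: "full_col_rank X Y ?M'"
    show "full_col_rank X (insert y0 Y) M"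
      unfolding full_col_rank_def
    proof (intro allI impI)
      fix c assume "\<forall>x\<in>X. (\<Sum>y\<in>insert y0 Y. M x y * c y) = 0"
      then have s: "(\<Sum>y\<in>Y. M x y * c y) = - (M x y0 * c y0)" if "x \<in> X" for x
        using that assms(1,2) by (simp add: eq_neg_iff_add_eq_0 add.commute)
      have "\<forall>x\<in>X. (\<Sum>y\<in>Y. ?M' x y * c y) = 0"
        using s[OF assms(3)] by (simp add: elim s)
      then have Y0: "\<forall>y\<in>Y. c y = 0" using R unfolding full_col_rank_def by blast
      then have "M x0 y0 * c y0 = 0" using s[OF assms(3)] by simp
      then show "\<forall>y\<in>insert y0 Y. c y = 0" using Y0 piv by simp
    qed
  qed
qed

text \<open>The product of the pivots that elimination meets at the point \<open>a\<close> is a polynomial in the entries, and wherever it does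
not vanish elimination succeeds with the same pivots. It plays the role of a maximal minor. Every column may have its own
degree \<open>\<delta> y\<close>; elimination preserves this, and so the product is a form.\<close>

lemma full_col_rank_open:
  fixes E :: "'x \<Rightarrow> 'y \<Rightarrow> ('w, 'k::field) mpol"
  assumes "finite Y" and "\<And>x y. x \<in> X \<Longrightarrow> y \<in> Y \<Longrightarrow> E x y \<in> graded (\<delta> y)"
    and "full_col_rank X Y (\<lambda>x y. peval (E x y) a)"
  shows "\<exists>H e. H \<in> graded e \<and> peval H a \<noteq> 0 \<and>
    (\<forall>b. peval H b \<noteq> 0 \<longrightarrow> full_col_rank X Y (\<lambda>x y. peval (E x y) b))"
  using assms
proof (induction Y arbitrary: E \<delta> rule: finite_induct)
  case empty
  have "peval 1 a \<noteq> 0" for a :: "'w \<Rightarrow> 'k" by (simp add: peval_one)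
  moreover have "(1 :: ('w, 'k) mpol) \<in> graded 0" using graded_cst[of 1] by simp
  ultimately show ?case by (auto simp: full_col_rank_def)
next
  case (insert y0 Y)
  have "\<exists>x0\<in>X. peval (E x0 y0) a \<noteq> 0"
  proof (rule ccontr)
    assume "\<not> ?thesis"
    then have "\<forall>x\<in>X. (\<Sum>y\<in>insert y0 Y. peval (E x y) a * (if y = y0 then 1 else 0)) = 0"
      using insert.hyps by (simp add: sum.neutral)
    then have "\<forall>y\<in>insert y0 Y. (if y = y0 then 1 else 0 :: 'k) = 0"
      using insert.prems(2) unfolding full_col_rank_def by fast
    then show False by simp
  qed
  then obtain x0 where x0: "x0 \<in> X" "peval (E x0 y0) a \<noteq> 0" by blast
  let ?E = "\<lambda>x y. E x0 y0 * E x y - E x y0 * E x0 y"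
  have pe: "peval (?E x y) b = peval (E x0 y0) b * peval (E x y) b - peval (E x y0) b * peval (E x0 y) b"
    for x y b
    by (simp add: comm_homD[OF comm_hom_peval])
  have "?E x y \<in> graded (\<delta> y0 + \<delta> y)" if "x \<in> X" "y \<in> Y" for x y
    using that x0 insert.prems(1) by (intro graded_minus graded_mult) auto
  moreover have "full_col_rank X Y (\<lambda>x y. peval (?E x y) a)"
    using insert.prems(2) full_col_rank_eliminate[OF insert.hyps x0(1), of "\<lambda>x y. peval (E x y) a"] x0(2)
    unfolding pe by simp
  ultimately obtain H e where H: "H \<in> graded e" "peval H a \<noteq> 0"
    "\<And>b. peval H b \<noteq> 0 \<Longrightarrow> full_col_rank X Y (\<lambda>x y. peval (?E x y) b)"
    using insert.IH[of ?E "\<lambda>y. \<delta> y0 + \<delta> y"] by blast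
  have "full_col_rank X (insert y0 Y) (\<lambda>x y. peval (E x y) b)" if "peval (H * E x0 y0) b \<noteq> 0" for b
    using that H(3)[of b] full_col_rank_eliminate[OF insert.hyps x0(1), of "\<lambda>x y. peval (E x y) b"]
    unfolding pe by (simp add: peval_mult)
  moreover have "H * E x0 y0 \<in> graded (e + \<delta> y0)"
    using H(1) x0 insert.prems(1) by (intro graded_mult) auto
  moreover have "peval (H * E x0 y0) a \<noteq> 0" using H(2) x0 by (simp add: peval_mult)
  ultimately show ?case by blast
qed

text \<open>Independence is a property of the family and not of its set of values: two members of a family that depends on a
parameter may coincide for some parameters, and there the family counts as dependent.\<close>

definition indep_family :: "('i \<Rightarrow> ('v, 'k::field) mpol) \<Rightarrow> 'i set \<Rightarrow> bool" where
  "indep_family w Y \<longleftrightarrow> (\<forall>c. (\<Sum>y\<in>Y. pscale (c y) (w y)) = 0 \<longrightarrow> (\<forall>y\<in>Y. c y = 0))"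

lemma indep_family_image:
  assumes "indep_family w Y" "finite Y"
  shows "inj_on w Y" "pvs.independent (w ` Y)"
proof -
  show inj: "inj_on w Y"
  proof (rule inj_onI, rule ccontr)
    fix y z assume yz: "y \<in> Y" "z \<in> Y" "w y = w z" "y \<noteq> z"
    let ?c = "\<lambda>x. if x = y then 1 else if x = z then -1 else 0"
    have "(\<Sum>x\<in>Y. pscale (?c x) (w x)) = (\<Sum>x\<in>{y, z}. pscale (?c x) (w x))"
      by (rule sum.mono_neutral_right) (use yz assms(2) in auto)
    also have "\<dots> = 0" using yz by simp
    finally show False using assms(1) yz(1) unfolding indep_family_def by fastforce
  qed
  show "pvs.independent (w ` Y)"
  proof (rule pvs.independent_if_scalars_zero)
    show "finite (w ` Y)" using assms(2) by simp
    fix f x assume "(\<Sum>x\<in>w ` Y. pscale (f x) x) = 0" "x \<in> w ` Y"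
    then have "(\<Sum>y\<in>Y. pscale (f (w y)) (w y)) = 0" by (simp add: sum.reindex[OF inj])
    then have "\<forall>y\<in>Y. f (w y) = 0"
      using assms(1) unfolding indep_family_def by (elim allE[of _ "\<lambda>y. f (w y)"]) simp
    then show "f x = 0" using \<open>x \<in> w ` Y\<close> by blast
  qed
qed

lemma finite_basis:
  assumes "V \<subseteq> pvs.span F" "finite F"
  obtains B where "B \<subseteq> V" "pvs.independent B" "V \<subseteq> pvs.span B" "card B = pvs.dim V" "finite B"
proof -
  obtain B where B: "B \<subseteq> V" "pvs.independent B" "V \<subseteq> pvs.span B" "card B = pvs.dim V"
    using pvs.basis_exists by blast
  have "finite B"
    using pvs.independent_span_bound[OF assms(2) B(2) subset_trans[OF B(1) assms(1)]] by (rule conjunct1)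
  from that[OF B this] show ?thesis .
qed

lemma independent_card_le_dim:
  assumes "V \<subseteq> pvs.span F" "finite F" "pvs.independent A" "A \<subseteq> V"
  shows "finite A" "card A \<le> pvs.dim V"
proof -
  obtain B where B: "B \<subseteq> V" "pvs.independent B" "V \<subseteq> pvs.span B" "card B = pvs.dim V" "finite B"
    by (rule finite_basis[OF assms(1,2)])
  then show "finite A" "card A \<le> pvs.dim V"
    using pvs.independent_span_bound[OF B(5) assms(3) subset_trans[OF assms(4) B(3)]] by simp_all
qed

lemma indep_family_card_le_dim:
  assumes "indep_family w Y" "finite Y" "w ` Y \<subseteq> V" "V \<subseteq> pvs.span F" "finite F"
  shows "card Y \<le> pvs.dim V"
  using independent_card_le_dim(2)[OF assms(4,5) indep_family_image(2)[OF assms(1,2)] assms(3)]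
    card_image[OF indep_family_image(1)[OF assms(1,2)]] by simp

lemma independent_card_eq_dim_spans:
  assumes "V \<subseteq> pvs.span F" "finite F" "pvs.independent A" "A \<subseteq> V" "pvs.dim V \<le> card A"
  shows "V \<subseteq> pvs.span A"
proof
  fix v assume v: "v \<in> V"
  show "v \<in> pvs.span A"
  proof (rule ccontr)
    assume nv: "v \<notin> pvs.span A"
    then have "pvs.independent (insert v A)" by (rule pvs.independent_insertI) (rule assms(3))
    moreover have "insert v A \<subseteq> V" using v assms(4) by simp
    ultimately have "finite (insert v A)" "card (insert v A) \<le> pvs.dim V"
      using independent_card_le_dim[OF assms(1,2), of "insert v A"] by simp_all
    moreover have "v \<notin> A" using nv pvs.span_base by blast
    ultimately show False using assms(5) by simp
  qed
qed

lemma indep_family_expand: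
  assumes "indep_family w Y" "finite Y" "w ` Y \<subseteq> V" "V \<subseteq> pvs.span F" "finite F"
    "pvs.dim V \<le> card Y" "v \<in> V"
  obtains c where "v = (\<Sum>y\<in>Y. pscale (c y) (w y))"
proof -
  note ind = indep_family_image[OF assms(1,2)]
  have "v \<in> pvs.span (w ` Y)"
    using independent_card_eq_dim_spans[OF assms(4,5) ind(2) assms(3)] assms(6,7)
    by (auto simp: card_image[OF ind(1)])
  then obtain u where "v = (\<Sum>x\<in>w ` Y. pscale (u x) x)"
    using pvs.span_finite[of "w ` Y"] assms(2) by auto
  then have "v = (\<Sum>y\<in>Y. pscale (u (w y)) (w y))" by (simp add: sum.reindex[OF ind(1)])
  then show ?thesis by (rule that)
qed

lemma indep_family_exists:
  assumes "V \<subseteq> pvs.span F" "finite F" "V = pvs.span (w ` I)"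
  obtains Y where "Y \<subseteq> I" "finite Y" "card Y = pvs.dim V" "indep_family w Y"
proof -
  obtain B where B: "B \<subseteq> w ` I" "pvs.independent B" "w ` I \<subseteq> pvs.span B"
    using pvs.maximal_independent_subset[of "w ` I"] by blast
  have BV: "B \<subseteq> V" using B(1) assms(3) pvs.span_superset by blast
  have "finite B" using independent_card_le_dim(1)[OF assms(1,2) B(2) BV] .
  have "V \<subseteq> pvs.span B" using B(3) assms(3) by (simp add: pvs.span_minimal)
  then have card: "card B = pvs.dim V" using pvs.basis_card_eq_dim[OF BV _ B(2)] by simp
  define g where "g = inv_into I w"
  have g: "g b \<in> I" "w (g b) = b" if "b \<in> B" for b
    using that B(1) by (auto simp: g_def inv_into_into f_inv_into_f subset_iff)
  have inj: "inj_on g B" using g(2) by (metis inj_onI)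
  have "indep_family w (g ` B)"
    unfolding indep_family_def
  proof (intro allI impI)
    fix c assume "(\<Sum>y\<in>g ` B. pscale (c y) (w y)) = 0"
    then have "(\<Sum>b\<in>B. pscale (c (g b)) b) = 0"
      by (simp add: sum.reindex[OF inj] g(2) cong: sum.cong)
    then have "\<forall>b\<in>B. c (g b) = 0"
      using pvs.independentD[OF B(2) \<open>finite B\<close> subset_refl, of "\<lambda>b. c (g b)"] by blast
    then show "\<forall>y\<in>g ` B. c y = 0" by blast
  qed
  then show ?thesis
    using that[of "g ` B"] g(1) \<open>finite B\<close> card by (auto simp: card_image[OF inj])
qed

lemma graded_subset_span_monomials:
  "graded e \<subseteq> pvs.span ((\<lambda>m. mon m (1::'k::field)) ` {m :: 'n \<Rightarrow>\<^sub>0 nat. mdeg m = e})"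
proof
  fix p :: "('n, 'k) mpol" assume p: "p \<in> graded e"
  have "(\<Sum>m\<in>Poly_Mapping.keys p. mon m (coef p m))
      \<in> pvs.span ((\<lambda>m. mon m (1::'k)) ` {m :: 'n \<Rightarrow>\<^sub>0 nat. mdeg m = e})"
  proof (rule pvs.span_sum)
    fix m assume "m \<in> Poly_Mapping.keys p"
    then have "mdeg m = e" using p by (auto simp: graded_def)
    then have "pscale (coef p m) (mon m 1) \<in> pvs.span ((\<lambda>m. mon m (1::'k)) ` {m :: 'n \<Rightarrow>\<^sub>0 nat. mdeg m = e})"
      by (intro pvs.span_scale pvs.span_base) auto
    then show "mon m (coef p m) \<in> pvs.span ((\<lambda>m. mon m (1::'k)) ` {m :: 'n \<Rightarrow>\<^sub>0 nat. mdeg m = e})"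
      by (simp add: pscale_def mult_single)
  qed
  then show "p \<in> pvs.span ((\<lambda>m. mon m 1) ` {m. mdeg m = e})"
    using poly_mapping_sum_monomials[of p] by simp
qed

section \<open>The homogeneous Nullstellensatz\<close>

text \<open>A homogeneous ideal given by its graded pieces: \<open>(N, p) \<in> I\<close> means that \<open>p\<close> belongs to the piece of degree
\<open>N\<close>. The degree is recorded because \<open>0\<close> is homogeneous of every degree.\<close>

definition graded_ideal :: "(nat \<times> ('n, 'k::comm_ring_1) mpol) set \<Rightarrow> bool" where
  "graded_ideal I \<longleftrightarrow> (\<forall>N p. (N, p) \<in> I \<longrightarrow> p \<in> graded N) \<and> (\<forall>N. (N, 0) \<in> I) \<and>
     (\<forall>N p q. (N, p) \<in> I \<longrightarrow> (N, q) \<in> I \<longrightarrow> (N, p + q) \<in> I) \<and>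
     (\<forall>N p m c. (N, p) \<in> I \<longrightarrow> (mdeg m + N, mon m c * p) \<in> I)"

text \<open>Equivalently, \<open>I\<close> contains no power of the ideal generated by the variables.\<close>

definition proper_in_all_degrees :: "(nat \<times> ('n, 'k::comm_ring_1) mpol) set \<Rightarrow> bool" where
  "proper_in_all_degrees I \<longleftrightarrow> (\<forall>N. \<exists>p\<in>graded N. (N, p) \<notin> I)"

lemma graded_idealD:
  assumes "graded_ideal I"
  shows "(N, p) \<in> I \<Longrightarrow> p \<in> graded N" "(N, 0) \<in> I"
    "(N, p) \<in> I \<Longrightarrow> (N, q) \<in> I \<Longrightarrow> (N, p + q) \<in> I"
    "(N, p) \<in> I \<Longrightarrow> (mdeg m + N, mon m c * p) \<in> I"
  using assms unfolding graded_ideal_def by blast+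

lemma graded_ideal_sum:
  assumes "graded_ideal I" "\<And>x. x \<in> A \<Longrightarrow> (N, f x) \<in> I"
  shows "(N, \<Sum>x\<in>A. f x) \<in> I"
  using assms(2)
  by (induction A rule: infinite_finite_induct) (auto intro: graded_idealD[OF assms(1)])

lemma graded_ideal_mult:
  assumes "graded_ideal I" "(N, p) \<in> I" "r \<in> graded s"
  shows "(s + N, r * p) \<in> I"
proof -
  have "(s + N, \<Sum>m\<in>Poly_Mapping.keys r. mon m (coef r m) * p) \<in> I"
  proof (rule graded_ideal_sum[OF assms(1)])
    fix m assume "m \<in> Poly_Mapping.keys r"
    then have "mdeg m = s" using assms(3) by (auto simp: graded_def)
    then show "(s + N, mon m (coef r m) * p) \<in> I" using graded_idealD(4)[OF assms(1,2)] by metis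
  qed
  then show ?thesis using poly_mapping_sum_monomials[of r] by (simp add: sum_distrib_right[symmetric])
qed

lemma graded_ideal_cst_mult: "graded_ideal I \<Longrightarrow> (N, p) \<in> I \<Longrightarrow> (N, cst c * p) \<in> I"
  using graded_ideal_mult[OF _ _ graded_cst] by fastforce

lemma graded_ideal_minus: "graded_ideal I \<Longrightarrow> (N, p) \<in> I \<Longrightarrow> (N, q) \<in> I \<Longrightarrow> (N, p - q) \<in> I"
  using graded_idealD(3)[of I N p "cst (-1) * q"] graded_ideal_cst_mult[of I N q "-1"]
  by (simp add: single_uminus)

lemma graded_ideal_full_if_monomials:
  assumes "graded_ideal I" "\<And>m. mdeg m = N \<Longrightarrow> (N, mon m 1) \<in> I" "p \<in> graded N"
  shows "(N, p) \<in> I"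
proof -
  have "(N, \<Sum>m\<in>Poly_Mapping.keys p. mon m (coef p m)) \<in> I"
  proof (rule graded_ideal_sum[OF assms(1)])
    fix m assume "m \<in> Poly_Mapping.keys p"
    then have "mdeg m = N" using assms(3) by (auto simp: graded_def)
    then have "(N, cst (coef p m) * mon m 1) \<in> I"
      by (intro graded_ideal_cst_mult assms)
    then show "(N, mon m (coef p m)) \<in> I" by (simp add: mult_single)
  qed
  then show ?thesis using poly_mapping_sum_monomials[of p] by simp
qed

lemma graded_ideal_full_upward:
  assumes "graded_ideal I" "\<And>p. p \<in> graded N \<Longrightarrow> (N, p) \<in> I" "p \<in> graded (N + k)"
  shows "(N + k, p) \<in> I"
  using assms(3)
proof (induction k arbitrary: p)
  case 0
  then show ?case using assms(2) by simp
next
  case (Suc k)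
  show ?case
  proof (rule graded_ideal_full_if_monomials[OF assms(1) _ Suc.prems])
    fix m :: "'a \<Rightarrow>\<^sub>0 nat" assume "mdeg m = N + Suc k"
    then have "mdeg m = Suc (N + k)" by simp
    then obtain v m' where m: "m = m' + expo v" "mdeg m' = N + k" by (rule mdeg_pos_obtain)
    then have "(1 + (N + k), var v * mon m' 1) \<in> I"
      by (intro graded_ideal_mult[OF assms(1) Suc.IH graded_var]) (simp add: graded_mon)
    then show "(N + Suc k, mon m 1) \<in> I" by (simp add: mult_single m add.commute)
  qed
qed

text \<open>The homogeneous ideal \<open>I + (a)\<close>, where \<open>a\<close> has degree \<open>s\<close>; its pieces of degree less than \<open>s\<close> are
those of \<open>I\<close>.\<close>

definition adjoin :: "(nat \<times> ('n, 'k::comm_ring_1) mpol) set \<Rightarrow> nat \<Rightarrow> ('n, 'k) mpol \<Rightarrow>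
    (nat \<times> ('n, 'k) mpol) set" where
  "adjoin I s a = {(N, p + r * a) | N p r. (N, p) \<in> I \<and> (if s \<le> N then r \<in> graded (N - s) else r = 0)}"

lemma graded_ideal_adjoin:
  assumes I: "graded_ideal I" and a: "a \<in> graded s"
  shows "graded_ideal (adjoin I s a)"
  unfolding graded_ideal_def
proof (intro conjI allI impI)
  fix N p assume "(N, p) \<in> adjoin I s a"
  then obtain p' r where *: "p = p' + r * a" "(N, p') \<in> I" "if s \<le> N then r \<in> graded (N - s) else r = 0"
    unfolding adjoin_def by blast
  then have "r * a \<in> graded N" using graded_mult[of r "N - s" a s] a by (auto split: if_splits)
  then show "p \<in> graded N" using * graded_idealD(1)[OF I] by (auto intro: graded_add)
next
  fix N
  have "(N, 0 + 0 * a) \<in> adjoin I s a"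
    unfolding adjoin_def using graded_idealD(2)[OF I] by (intro CollectI exI[of _ N] exI[of _ 0]) auto
  then show "(N, 0) \<in> adjoin I s a" by simp
next
  fix N p q assume "(N, p) \<in> adjoin I s a" "(N, q) \<in> adjoin I s a"
  then obtain p' r q' r' where *: "p = p' + r * a" "(N, p') \<in> I" "if s \<le> N then r \<in> graded (N - s) else r = 0"
    "q = q' + r' * a" "(N, q') \<in> I" "if s \<le> N then r' \<in> graded (N - s) else r' = 0"
    unfolding adjoin_def by blast
  have "p + q = (p' + q') + (r + r') * a" using * by (simp add: algebra_simps)
  moreover have "(N, p' + q') \<in> I" using * graded_idealD(3)[OF I] by blast
  moreover have "if s \<le> N then r + r' \<in> graded (N - s) else r + r' = 0"
    using * by (auto intro: graded_add split: if_splits)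
  ultimately show "(N, p + q) \<in> adjoin I s a" unfolding adjoin_def by blast
next
  fix N p m c assume "(N, p) \<in> adjoin I s a"
  then obtain p' r where *: "p = p' + r * a" "(N, p') \<in> I" "if s \<le> N then r \<in> graded (N - s) else r = 0"
    unfolding adjoin_def by blast
  have "mon m c * p = mon m c * p' + (mon m c * r) * a" using * by (simp add: algebra_simps)
  moreover have "(mdeg m + N, mon m c * p') \<in> I" using * graded_idealD(4)[OF I] by blast
  moreover have "if s \<le> mdeg m + N then mon m c * r \<in> graded (mdeg m + N - s) else mon m c * r = 0"
  proof (cases "s \<le> N")
    case True
    then show ?thesis using graded_mult[OF graded_mon[OF refl], of r "N - s" m c] * by simp
  next
    case False
    then show ?thesis using * by simp
  qed
  ultimately show "(mdeg m + N, mon m c * p) \<in> adjoin I s a" unfolding adjoin_def by blast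
qed

lemma adjoin_superset: "I \<subseteq> adjoin I s a"
proof (rule subrelI)
  fix N p assume "(N, p) \<in> I"
  moreover have "p = p + 0 * a" by simp
  moreover have "if s \<le> N then 0 \<in> graded (N - s) else (0 :: ('a, 'b) mpol) = 0" by simp
  ultimately show "(N, p) \<in> adjoin I s a" unfolding adjoin_def by blast
qed

lemma adjoin_contains: "graded_ideal I \<Longrightarrow> (s, a) \<in> adjoin I s a"
proof -
  assume "graded_ideal I"
  then have "(s, 0) \<in> I" by (rule graded_idealD)
  moreover have "a = 0 + 1 * a" by simp
  moreover have "if s \<le> s then 1 \<in> graded (s - s) else (1 :: ('a, 'b) mpol) = 0"
    using graded_cst[of 1] by simp
  ultimately show ?thesis unfolding adjoin_def by blast
qed

text \<open>The union of a chain is again proper in all degrees: if it contained all forms of degree \<open>N\<close>, then one member of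
the chain would contain the finitely many monomials of degree \<open>N\<close>.\<close>

lemma maximal_proper_graded_ideal_exists:
  fixes I :: "(nat \<times> ('n::finite, 'k::comm_ring_1) mpol) set"
  assumes "graded_ideal I" "proper_in_all_degrees I"
  obtains P where "graded_ideal P" "proper_in_all_degrees P" "I \<subseteq> P"
    "\<And>J. graded_ideal J \<Longrightarrow> proper_in_all_degrees J \<Longrightarrow> P \<subseteq> J \<Longrightarrow> J = P"
proof -
  let ?A = "{J. graded_ideal J \<and> proper_in_all_degrees J \<and> I \<subseteq> J}"
  have "\<exists>M\<in>?A. \<forall>X\<in>?A. M \<subseteq> X \<longrightarrow> X = M"
  proof (rule subset_Zorn_nonempty)
    show "?A \<noteq> {}" using assms by blast
    fix C assume C: "C \<noteq> {}" "subset.chain ?A C"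
    then have CA: "J \<in> C \<Longrightarrow> graded_ideal J \<and> proper_in_all_degrees J \<and> I \<subseteq> J" for J
      by (auto simp: subset_chain_def)
    have tot: "J \<subseteq> K \<or> K \<subseteq> J" if "J \<in> C" "K \<in> C" for J K
      using C(2) that by (auto simp: subset_chain_def)
    have gi: "graded_ideal (\<Union>C)"
      unfolding graded_ideal_def
    proof (intro conjI allI impI)
      fix N p assume "(N, p) \<in> \<Union>C"
      then show "p \<in> graded N" using CA graded_idealD(1) by blast
    next
      fix N show "(N, 0) \<in> \<Union>C" using C(1) CA graded_idealD(2) by blast
    next
      fix N p q assume "(N, p) \<in> \<Union>C" "(N, q) \<in> \<Union>C"
      then obtain J K where JK: "J \<in> C" "K \<in> C" "(N, p) \<in> J" "(N, q) \<in> K" by blast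
      with tot[OF JK(1,2)] obtain L where "L \<in> C" "(N, p) \<in> L" "(N, q) \<in> L" by blast
      then show "(N, p + q) \<in> \<Union>C" using CA graded_idealD(3) by blast
    next
      fix N p m c assume "(N, p) \<in> \<Union>C"
      then show "(mdeg m + N, mon m c * p) \<in> \<Union>C" using CA graded_idealD(4) by blast
    qed
    have "proper_in_all_degrees (\<Union>C)"
      unfolding proper_in_all_degrees_def
    proof (rule allI, rule ccontr)
      fix N assume "\<not> (\<exists>p\<in>graded N. (N, p) \<notin> \<Union>C)"
      then have "(\<lambda>m. (N, mon m 1)) ` {m. mdeg m = N} \<subseteq> \<Union>C"
        using graded_mon by blast
      then obtain J where J: "J \<in> C" "(\<lambda>m. (N, mon m 1)) ` {m. mdeg m = N} \<subseteq> J"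
        using finite_subset_Union_chain[of "(\<lambda>m. (N, mon m 1)) ` {m. mdeg m = N}" C ?A] C by auto
      then have "\<forall>p\<in>graded N. (N, p) \<in> J"
        using graded_ideal_full_if_monomials[of J N] CA by blast
      then show False using CA[OF J(1)] unfolding proper_in_all_degrees_def by blast
    qed
    then show "\<Union>C \<in> ?A" using gi C(1) CA by blast
  qed
  then obtain P where "P \<in> ?A" "\<forall>X\<in>?A. P \<subseteq> X \<longrightarrow> X = P" by blast
  then show ?thesis using that[of P] by blast
qed

lemma exponent_of_degree_sum:
  assumes "mdeg m = a + b"
  obtains m1 m2 where "m = m1 + m2" "mdeg m1 = a" "mdeg m2 = b"
proof -
  have "\<exists>m1 m2. m = m1 + m2 \<and> mdeg m1 = a \<and> mdeg m2 = b"
    using assms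
  proof (induction b arbitrary: m)
    case 0
    then show ?case by (intro exI[of _ m] exI[of _ 0]) simp
  next
    case (Suc b)
    then have "mdeg m = Suc (a + b)" by simp
    then obtain v m' where m': "m = m' + expo v" "mdeg m' = a + b" by (rule mdeg_pos_obtain)
    then obtain m1 m2 where "m' = m1 + m2" "mdeg m1 = a" "mdeg m2 = b" using Suc.IH by blast
    then show ?case using m' by (intro exI[of _ m1] exI[of _ "m2 + expo v"]) (simp add: add.assoc)
  qed
  then show ?thesis using that by blast
qed

text \<open>Such an ideal turns out to be the ideal of a single point of projective space.\<close>

locale maximal_proper_graded_ideal =
  fixes P :: "(nat \<times> ('n::finite, 'k::alg_closed_field) mpol) set"
  assumes gi: "graded_ideal P" and proper: "proper_in_all_degrees P"
    and maximal: "\<And>J. graded_ideal J \<Longrightarrow> proper_in_all_degrees J \<Longrightarrow> P \<subseteq> J \<Longrightarrow> J = P"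
begin

text \<open>By maximality \<open>P + (a)\<close> contains all forms of some degree, hence of all larger degrees.\<close>

lemma eventually_generated:
  assumes "a \<in> graded s" "(s, a) \<notin> P"
  obtains N0 where "s \<le> N0" "\<And>N x. N0 \<le> N \<Longrightarrow> x \<in> graded N \<Longrightarrow>
    \<exists>p r. (N, p) \<in> P \<and> r \<in> graded (N - s) \<and> x = p + r * a"
proof -
  let ?J = "adjoin P s a"
  have J: "graded_ideal ?J" by (rule graded_ideal_adjoin[OF gi assms(1)])
  have "?J \<noteq> P" using adjoin_contains[OF gi] assms(2) by blast
  then have "\<not> proper_in_all_degrees ?J" using maximal[OF J _ adjoin_superset] by blast
  then obtain N1 where N1: "\<And>p. p \<in> graded N1 \<Longrightarrow> (N1, p) \<in> ?J"
    unfolding proper_in_all_degrees_def by blast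
  show ?thesis
  proof (rule that[of "max s N1"])
    fix N and x :: "('n, 'k) mpol" assume N: "max s N1 \<le> N" and x: "x \<in> graded N"
    have "(N1 + (N - N1), x) \<in> ?J"
      by (rule graded_ideal_full_upward[OF J N1]) (use N x in auto)
    then have "(N, x) \<in> ?J" using N by simp
    then show "\<exists>p r. (N, p) \<in> P \<and> r \<in> graded (N - s) \<and> x = p + r * a"
      using N unfolding adjoin_def by auto
  qed simp
qed

text \<open>\<open>P\<close> is prime: if \<open>a b \<in> P\<close>, then \<open>P\<close> contains the product of \<open>P + (a)\<close> and \<open>P + (b)\<close>,
and with it all forms of some degree.\<close>

lemma mult_notin:
  assumes a: "a \<in> graded s" "(s, a) \<notin> P" and b: "b \<in> graded t" "(t, b) \<notin> P"
  shows "(s + t, a * b) \<notin> P"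
proof
  assume ab: "(s + t, a * b) \<in> P"
  obtain N1 where N1: "s \<le> N1" "\<And>x. x \<in> graded N1 \<Longrightarrow>
    \<exists>p r. (N1, p) \<in> P \<and> r \<in> graded (N1 - s) \<and> x = p + r * a"
    using eventually_generated[OF a] by (metis order_refl)
  obtain N2 where N2: "t \<le> N2" "\<And>x. x \<in> graded N2 \<Longrightarrow>
    \<exists>p r. (N2, p) \<in> P \<and> r \<in> graded (N2 - t) \<and> x = p + r * b"
    using eventually_generated[OF b] by (metis order_refl)
  have "(N1 + N2, x) \<in> P" if x: "x \<in> graded (N1 + N2)" for x
  proof (rule graded_ideal_full_if_monomials[OF gi _ x])
    fix m :: "'n \<Rightarrow>\<^sub>0 nat" assume "mdeg m = N1 + N2"
    then obtain m1 m2 where m: "m = m1 + m2" "mdeg m1 = N1" "mdeg m2 = N2"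
      by (rule exponent_of_degree_sum)
    obtain p r where p: "(N1, p) \<in> P" "r \<in> graded (N1 - s)" "mon m1 1 = p + r * a"
      using N1(2)[OF graded_mon[OF m(2)]] by blast
    obtain q u where q: "(N2, q) \<in> P" "u \<in> graded (N2 - t)" "mon m2 1 = q + u * b"
      using N2(2)[OF graded_mon[OF m(3)]] by blast
    have "r * a \<in> graded N1" using graded_mult[OF p(2) a(1)] N1(1) by simp
    then have 1: "(N1 + N2, (r * a) * q) \<in> P" by (rule graded_ideal_mult[OF gi q(1)])
    have 2: "(N1 + N2, mon m2 1 * p) \<in> P"
      using graded_ideal_mult[OF gi p(1) graded_mon[OF m(3)]] by (simp add: add.commute)
    have "((N1 - s) + (N2 - t) + (s + t), (r * u) * (a * b)) \<in> P"
      by (rule graded_ideal_mult[OF gi ab graded_mult[OF p(2) q(2)]])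
    then have 3: "(N1 + N2, (r * u) * (a * b)) \<in> P" using N1(1) N2(1) by simp
    have "mon m (1::'k) = mon m1 1 * mon m2 1" by (simp add: m mult_single)
    also have "\<dots> = mon m2 1 * p + ((r * a) * q + (r * u) * (a * b))"
      unfolding p(3) by (simp add: q(3) algebra_simps)
    finally show "(N1 + N2, mon m 1) \<in> P"
      using graded_idealD(3)[OF gi 2 graded_idealD(3)[OF gi 1 3]] by simp
  qed
  then show False using proper unfolding proper_in_all_degrees_def by blast
qed

lemma one_notin: "(0, 1) \<notin> P"
proof
  assume "(0, 1) \<in> P"
  then have "(N, p) \<in> P" if "p \<in> graded N" for N p
    using graded_ideal_mult[OF gi _ that] by fastforce
  then show False using proper unfolding proper_in_all_degrees_def by blast
qed

lemma power_notin:
  assumes "a \<in> graded s" "(s, a) \<notin> P"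
  shows "(s * k, a ^ k) \<notin> P"
proof (induction k)
  case 0
  then show ?case using one_notin by simp
next
  case (Suc k)
  then show ?case using mult_notin[OF assms graded_power[OF assms(1)]] by simp
qed

lemma cst_mult_iff: "c \<noteq> 0 \<Longrightarrow> (N, cst c * p) \<in> P \<longleftrightarrow> (N, p) \<in> P"
proof
  assume "c \<noteq> 0" "(N, cst c * p) \<in> P"
  then have "(N, cst (1 / c) * (cst c * p)) \<in> P" by - (rule graded_ideal_cst_mult[OF gi])
  moreover have "cst (1 / c) * (cst c * p) = p"
    using \<open>c \<noteq> 0\<close> by (simp only: mult.assoc[symmetric] single_const_mult[symmetric]) simp
  ultimately show "(N, p) \<in> P" by simp
qed (rule graded_ideal_cst_mult[OF gi])

lemma variable_outside: obtains i where "(1, var i) \<notin> P"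
proof (rule ccontr)
  assume "\<not> thesis"
  then have all: "(1, var i) \<in> P" for i using that by blast
  have "(1, p) \<in> P" if "p \<in> graded 1" for p
  proof (rule graded_ideal_full_if_monomials[OF gi _ that])
    fix m :: "'n \<Rightarrow>\<^sub>0 nat" assume "mdeg m = 1"
    then have "mdeg m = Suc 0" by simp
    then obtain v m' where "m = m' + expo v" "mdeg m' = 0" by (rule mdeg_pos_obtain)
    then show "(1, mon m 1) \<in> P" using all by (simp add: mdeg_eq_zero_iff)
  qed
  then show False using proper unfolding proper_in_all_degrees_def by blast
qed

text \<open>The binary form in \<open>x\<^sub>j\<close> and \<open>x\<^sub>i\<close> of degree \<open>M\<close> that becomes \<open>q(x\<^sub>j)\<close> for \<open>x\<^sub>i = 1\<close>.\<close>

definition homogenize :: "'n \<Rightarrow> 'n \<Rightarrow> nat \<Rightarrow> 'k poly \<Rightarrow> ('n, 'k) mpol" where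
  "homogenize i j M q = (\<Sum>a\<le>M. cst (coeff q a) * (var j ^ a * var i ^ (M - a)))"

lemma homogenize_linear_factor:
  assumes "degree q \<le> M"
  shows "homogenize i j (Suc M) ([:- c, 1:] * q) = (var j - cst c * var i) * homogenize i j M q"
proof -
  let ?x = "var i :: ('n, 'k) mpol" and ?y = "var j :: ('n, 'k) mpol"
  have co: "coeff ([:- c, 1:] * q) a = (if a = 0 then 0 else coeff q (a - 1)) - c * coeff q a" for a
    by (cases a) simp_all
  have split: "homogenize i j (Suc M) ([:- c, 1:] * q) =
      (\<Sum>a\<le>Suc M. cst (if a = 0 then 0 else coeff q (a - 1)) * (?y ^ a * ?x ^ (Suc M - a))) -
      (\<Sum>a\<le>Suc M. cst c * cst (coeff q a) * (?y ^ a * ?x ^ (Suc M - a)))"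
    unfolding homogenize_def co
    by (simp only: single_diff sum_subtractf[symmetric] left_diff_distrib mult_single add_0)
  have y: "(\<Sum>a\<le>Suc M. cst (if a = 0 then 0 else coeff q (a - 1)) * (?y ^ a * ?x ^ (Suc M - a)))
      = ?y * homogenize i j M q"
    unfolding homogenize_def sum.atMost_Suc_shift by (simp add: sum_distrib_left mult_ac)
  have "coeff q (Suc M) = 0" using assms by (intro coeff_eq_0) simp
  then have "(\<Sum>a\<le>Suc M. cst c * cst (coeff q a) * (?y ^ a * ?x ^ (Suc M - a)))
      = (\<Sum>a\<le>M. cst c * cst (coeff q a) * (?y ^ a * ?x ^ (Suc M - a)))"
    by simp
  also have "\<dots> = cst c * ?x * homogenize i j M q"
    unfolding homogenize_def sum_distrib_left
    by (rule sum.cong[OF refl]) (simp add: Suc_diff_le mult_ac)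
  finally show ?thesis unfolding split y by (simp add: left_diff_distrib)
qed

lemma homogenize_graded: "homogenize i j M q \<in> graded M"
  unfolding homogenize_def
proof (rule graded_sum)
  fix a assume "a \<in> {..M}"
  then show "cst (coeff q a) * (var j ^ a * var i ^ (M - a)) \<in> graded M"
    using graded_mult[OF graded_cst graded_mult[OF graded_power[OF graded_var] graded_power[OF graded_var]],
        of "coeff q a" j a i "M - a"] by simp
qed

text \<open>Over an algebraically closed field a binary form is a product of linear ones. As \<open>P\<close> is prime it contains one of
the factors, and this factor is not \<open>x\<^sub>i\<close>.\<close>

lemma linear_form_from_binary_form:
  assumes i: "(1, var i) \<notin> P" and "q \<noteq> 0" "degree q \<le> M" "(M, homogenize i j M q) \<in> P"
  shows "\<exists>c. (1, var j - cst c * var i) \<in> P"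
  using assms(2-)
proof (induction M arbitrary: q)
  case 0
  then have "(0, cst (coeff q 0) * 1) \<in> P" by (simp add: homogenize_def)
  moreover have "coeff q 0 \<noteq> 0" using 0 by (metis leading_coeff_0_iff le_zero_eq)
  ultimately show ?case using cst_mult_iff one_notin by blast
next
  case (Suc M)
  show ?case
  proof (cases "degree q = 0")
    case True
    then have q: "coeff q a = 0" if "a > 0" for a using that by (simp add: coeff_eq_0)
    have "homogenize i j (Suc M) q = cst (coeff q 0) * var i ^ Suc M"
      unfolding homogenize_def sum.atMost_Suc_shift by (simp add: q)
    moreover have "coeff q 0 \<noteq> 0" using True Suc.prems(1) by (metis leading_coeff_0_iff)
    ultimately have "(Suc M, var i ^ Suc M) \<in> P" using Suc.prems(3) cst_mult_iff by metis
    then show ?thesis using power_notin[OF graded_var i, of "Suc M"] by simp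
  next
    case False
    then obtain c where "poly q c = 0" using alg_closed_imp_poly_has_root by blast
    then obtain q' where q': "q = [:- c, 1:] * q'" by (auto simp: poly_eq_0_iff_dvd elim: dvdE)
    then have nz: "q' \<noteq> 0" using Suc.prems(1) by auto
    then have "degree q = Suc (degree q')" unfolding q' by (subst degree_mult_eq) auto
    then have deg: "degree q' \<le> M" using Suc.prems(2) by simp
    show ?thesis
    proof (cases "(M, homogenize i j M q') \<in> P")
      case True
      then show ?thesis using Suc.IH nz deg by blast
    next
      case False
      have "var j - cst c * var i \<in> graded 1"
        using graded_mult[OF graded_cst graded_var] by (intro graded_minus graded_var) auto
      moreover have "(1 + M, (var j - cst c * var i) * homogenize i j M q') \<in> P"
        using Suc.prems(3) unfolding q' homogenize_linear_factor[OF deg] by simp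
      ultimately show ?thesis using mult_notin[OF _ _ homogenize_graded False] by blast
    qed
  qed
qed

text \<open>If all forms of degree at least \<open>N0\<close> are multiples of \<open>x\<^sub>i\<close> modulo \<open>P\<close>, then in large degrees all of
them come from degree \<open>N0\<close>; so the graded pieces of \<open>R/P\<close> have bounded dimension.\<close>

lemma divide_by_variable_power:
  assumes "\<And>N x. N0 \<le> N \<Longrightarrow> x \<in> graded N \<Longrightarrow>
    \<exists>p r. (N, p) \<in> P \<and> r \<in> graded (N - 1) \<and> x = p + r * var i"
    and "x \<in> graded (N0 + k)"
  shows "\<exists>p r. (N0 + k, p) \<in> P \<and> r \<in> graded N0 \<and> x = p + var i ^ k * r"
  using assms(2)
proof (induction k arbitrary: x)
  case 0
  then show ?case using graded_idealD(2)[OF gi] by (intro exI[of _ 0] exI[of _ x]) simp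
next
  case (Suc k)
  obtain p r where p: "(N0 + Suc k, p) \<in> P" "r \<in> graded (N0 + k)" "x = p + r * var i"
    using assms(1)[OF _ Suc.prems] by auto
  obtain p' r' where p': "(N0 + k, p') \<in> P" "r' \<in> graded N0" "r = p' + var i ^ k * r'"
    using Suc.IH[OF p(2)] by blast
  have "(N0 + Suc k, var i * p') \<in> P" using graded_ideal_mult[OF gi p'(1) graded_var[of i]] by simp
  then have "(N0 + Suc k, p + var i * p') \<in> P" using graded_idealD(3)[OF gi p(1)] by blast
  moreover have "x = (p + var i * p') + var i ^ Suc k * r'"
    unfolding p(3) p'(3) by (simp add: algebra_simps)
  ultimately show ?case using p'(2) by blast
qed

text \<open>There are \<open>M + 1\<close> monomials \<open>x\<^sub>j\<^sup>a x\<^sub>i\<^bsup>M-a\<^esup>\<close>, while the dimension of the graded pieces of \<open>R/P\<close> is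
bounded. For large \<open>M\<close> the monomials are therefore dependent modulo \<open>P\<close>, and a dependency is a nonzero
binary form in \<open>P\<close>.\<close>

lemma linear_form_in_ideal:
  assumes i: "(1, var i) \<notin> P"
  shows "\<exists>c. (1, var j - cst c * var i) \<in> P"
proof -
  obtain N0 where N0: "\<And>N x. N0 \<le> N \<Longrightarrow> x \<in> graded N \<Longrightarrow>
    \<exists>p r. (N, p) \<in> P \<and> r \<in> graded (N - 1) \<and> x = p + r * var i"
    using eventually_generated[OF graded_var i] by blast
  let ?F = "(\<lambda>m. mon m (1::'k)) ` {m :: 'n \<Rightarrow>\<^sub>0 nat. mdeg m = N0}"
  let ?K = "pvs.dim (graded N0 :: ('n, 'k) mpol set)"
  let ?M = "N0 + ?K"
  let ?x = "\<lambda>a. var j ^ a * var i ^ (?M - a) :: ('n, 'k) mpol"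
  have gr: "?x a \<in> graded ?M" if "a \<le> ?M" for a
    using graded_mult[OF graded_power[OF graded_var] graded_power[OF graded_var], of j a i "?M - a"] that
    by simp
  have "\<forall>a. \<exists>p r. a \<le> ?M \<longrightarrow> (?M, p) \<in> P \<and> r \<in> graded N0 \<and> ?x a = p + var i ^ ?K * r"
    using divide_by_variable_power[OF N0 gr] by blast
  then obtain p r where pr: "\<And>a. a \<le> ?M \<Longrightarrow> (?M, p a) \<in> P \<and> r a \<in> graded N0 \<and> ?x a = p a + var i ^ ?K * r a"
    by metis
  have "\<not> indep_family r {..?M}"
  proof
    assume "indep_family r {..?M}"
    then have "card {..?M} \<le> ?K"
      by (rule indep_family_card_le_dim[OF _ _ _ graded_subset_span_monomials]) (use pr in auto)
    then show False by simp
  qed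
  then obtain c a0 where c: "(\<Sum>a\<le>?M. pscale (c a) (r a)) = 0" "a0 \<le> ?M" "c a0 \<noteq> 0"
    unfolding indep_family_def by auto
  define q where "q = (\<Sum>a\<le>?M. monom (c a) a)"
  have cq: "coeff q a = (if a \<le> ?M then c a else 0)" for a
    by (auto simp: q_def coeff_sum)
  have "q \<noteq> 0" using c(2,3) cq[of a0] by auto
  moreover have "degree q \<le> ?M" by (rule degree_le) (simp add: cq)
  moreover have "(?M, homogenize i j ?M q) \<in> P"
  proof -
    have "homogenize i j ?M q = (\<Sum>a\<le>?M. cst (c a) * p a + var i ^ ?K * pscale (c a) (r a))"
      unfolding homogenize_def
    proof (rule sum.cong[OF refl])
      fix a assume "a \<in> {..?M}"
      then have a: "a \<le> ?M" by simp
      then have "?x a = p a + var i ^ ?K * r a" using pr by blast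
      then show "cst (coeff q a) * ?x a = cst (c a) * p a + var i ^ ?K * pscale (c a) (r a)"
        using a by (simp only: cq if_True pscale_def distrib_left) (simp only: mult_ac)
    qed
    also have "\<dots> = (\<Sum>a\<le>?M. cst (c a) * p a)"
      by (simp only: sum.distrib sum_distrib_left[symmetric] c(1)) simp
    finally show ?thesis using pr graded_ideal_cst_mult[OF gi]
      by (auto intro!: graded_ideal_sum[OF gi])
  qed
  ultimately show ?thesis using linear_form_from_binary_form[OF i] by blast
qed

text \<open>Modulo \<open>P\<close> every variable \<open>x\<^sub>j\<close> is a multiple \<open>\<mu>\<^sub>j x\<^sub>i\<close>. Hence a form \<open>F\<close> of degree
\<open>N\<close> is congruent to \<open>F(\<mu>) x\<^sub>i\<^sup>N\<close>, and \<open>x\<^sub>i\<^sup>N\<close> is not in \<open>P\<close>.\<close>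

lemma common_zero: "\<exists>\<mu>. (\<exists>i. \<mu> i \<noteq> 0) \<and> (\<forall>N F. (N, F) \<in> P \<longrightarrow> peval F \<mu> = 0)"
proof -
  obtain i where i: "(1, var i) \<notin> P" by (rule variable_outside)
  have "\<forall>j. \<exists>c. (1, var j - cst c * var i) \<in> P" using linear_form_in_ideal[OF i] by blast
  then obtain \<mu> where \<mu>: "\<And>j. (1, var j - cst (\<mu> j) * var i) \<in> P" by metis
  have mono: "(N, mon m 1 - cst (peval (mon m 1) \<mu>) * var i ^ N) \<in> P" if "mdeg m = N" for N and m :: "'n \<Rightarrow>\<^sub>0 nat"
    using that
  proof (induction N arbitrary: m)
    case 0
    then show ?case using graded_idealD(2)[OF gi] by (simp add: mdeg_eq_zero_iff peval_one)
  next
    case (Suc N)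
    then obtain v m' where m: "m = m' + expo v" "mdeg m' = N" by (meson mdeg_pos_obtain)
    let ?e = "peval (mon m' 1) \<mu>"
    have 1: "(1 + N, var v * (mon m' 1 - cst ?e * var i ^ N)) \<in> P"
      by (rule graded_ideal_mult[OF gi Suc.IH[OF m(2)] graded_var])
    have "cst ?e * var i ^ N \<in> graded (0 + 1 * N)"
      by (intro graded_mult graded_cst graded_power graded_var)
    then have 2: "(0 + 1 * N + 1, (cst ?e * var i ^ N) * (var v - cst (\<mu> v) * var i)) \<in> P"
      by (rule graded_ideal_mult[OF gi \<mu>])
    have mm: "mon m 1 = var v * mon m' (1::'k)" by (simp add: m mult_single add.commute)
    have "peval (mon m 1) \<mu> = ?e * \<mu> v" unfolding mm peval_mult by simp
    then have "mon m 1 - cst (peval (mon m 1) \<mu>) * var i ^ Suc N =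
      var v * (mon m' 1 - cst ?e * var i ^ N) + (cst ?e * var i ^ N) * (var v - cst (\<mu> v) * var i)"
      unfolding mm by (simp add: single_const_mult algebra_simps)
    then show ?case using graded_idealD(3)[OF gi 1] 2 by simp
  qed
  have "peval F \<mu> = 0" if F: "(N, F) \<in> P" for N F
  proof (rule ccontr)
    assume nz: "peval F \<mu> \<noteq> 0"
    have FN: "F \<in> graded N" using graded_idealD(1)[OF gi F] .
    have "(N, \<Sum>m\<in>Poly_Mapping.keys F. cst (coef F m) * (mon m 1 - cst (peval (mon m 1) \<mu>) * var i ^ N)) \<in> P"
    proof (rule graded_ideal_sum[OF gi])
      fix m assume "m \<in> Poly_Mapping.keys F"
      then have "mdeg m = N" using FN by (auto simp: graded_def)
      then show "(N, cst (coef F m) * (mon m 1 - cst (peval (mon m 1) \<mu>) * var i ^ N)) \<in> P"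
        by - (rule graded_ideal_cst_mult[OF gi mono])
    qed
    also have "(\<Sum>m\<in>Poly_Mapping.keys F. cst (coef F m) * (mon m 1 - cst (peval (mon m 1) \<mu>) * var i ^ N))
      = (\<Sum>m\<in>Poly_Mapping.keys F. mon m (coef F m) -
          cst (coef F m * peval (mon m 1) \<mu>) * var i ^ N)"
      by (simp only: right_diff_distrib mult.assoc[symmetric] mult_single) simp
    also have "\<dots> = (\<Sum>m\<in>Poly_Mapping.keys F. mon m (coef F m)) -
        cst (\<Sum>m\<in>Poly_Mapping.keys F. coef F m * peval (mon m 1) \<mu>) * var i ^ N"
      by (simp only: sum_subtractf comm_hom_sum[OF comm_hom_cst] sum_distrib_right)
    also have "(\<Sum>m\<in>Poly_Mapping.keys F. coef F m * peval (mon m 1) \<mu>) = peval F \<mu>"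
      by (simp add: peval_def[of F] peval_single)
    finally have "(N, F - cst (peval F \<mu>) * var i ^ N) \<in> P"
      using poly_mapping_sum_monomials[of F] by simp
    then have "(N, F - (F - cst (peval F \<mu>) * var i ^ N)) \<in> P" by (rule graded_ideal_minus[OF gi F])
    then have "(N, var i ^ N) \<in> P" using cst_mult_iff[OF nz] by simp
    then show False using power_notin[OF graded_var i, of N] by simp
  qed
  moreover have "\<mu> i \<noteq> 0"
  proof
    assume "\<mu> i = 0"
    then show False using \<mu>[of i] i by simp
  qed
  ultimately show ?thesis by blast
qed

end

theorem homogeneous_nullstellensatz:
  fixes I :: "(nat \<times> ('n::finite, 'k::alg_closed_field) mpol) set"
  assumes "graded_ideal I" "proper_in_all_degrees I"
  obtains \<mu> i where "\<mu> i \<noteq> 0" "\<And>N F. (N, F) \<in> I \<Longrightarrow> peval F \<mu> = 0"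
proof -
  obtain P where "graded_ideal P" "proper_in_all_degrees P" "I \<subseteq> P"
    "\<And>J. graded_ideal J \<Longrightarrow> proper_in_all_degrees J \<Longrightarrow> P \<subseteq> J \<Longrightarrow> J = P"
    using maximal_proper_graded_ideal_exists[OF assms] by blast
  then interpret maximal_proper_graded_ideal P by unfold_locales blast+
  show ?thesis using common_zero \<open>I \<subseteq> P\<close> that by blast
qed

section \<open>Repeated factors on a generic line\<close>

text \<open>A greatest common divisor over the fraction field of the coefficient ring, with its denominators cleared: \<open>P\<close> is a
nonzero element of least degree in the ideal \<open>(A, B)\<close>. The remainder of a pseudo-division by \<open>P\<close> lies in the
ideal, hence is \<open>0\<close>.\<close>

lemma fraction_free_bezout:
  fixes A B :: "'a::idom poly"
  assumes "A \<noteq> 0"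
  obtains P u w c where "P \<noteq> 0" "P = u * A + w * B" "c \<noteq> 0" "P dvd smult c A" "P dvd smult c B"
proof -
  let ?S = "\<lambda>p. p \<noteq> 0 \<and> (\<exists>u w. p = u * A + w * B)"
  have "?S A" using assms by (intro conjI exI[of _ 1] exI[of _ 0]) simp_all
  then obtain P where P: "?S P" and min: "\<And>p. ?S p \<Longrightarrow> degree P \<le> degree p"
    using ex_has_least_nat[of ?S A degree] by blast
  obtain u w where uw: "P = u * A + w * B" using P by blast
  have red: "\<exists>c. c \<noteq> 0 \<and> P dvd smult c X" if X: "X = x * A + y * B" for X x y
  proof -
    obtain q r where qr: "pseudo_divmod X P = (q, r)" by fastforce
    let ?c = "lead_coeff P ^ (Suc (degree X) - degree P)"
    have eq: "smult ?c X = P * q + r" and deg: "r = 0 \<or> degree r < degree P"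
      using pseudo_divmod[OF conjunct1[OF P] qr] by auto
    have "r = smult ?c X - P * q" using eq by simp
    also have "\<dots> = (smult ?c x - u * q) * A + (smult ?c y - w * q) * B"
      unfolding X by (subst uw) (simp add: algebra_simps smult_add_right)
    finally have "r = 0" using min[of r] deg by fastforce
    then have "P dvd smult ?c X" using eq by simp
    moreover have "?c \<noteq> 0" using P by simp
    ultimately show ?thesis by blast
  qed
  obtain c where c: "c \<noteq> 0" "P dvd smult c A" using red[of A 1 0] by auto
  obtain c' where c': "c' \<noteq> 0" "P dvd smult c' B" using red[of B 0 1] by auto
  have "P dvd smult (c * c') A" using c(2) dvd_smult[of P "smult c A" c'] by (simp add: mult.commute)
  moreover have "P dvd smult (c * c') B" using c'(2) dvd_smult[of P "smult c' B" c] by simp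
  ultimately show ?thesis using that[of P u w "c * c'"] P uw c(1) c'(1) by simp
qed

text \<open>Pseudo-division of \<open>G\<close> by \<open>F\<close> multiplies \<open>G\<close> only by a unit, and \<open>F\<close> divides \<open>c\<close> times the
remainder, which is impossible by degree unless the remainder is \<open>0\<close>.\<close>

lemma dvd_smult_cancel_unit_lead:
  fixes F G :: "'a::idom poly"
  assumes dvd: "F dvd smult c G" and c: "c \<noteq> 0" and unit: "lead_coeff F dvd 1"
  shows "F dvd G"
proof -
  have F0: "F \<noteq> 0" using unit by auto
  obtain q r where qr: "pseudo_divmod G F = (q, r)" by fastforce
  let ?l = "lead_coeff F ^ (Suc (degree G) - degree F)"
  have eq: "smult ?l G = F * q + r" and deg: "r = 0 \<or> degree r < degree F"
    using pseudo_divmod[OF F0 qr] by auto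
  have "F dvd smult c (smult ?l G)" using dvd_smult[OF dvd, of ?l] by (simp add: mult.commute)
  then have "F dvd smult c (F * q + r)" unfolding eq .
  then have "F dvd smult c r"
    by (simp add: smult_add_right dvd_add_right_iff dvd_smult)
  then have "r = 0" using deg c dvd_imp_degree_le[of F "smult c r"] by fastforce
  have "?l dvd 1" using dvd_power_same[OF unit] by (simp only: power_one)
  then obtain z where "1 = ?l * z" by (elim dvdE)
  then have "G = smult z (smult ?l G)" by (simp add: mult.commute)
  also have "\<dots> = F * smult z q" using eq \<open>r = 0\<close> by simp
  finally show ?thesis by (metis dvd_triv_left)
qed

lemma dvd_power_diff: "e dvd x - y \<Longrightarrow> e dvd x ^ n - y ^ n" for e x y :: "'a::comm_ring_1"
proof (induction n)
  case (Suc n)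
  have "x ^ Suc n - y ^ Suc n = x * (x ^ n - y ^ n) + (x - y) * y ^ n" by (simp add: algebra_simps)
  then show ?case using Suc by (metis dvd_add dvd_mult dvd_mult2)
qed simp

text \<open>Over the fraction field let \<open>D = gcd(F, G)\<close> and \<open>E' = F / D\<close>. A common factor \<open>P\<close> of \<open>E'\<close> and
\<open>D\<close> is a repeated factor of \<open>F\<close>. If \<open>P\<close> were constant, then \<open>E'\<close> would be coprime to \<open>G\<close>; as
\<open>E'\<close> divides \<open>F\<close> and thus \<open>G\<^sup>r\<close>, it would be constant, and \<open>F\<close> would divide \<open>G\<close> like \<open>D\<close>
does. The constant \<open>c\<close> collects the denominators.\<close>

lemma square_factor_if_not_radical:
  fixes F G :: "'a::idom poly"
  assumes unit: "lead_coeff F dvd 1" and pow: "F dvd G ^ r" and ndvd: "\<not> F dvd G"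
  obtains c P Q where "c \<noteq> 0" "degree P > 0" "[:c:] * F = P\<^sup>2 * Q"
proof -
  have F0: "F \<noteq> 0" using unit by auto
  obtain D u w c1 where D: "D \<noteq> 0" "D = u * F + w * G" "c1 \<noteq> 0" "D dvd smult c1 F" "D dvd smult c1 G"
    using fraction_free_bezout[OF F0] by metis
  obtain E' where E': "smult c1 F = D * E'" using D(4) by (elim dvdE)
  obtain G' where G': "smult c1 G = D * G'" using D(5) by (elim dvdE)
  have E0: "E' \<noteq> 0" using E' F0 D(3) by auto
  obtain P u' w' c2 where P: "P \<noteq> 0" "P = u' * E' + w' * D" "c2 \<noteq> 0" "P dvd smult c2 E'" "P dvd smult c2 D"
    using fraction_free_bezout[OF E0] by metis
  obtain E'' where E'': "smult c2 E' = P * E''" using P(4) by (elim dvdE)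
  obtain D'' where D'': "smult c2 D = P * D''" using P(5) by (elim dvdE)
  have "[:c2 * c2 * c1:] * F = smult (c2 * c2) (smult c1 F)" by simp
  also have "\<dots> = smult c2 D * smult c2 E'" unfolding E' by simp
  also have "\<dots> = P\<^sup>2 * (D'' * E'')" unfolding E'' D'' by (simp add: power2_eq_square mult_ac)
  finally have sq: "[:c2 * c2 * c1:] * F = P\<^sup>2 * (D'' * E'')" .
  have "degree P > 0"
  proof (rule ccontr)
    assume "\<not> degree P > 0"
    then have degP: "degree P = 0" by simp
    \<comment> \<open>up to a constant, \<open>P\<close> is \<open>D\<close> times a polynomial modulo \<open>E'\<close>, and \<open>D\<close> in turn is a multiple of \<open>G\<close>\<close>
    have "smult c1 P = (smult c1 u' + w' * u * D) * E' + (smult c1 (w * w')) * G"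
    proof -
      have "smult c1 D = u * (D * E') + smult c1 w * G"
        by (subst D(2)) (simp add: smult_add_right E'[symmetric])
      then have "smult c1 P = smult c1 u' * E' + w' * (u * (D * E') + smult c1 w * G)"
        unfolding P(2) by (simp add: smult_add_right flip: mult_smult_right)
      then show ?thesis by (simp add: algebra_simps)
    qed
    then have "E' dvd smult c1 P - smult c1 (w * w') * G" by simp
    then have "E' dvd (smult c1 P) ^ r - (smult c1 (w * w') * G) ^ r" by (rule dvd_power_diff)
    then have 1: "E' dvd smult c1 ((smult c1 P) ^ r - (smult c1 (w * w') * G) ^ r)" by (rule dvd_smult)
    have "E' dvd smult c1 F" unfolding E' by simp
    moreover have "smult c1 F dvd smult c1 (G ^ r)"
      using pow by (metis dvd_def mult_smult_left)
    ultimately have "E' dvd smult c1 (G ^ r)" by (rule dvd_trans)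
    then have "E' dvd smult c1 (G ^ r) * (smult c1 (w * w')) ^ r" by (rule dvd_mult2)
    then have 2: "E' dvd smult c1 ((smult c1 (w * w') * G) ^ r)"
      by (simp only: power_mult_distrib mult_smult_left mult.commute)
    have "E' dvd smult c1 ((smult c1 P) ^ r)"
      using dvd_add[OF 1 2] by (simp add: smult_diff_right)
    moreover have "smult c1 ((smult c1 P) ^ r) \<noteq> 0" using P(1) D(3) by simp
    moreover have "degree (smult c1 ((smult c1 P) ^ r)) = 0"
      using degP by (simp add: degree_power_eq P(1) D(3))
    ultimately have "degree E' = 0" using dvd_imp_degree_le by fastforce
    then obtain \<epsilon> where \<epsilon>: "E' = [:\<epsilon>:]" by (rule degree_eq_zeroE)
    with E0 have "\<epsilon> \<noteq> 0" by auto
    have "smult (\<epsilon> * c1) G = smult \<epsilon> D * G'" using G' by (metis smult_smult mult_smult_left)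
    also have "smult \<epsilon> D = smult c1 F" unfolding E' \<epsilon> by simp
    finally have "smult (\<epsilon> * c1) G = F * smult c1 G'" by simp
    then have "F dvd smult (\<epsilon> * c1) G" by (rule dvdI)
    then show False using dvd_smult_cancel_unit_lead[OF _ _ unit] ndvd \<open>\<epsilon> \<noteq> 0\<close> D(3) by auto
  qed
  then show ?thesis using that[OF _ _ sq] P(3) D(3) by simp
qed

text \<open>The derivative of \<open>P\<^sup>2 Q\<close> is divisible by \<open>P\<close>. One factor \<open>C\<close> comes from \<open>D (C F)\<close>, the second one
absorbs the term \<open>D C \<cdot> F\<close>.\<close>

lemma derivation_square_factor:
  assumes D: "derivation D" and eq: "C * F = P\<^sup>2 * (Q :: 'b::comm_ring_1)"
  shows "P dvd C\<^sup>2 * D F"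
proof -
  have m: "D (x * y) = D x * y + x * D y" for x y using D by (simp add: derivation_def)
  have "D C * F + C * D F = D (P\<^sup>2 * Q)" unfolding m[symmetric] eq ..
  also have "\<dots> = P * (2 * D P * Q + P * D Q)" by (simp add: m power2_eq_square algebra_simps)
  finally have CDF: "C * D F = P * (2 * D P * Q + P * D Q) - D C * F" by (simp add: algebra_simps)
  have "C\<^sup>2 * D F = C * (C * D F)" by (simp add: power2_eq_square mult_ac)
  also have "\<dots> = C * (P * (2 * D P * Q + P * D Q)) - D C * (C * F)"
    unfolding CDF by (simp add: right_diff_distrib mult_ac)
  also have "\<dots> = P * (C * (2 * D P * Q + P * D Q) - D C * (P * Q))"
    unfolding eq by (simp add: power2_eq_square algebra_simps)
  finally show ?thesis by simp
qed

lemma derivation_sum: "derivation D \<Longrightarrow> D (\<Sum>x\<in>A. f x) = (\<Sum>x\<in>A. D (f x))"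
proof (induction A rule: infinite_finite_induct)
  case (insert x A)
  then show ?case by (simp add: derivation_def)
next
  case empty
  then have "D (0 + 0) = D 0 + D 0" unfolding derivation_def by blast
  then show ?case by simp
next
  case (infinite A)
  then have "D (0 + 0) = D 0 + D 0" unfolding derivation_def by blast
  then show ?case using infinite by simp
qed

lemma derivation_pd: "derivation (pd i)"
  by (simp add: derivation_def pd_add pd_mult)

lemma derivation_map_poly:
  assumes "derivation D"
  shows "derivation (map_poly D)"
proof -
  have D0: "D 0 = 0" using derivation_sum[OF assms, of "\<lambda>x. x" "{}"] by simp
  have Da: "D (x + y) = D x + D y" and Dm: "D (x * y) = D x * y + x * D y" for x y
    using assms by (simp_all add: derivation_def)
  show ?thesis
    unfolding derivation_def
    by (auto intro!: poly_eqI
        simp: coeff_map_poly D0 Da Dm coeff_mult derivation_sum[OF assms] sum.distrib)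
qed

lemma comm_hom_poly: "comm_hom (\<lambda>p. poly p s)" by (simp add: comm_hom_def)

lemma comm_hom_pCons: "comm_hom h \<Longrightarrow> comm_hom (\<lambda>c. [:h c:])"
  by (simp add: comm_hom_def one_pCons)

text \<open>In characteristic \<open>0\<close> a nonzero form of positive degree has a nonzero partial derivative, which has a nonzero value
at some point \<open>a\<close> by induction. So the form does not vanish identically on the line through \<open>a\<close> in the
direction of that coordinate.\<close>

lemma exists_nonzero_value:
  fixes f :: "('n, 'k::field_char_0) mpol"
  assumes "f \<in> graded d" "f \<noteq> 0"
  shows "\<exists>a. peval f a \<noteq> 0"
  using assms
proof (induction d arbitrary: f)
  case 0
  then obtain m where m: "coef f m \<noteq> 0" by (metis lookup_zero poly_mapping_eqI)
  have "f = cst (coef f 0)"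
  proof (rule poly_mapping_eqI)
    fix k show "coef f k = coef (cst (coef f 0)) k"
      using graded_coef_zero[OF 0(1), of k] by (auto simp: lookup_single when_def mdeg_eq_zero_iff)
  qed
  then have "peval f a = coef f 0" for a by (metis peval_cst)
  moreover have "m = 0" using graded_coef_zero[OF 0(1), of m] m by (auto simp: mdeg_eq_zero_iff)
  ultimately show ?case using m by simp
next
  case (Suc d)
  obtain m where m: "coef f m \<noteq> 0" using Suc.prems(2) by (metis lookup_zero poly_mapping_eqI)
  then have "mdeg m = Suc d" using graded_coef_zero[OF Suc.prems(1)] by blast
  then obtain i m' where m': "m = m' + expo i" "mdeg m' = d" by (rule mdeg_pos_obtain)
  have "coef (pd i f) m' = of_nat (Suc (coef m' i)) * coef f m" by (simp only: coef_pd m'(1))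
  then have "coef (pd i f) m' \<noteq> 0" using m by (simp del: of_nat_Suc)
  then have "pd i f \<noteq> 0" by auto
  moreover have "pd i f \<in> graded d" using pd_graded[OF Suc.prems(1), of i] by simp
  ultimately obtain a where a: "peval (pd i f) a \<noteq> 0" using Suc.IH by blast
  let ?h = "substitute (\<lambda>c. [:c:]) (\<lambda>j. [:a j, if j = i then 1 else 0:])"
  have \<kappa>: "comm_hom (\<lambda>c::'k. [:c:])" by (rule comm_hom_pCons[OF comm_hom_id])
  have h: "comm_hom ?h" by (rule comm_hom_substitute[OF \<kappa>])
  have der: "derivation (pderiv :: 'k poly \<Rightarrow> 'k poly)"
    by (simp add: derivation_def pderiv_add pderiv_mult)
  have "pderiv (?h f) = ?h (pd i f)"
    by (rule derivation_hom[OF h der]) (simp_all add: substitute_cst[OF \<kappa>] substitute_var[OF \<kappa>] pderiv_pCons)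
  moreover have "poly (?h p) s = peval p (\<lambda>j. a j + s * (if j = i then 1 else 0))" for p s
    by (rule comm_hom_eqI[OF comm_hom_comp[OF comm_hom_poly h] comm_hom_peval])
      (simp_all add: substitute_cst[OF \<kappa>] substitute_var[OF \<kappa>])
  note val = this
  have "poly (?h (pd i f)) 0 \<noteq> 0" using a by (simp add: val)
  ultimately have "?h f \<noteq> 0" by auto
  then obtain s where "poly (?h f) s \<noteq> 0" using poly_all_0_iff_0 by blast
  then show ?case unfolding val by blast
qed

lemma power_form_nonzero:
  fixes l :: "('n, 'k::field_char_0) mpol"
  assumes "l \<in> graded e" "l \<noteq> 0"
  shows "l ^ k \<noteq> 0"
proof -
  obtain a where "peval l a \<noteq> 0" using exists_nonzero_value[OF assms] by blast
  then have "peval (l ^ k) a \<noteq> 0" by (simp add: comm_homD(7)[OF comm_hom_peval])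
  moreover have "peval 0 a = 0" by (rule comm_homD(4)[OF comm_hom_peval])
  ultimately show ?thesis by metis
qed

text \<open>A copy of the polynomial ring in variables indexed by natural numbers. The target is an integral domain as a type, since
its variables are ordered; the index type \<open>'n\<close> carries no order.\<close>

definition embed_vars :: "('n::finite \<Rightarrow> nat) \<Rightarrow> ('n, 'k::field) mpol \<Rightarrow> (nat, 'k) mpol" where
  "embed_vars \<iota> = substitute cst (\<lambda>j. var (\<iota> j))"

text \<open>The polynomial \<open>f(x + s v)\<close> in \<open>s\<close>, where \<open>x\<close> is the generic point with coordinates the variables
(indexed by natural numbers via \<open>\<iota>\<close>).\<close>

definition generic_line :: "('n::finite \<Rightarrow> nat) \<Rightarrow> ('n \<Rightarrow> 'k::field) \<Rightarrow> ('n, 'k) mpol \<Rightarrow> (nat, 'k) mpol poly" where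
  "generic_line \<iota> v = substitute (\<lambda>c. [:cst c:]) (\<lambda>j. [:var (\<iota> j), cst (v j):])"

lemma comm_hom_embed_vars: "comm_hom (embed_vars \<iota>)"
  unfolding embed_vars_def by (rule comm_hom_substitute[OF comm_hom_cst])

lemma embed_vars_cst: "embed_vars \<iota> (cst c) = cst c"
  unfolding embed_vars_def by (rule substitute_cst[OF comm_hom_cst])

lemma embed_vars_var: "embed_vars \<iota> (var j) = var (\<iota> j)"
  unfolding embed_vars_def by (rule substitute_var[OF comm_hom_cst])

lemma embed_vars_retract:
  assumes "inj \<iota>"
  shows "substitute cst (\<lambda>n. var (inv \<iota> n)) (embed_vars \<iota> p) = p"
  by (rule comm_hom_eqI[OF comm_hom_comp[OF comm_hom_substitute[OF comm_hom_cst] comm_hom_embed_vars] comm_hom_id])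
    (simp_all add: embed_vars_cst embed_vars_var substitute_cst[OF comm_hom_cst] substitute_var[OF comm_hom_cst] inv_f_f[OF assms]
      del: One_nat_def)

lemma comm_hom_cst_poly: "comm_hom (\<lambda>c::'k::comm_ring_1. [:cst c :: (nat, 'k) mpol:])"
  by (rule comm_hom_pCons[OF comm_hom_cst])

lemma comm_hom_generic_line: "comm_hom (generic_line \<iota> v)"
  unfolding generic_line_def by (rule comm_hom_substitute[OF comm_hom_cst_poly])

lemma generic_line_cst: "generic_line \<iota> v (cst c) = [:cst c:]"
  unfolding generic_line_def by (rule substitute_cst[OF comm_hom_cst_poly])

lemma generic_line_var: "generic_line \<iota> v (var j) = [:var (\<iota> j), cst (v j):]"
  unfolding generic_line_def by (rule substitute_var[OF comm_hom_cst_poly])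

lemma generic_line_at_zero: "poly (generic_line \<iota> v p) 0 = embed_vars \<iota> p"
  by (rule comm_hom_eqI[OF comm_hom_comp[OF comm_hom_poly comm_hom_generic_line] comm_hom_embed_vars])
    (simp_all add: generic_line_cst generic_line_var embed_vars_cst embed_vars_var)

lemma generic_line_dvd_reflect:
  assumes "inj \<iota>" "generic_line \<iota> v f dvd generic_line \<iota> v g"
  shows "f dvd g"
proof -
  have "embed_vars \<iota> f dvd embed_vars \<iota> g"
    using comm_hom_dvd[OF comm_hom_poly assms(2), of 0] by (simp add: generic_line_at_zero)
  from comm_hom_dvd[OF comm_hom_substitute[OF comm_hom_cst] this, of "\<lambda>n. var (inv \<iota> n)"]
  show ?thesis by (simp add: embed_vars_retract[OF assms(1)])
qed

lemma generic_line_derivation: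
  assumes "inj \<iota>"
  shows "map_poly (pd (\<iota> j)) (generic_line \<iota> v f) = generic_line \<iota> v (pd j f)"
proof (rule derivation_hom[OF comm_hom_generic_line derivation_map_poly[OF derivation_pd]])
  show "map_poly (pd (\<iota> j)) (generic_line \<iota> v (cst c)) = 0" for c
    by (simp add: generic_line_cst map_poly_pCons pd_cst)
  show "map_poly (pd (\<iota> j)) (generic_line \<iota> v (var k)) = (if k = j then 1 else 0)" for k
    using assms by (auto simp: generic_line_var map_poly_pCons pd_cst pd_var one_pCons inj_eq simp del: One_nat_def)
qed

text \<open>The degree bounds may be strict, so this is more than multiplicativity of leading coefficients.\<close>

lemma coeff_mult_top:
  assumes "degree p \<le> a" "degree q \<le> b"
  shows "coeff (p * q) (a + b) = coeff p a * coeff q b"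
proof -
  have "coeff (p * q) (a + b) = (\<Sum>i\<le>a + b. if i = a then coeff p a * coeff q b else 0)"
    unfolding coeff_mult
  proof (rule sum.cong[OF refl])
    fix i assume "i \<in> {..a + b}"
    then have "i < a \<Longrightarrow> b < a + b - i" by simp
    then show "coeff p i * coeff q (a + b - i) = (if i = a then coeff p a * coeff q b else 0)"
      using assms by (cases i a rule: linorder_cases) (auto simp: coeff_eq_0)
  qed
  then show ?thesis by simp
qed

lemma generic_line_top:
  fixes f :: "('n::finite, 'k::field) mpol"
  assumes "f \<in> graded d"
  shows "degree (generic_line \<iota> v f) \<le> d" "coeff (generic_line \<iota> v f) d = cst (peval f v)"
proof -
  let ?\<theta> = "\<lambda>j. [:var (\<iota> j), cst (v j):] :: (nat, 'k) mpol poly"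
  have pow: "degree (?\<theta> j ^ k) \<le> k \<and> coeff (?\<theta> j ^ k) k = cst (v j ^ k)" for j k
  proof (induction k)
    case 0
    then show ?case by simp
  next
    case (Suc k)
    have lin: "degree (?\<theta> j) \<le> 1" "coeff (?\<theta> j) 1 = cst (v j)" by simp_all
    have "degree (?\<theta> j * ?\<theta> j ^ k) \<le> 1 + k"
      using degree_mult_le[of "?\<theta> j" "?\<theta> j ^ k"] lin(1) Suc by linarith
    moreover have "coeff (?\<theta> j * ?\<theta> j ^ k) (1 + k) = cst (v j * v j ^ k)"
      using coeff_mult_top[OF lin(1) conjunct1[OF Suc]] lin(2) Suc by (simp only: single_const_mult)
    ultimately show ?case by (simp only: power_Suc plus_1_eq_Suc)
  qed
  have prod: "degree (\<Prod>j\<in>A. ?\<theta> j ^ m j) \<le> (\<Sum>j\<in>A. m j) \<and>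
      coeff (\<Prod>j\<in>A. ?\<theta> j ^ m j) (\<Sum>j\<in>A. m j) = cst (\<Prod>j\<in>A. v j ^ m j)" if "finite A" for A m
    using that
  proof (induction A rule: finite_induct)
    case empty
    then show ?case by simp
  next
    case (insert x A)
    then show ?case
      using degree_mult_le[of "?\<theta> x ^ m x" "\<Prod>j\<in>A. ?\<theta> j ^ m j"] pow[of x "m x"]
        coeff_mult_top[of "?\<theta> x ^ m x" "m x" "\<Prod>j\<in>A. ?\<theta> j ^ m j" "\<Sum>j\<in>A. m j"]
      by (auto simp: single_const_mult simp del: One_nat_def)
  qed
  have tm: "degree ([:cst c:] * (\<Prod>j\<in>Poly_Mapping.keys m. ?\<theta> j ^ coef m j)) \<le> d \<and>
      coeff ([:cst c:] * (\<Prod>j\<in>Poly_Mapping.keys m. ?\<theta> j ^ coef m j)) d =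
      cst (c * (\<Prod>j\<in>Poly_Mapping.keys m. v j ^ coef m j))" if "mdeg m = d" for c m
    using prod[of "Poly_Mapping.keys m" "coef m"] that degree_smult_le order_trans
    by (fastforce simp: mdeg_def single_const_mult)
  have md: "mdeg m = d" if "m \<in> Poly_Mapping.keys f" for m using that assms by (auto simp: graded_def)
  show "degree (generic_line \<iota> v f) \<le> d"
    unfolding generic_line_def substitute_def by (rule degree_sum_le) (use tm md in auto)
  show "coeff (generic_line \<iota> v f) d = cst (peval f v)"
    unfolding generic_line_def substitute_def peval_def coeff_sum comm_hom_sum[OF comm_hom_cst]
    by (rule sum.cong[OF refl]) (use tm md in blast)
qed

text \<open>For \<open>v i = 1\<close> the forms \<open>y\<^sub>j = x\<^sub>j - v\<^sub>j x\<^sub>i\<close> with \<open>j \<noteq> i\<close> generate the polynomials that are constant in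
the direction \<open>v\<close>, and \<open>y\<^sub>i = 0\<close>.\<close>

definition shear :: "'n \<Rightarrow> ('n \<Rightarrow> 'k::field) \<Rightarrow> ('n, 'k) mpol \<Rightarrow> ('n, 'k) mpol" where
  "shear i v = substitute cst (\<lambda>j. var j - cst (v j) * var i)"

lemma comm_hom_shear: "comm_hom (shear i v)"
  unfolding shear_def by (rule comm_hom_substitute[OF comm_hom_cst])

lemma shear_cst: "shear i v (cst c) = cst c"
  unfolding shear_def by (rule substitute_cst[OF comm_hom_cst])

lemma shear_var: "shear i v (var j) = var j - cst (v j) * var i"
  unfolding shear_def by (rule substitute_var[OF comm_hom_cst])

lemma shear_graded: "p \<in> graded e \<Longrightarrow> shear i v p \<in> graded e"
  unfolding shear_def
proof (rule substitute_graded)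
  fix j
  have "cst (v j) * var i \<in> graded (0 + 1)" by (rule graded_mult[OF graded_cst graded_var])
  then show "var j - cst (v j) * var i \<in> graded 1" by (intro graded_minus graded_var) simp
qed

lemma shear_pscale: "shear i v (pscale c p) = pscale c (shear i v p)"
  by (simp add: pscale_def comm_homD[OF comm_hom_shear] shear_cst)

lemma generic_line_shear:
  assumes "v i = 1"
  shows "generic_line \<iota> v (shear i v p) = [:embed_vars \<iota> (shear i v p):]"
proof (rule comm_hom_eqI[OF comm_hom_comp[OF comm_hom_generic_line comm_hom_shear]
      comm_hom_pCons[OF comm_hom_comp[OF comm_hom_embed_vars comm_hom_shear]]])
  show "generic_line \<iota> v (shear i v (cst c)) = [:embed_vars \<iota> (shear i v (cst c)):]" for c
    by (simp add: shear_cst generic_line_cst embed_vars_cst)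
  show "generic_line \<iota> v (shear i v (var j)) = [:embed_vars \<iota> (shear i v (var j)):]" for j
    by (simp add: shear_var comm_homD[OF comm_hom_generic_line] comm_homD[OF comm_hom_embed_vars]
        generic_line_cst generic_line_var embed_vars_cst embed_vars_var assms del: One_nat_def)
qed

lemma gradient_ideal_closed:
  shows "0 \<in> gradient_ideal f" "x \<in> gradient_ideal f \<Longrightarrow> y \<in> gradient_ideal f \<Longrightarrow> x + y \<in> gradient_ideal f"
    "x \<in> gradient_ideal f \<Longrightarrow> r * x \<in> gradient_ideal f"
  unfolding gradient_ideal_def ideal_gen_def
  by (auto intro: module.span_zero[OF module_times] module.span_add[OF module_times]
        module.span_scale[OF module_times])

text \<open>On the generic line in the direction \<open>v\<close>, the leading coefficient \<open>f(v)\<close> is a unit, so \<open>f\<close> remains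
non-reduced there and has a repeated factor \<open>P\<close> up to a constant \<open>c\<close>. By the product rule \<open>P\<close> divides
\<open>c\<^sup>2 \<partial>\<^sub>j f\<close> on the line for every \<open>j\<close>, hence \<open>c\<^sup>2 h\<close> for all \<open>h\<close> in the gradient ideal. If \<open>h\<close> is
constant on the line, it is \<open>0\<close> because \<open>P\<close> has positive degree.\<close>

lemma nonreduced_gradient_ideal_shear:
  fixes f :: "('n::finite, 'k::field) mpol"
  assumes f: "f \<in> graded d" and v: "peval f v \<noteq> 0" "v i = 1"
    and pow: "f dvd g ^ r" and ndvd: "\<not> f dvd g" and h: "shear i v p \<in> gradient_ideal f"
  shows "shear i v p = 0"
proof -
  obtain \<iota> :: "'n \<Rightarrow> nat" where \<iota>: "inj \<iota>"
    using finite_imp_inj_to_nat_seg[of "UNIV :: 'n set"] by auto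
  let ?L = "generic_line \<iota> v"
  note top = generic_line_top[OF f, of \<iota> v]
  have "coeff (?L f) d \<noteq> 0" unfolding top(2) using v by (metis single_zero inj_single injD lookup_single_eq lookup_zero)
  then have deg: "degree (?L f) = d" using top(1) le_degree by fastforce
  have "lead_coeff (?L f) dvd 1"
  proof (rule dvdI)
    show "1 = lead_coeff (?L f) * cst (1 / peval f v)"
      using v by (simp add: deg top(2) mult_single)
  qed
  moreover have "?L f dvd ?L g ^ r"
    using comm_hom_dvd[OF comm_hom_generic_line pow, of \<iota> v] by (simp add: comm_homD(7)[OF comm_hom_generic_line])
  moreover have "\<not> ?L f dvd ?L g" using generic_line_dvd_reflect[OF \<iota>] ndvd by blast
  ultimately obtain c P Q where c: "c \<noteq> 0" "degree P > 0" "[:c:] * ?L f = P\<^sup>2 * Q"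
    by (rule square_factor_if_not_radical)
  have sub: "gradient_ideal f \<subseteq> {h. P dvd [:c:]\<^sup>2 * ?L h}"
    unfolding gradient_ideal_def ideal_gen_def
  proof (rule module.span_minimal[OF module_times])
    show "module.subspace (*) {h. P dvd [:c:]\<^sup>2 * ?L h}"
      unfolding module.subspace_def[OF module_times]
      by (auto simp: comm_homD[OF comm_hom_generic_line] distrib_left mult.left_commute[of _ "?L _"]
          intro!: dvd_add dvd_mult)
    show "{pd i f |i. True} \<subseteq> {h. P dvd [:c:]\<^sup>2 * ?L h}"
    proof clarify
      fix j
      show "P dvd [:c:]\<^sup>2 * ?L (pd j f)"
        using derivation_square_factor[OF derivation_map_poly[OF derivation_pd[of "\<iota> j"]] c(3)]
        unfolding generic_line_derivation[OF \<iota>] .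
    qed
  qed
  then have "P dvd [:c:]\<^sup>2 * [:embed_vars \<iota> (shear i v p):]"
    using h generic_line_shear[where v = v and i = i, OF v(2), of \<iota> p] by auto
  moreover have "degree ([:c:]\<^sup>2 * [:embed_vars \<iota> (shear i v p):]) = 0" by (simp add: power2_eq_square)
  ultimately have "[:c:]\<^sup>2 * [:embed_vars \<iota> (shear i v p):] = 0"
    using dvd_imp_degree_le c(2) by fastforce
  then have "embed_vars \<iota> (shear i v p) = 0" using c(1) by (simp add: power2_eq_square)
  then show ?thesis
    using embed_vars_retract[OF \<iota>, of "shear i v p"] by (simp add: substitute_def)
qed

section \<open>Reducedness\<close>

definition free_of :: "'n \<Rightarrow> ('n, 'k::field) mpol \<Rightarrow> bool" where
  "free_of i p \<longleftrightarrow> (\<forall>m\<in>Poly_Mapping.keys p. coef m i = 0)"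

text \<open>Restriction to the hyperplane \<open>x\<^sub>i = 0\<close>. It inverts \<open>shear i v\<close> on polynomials free of \<open>x\<^sub>i\<close>.\<close>

definition kill_var :: "'n \<Rightarrow> ('n, 'k::field) mpol \<Rightarrow> ('n, 'k) mpol" where
  "kill_var i = substitute cst (\<lambda>j. if j = i then 0 else var j)"

lemma comm_hom_kill_var: "comm_hom (kill_var i)"
  unfolding kill_var_def by (rule comm_hom_substitute[OF comm_hom_cst])

lemma kill_var_cst: "kill_var i (cst c) = cst c"
  unfolding kill_var_def by (rule substitute_cst[OF comm_hom_cst])

lemma kill_var_var: "kill_var i (var j) = (if j = i then 0 else var j)"
  unfolding kill_var_def by (rule substitute_var[OF comm_hom_cst])

lemma kill_var_shear:
  assumes "v i = 1"
  shows "kill_var i (shear i v p) = kill_var i p"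
  by (rule comm_hom_eqI[OF comm_hom_comp[OF comm_hom_kill_var comm_hom_shear] comm_hom_kill_var])
    (auto simp: shear_cst shear_var comm_homD[OF comm_hom_kill_var] kill_var_cst kill_var_var assms)

lemma kill_var_free:
  assumes "free_of i p"
  shows "kill_var i p = p"
proof -
  have "kill_var i p = (\<Sum>m\<in>Poly_Mapping.keys p. mon m (coef p m))"
    unfolding kill_var_def substitute_def
  proof (rule sum.cong[OF refl])
    fix m assume "m \<in> Poly_Mapping.keys p"
    then have m: "coef m i = 0" using assms by (simp add: free_of_def)
    have "(\<Prod>j\<in>Poly_Mapping.keys m. (if j = i then 0 else var j) ^ coef m j :: ('a, 'b) mpol)
        = (\<Prod>j\<in>Poly_Mapping.keys m. var j ^ coef m j)"
      by (rule prod.cong) (use m in \<open>auto simp: in_keys_iff\<close>)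
    also have "\<dots> = mon m 1" by (rule mon_one_eq_prod_vars[symmetric])
    finally show "cst (coef p m) * (\<Prod>j\<in>Poly_Mapping.keys m. (if j = i then 0 else var j) ^ coef m j)
        = mon m (coef p m)" by (simp add: mult_single)
  qed
  then show ?thesis using poly_mapping_sum_monomials[of p] by simp
qed

lemma kill_var_shear_free: "v i = 1 \<Longrightarrow> free_of i p \<Longrightarrow> kill_var i (shear i v p) = p"
  by (simp add: kill_var_shear kill_var_free)

lemma free_of_mult: "free_of i p \<Longrightarrow> free_of i q \<Longrightarrow> free_of i (p * q)"
  unfolding free_of_def using keys_mult[of p q] by (fastforce simp: lookup_add)

lemma free_of_diff: "free_of i p \<Longrightarrow> free_of i q \<Longrightarrow> free_of i (p - q)"
  unfolding free_of_def using keys_diff[of p q] by blast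

lemma free_of_add: "free_of i p \<Longrightarrow> free_of i q \<Longrightarrow> free_of i (p + q)"
  unfolding free_of_def using Poly_Mapping.keys_add[of p q] by blast

lemma free_of_mon: "coef m i = 0 \<Longrightarrow> free_of i (mon m c)"
  by (cases "c = 0") (auto simp: free_of_def)

lemma free_of_sum: "(\<And>x. x \<in> A \<Longrightarrow> free_of i (f x)) \<Longrightarrow> free_of i (\<Sum>x\<in>A. f x)"
  by (induction A rule: infinite_finite_induct) (auto intro: free_of_add, auto simp: free_of_def)

lemma free_of_pscale: "free_of i p \<Longrightarrow> free_of i (pscale c p)"
  unfolding pscale_def by (intro free_of_mult free_of_mon) auto

text \<open>Sheared forms of degree \<open>e\<close> in the variables other than \<open>x\<^sub>i\<close> meet \<open>J\<close> only in \<open>0\<close>. Any \<open>n\<close>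
independent ones span a complement of \<open>J\<close> in \<open>R\<^sub>e\<close>, by the bound on the codimension of \<open>J\<close>. Reducing \<open>x\<^sub>i\<close> times
\<open>y\<^sub>a\<^bsup>e-1\<^esup>\<close> and \<open>y\<^sub>b\<^bsup>e-1\<^esup>\<close> gives \<open>u\<^sub>1\<close> and \<open>u\<^sub>2\<close> with
\<open>y\<^sub>b\<^bsup>e-1\<^esup> u\<^sub>1 = y\<^sub>a\<^bsup>e-1\<^esup> u\<^sub>2\<close>, so \<open>u\<^sub>1 = y\<^sub>a\<^bsup>e-1\<^esup> \<beta>\<close> with a linear form
\<open>\<beta>\<close>: the multiplication by \<open>x\<^sub>i\<close> modulo \<open>J\<close> is multiplication by \<open>\<beta>\<close>. The linear form sought is
\<open>x\<^sub>i - \<beta>\<close>.\<close>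

lemma shear_complement_contains_linear_power:
  fixes J :: "('n::finite, 'k::field_char_0) mpol set"
  assumes J0: "0 \<in> J" and Jadd: "\<And>x y. x \<in> J \<Longrightarrow> y \<in> J \<Longrightarrow> x + y \<in> J"
    and Jmult: "\<And>r x. x \<in> J \<Longrightarrow> r * x \<in> J"
    and v: "v i = 1" and trivial: "\<And>p. shear i v p \<in> J \<Longrightarrow> shear i v p = 0"
    and dim: "pvs.dim (graded e :: ('n, 'k) mpol set) \<le> pvs.dim (J \<inter> graded e) + CARD('n)"
    and n: "CARD('n) \<ge> 3" and e: "e \<ge> 2"
  shows "\<exists>l\<in>graded 1. l \<noteq> 0 \<and> l ^ e \<in> J"
proof -
  let ?s = "shear i v" and ?R = "graded e :: ('n, 'k) mpol set"
  let ?F = "(\<lambda>m. mon m (1::'k)) ` {m :: 'n \<Rightarrow>\<^sub>0 nat. mdeg m = e}"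
  note hs = comm_homD[OF comm_hom_shear]
  have RF: "?R \<subseteq> pvs.span ?F" "finite ?F" using graded_subset_span_monomials by auto
  have Jminus: "x - y \<in> J" if "x \<in> J" "y \<in> J" for x y
    using Jadd[OF that(1) Jmult[OF that(2), of "-1"]] by simp
  have Jscale: "pscale c x \<in> J" if "x \<in> J" for c x
    unfolding pscale_def by (rule Jmult[OF that])
  have kill: "kill_var i (?s p) = p" if "free_of i p" for p
    using kill_var_shear_free[of v i p] v that by simp
  have free0: "p = 0" if "?s p \<in> J" "free_of i p" for p
    using kill[OF that(2)] trivial[OF that(1)]
    by (simp add: comm_homD(4)[OF comm_hom_kill_var])
  obtain a b where ab: "a \<noteq> i" "b \<noteq> i" "a \<noteq> b"
  proof -
    have "card (UNIV - {i}) \<ge> 2" using n by (simp add: card_Diff_singleton)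
    then obtain T where "T \<subseteq> UNIV - {i}" "card T = 2" by (meson obtain_subset_with_card_n)
    then show ?thesis using that by (auto simp: card_2_iff)
  qed
  \<comment> \<open>exponents of \<open>n\<close> monomials free of \<open>x\<^sub>i\<close>: the other \<open>n - 1\<close> pure powers, and \<open>x\<^sub>a\<^bsup>e-1\<^esup> x\<^sub>b\<close> in place of \<open>x\<^sub>i\<^sup>e\<close>\<close>
  define \<mu> where "\<mu> j = (if j = i then mon a (e - 1) + expo b else mon j e)" for j
  have \<mu>deg: "mdeg (\<mu> j) = e" for j using e by (simp add: \<mu>_def)
  have \<mu>i: "coef (\<mu> j) i = 0" for j using ab by (simp add: \<mu>_def lookup_add lookup_single when_def)
  have ia: "coef (\<mu> i) a = e - 1" "coef (\<mu> i) b = 1"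
    using ab by (simp_all add: \<mu>_def lookup_add lookup_single when_def)
  have ji: "coef (\<mu> j) k = (if j = k then e else 0)" if "j \<noteq> i" for j k
    using that by (simp add: \<mu>_def lookup_single when_def)
  have \<mu>inj: "j = k" if "\<mu> j = \<mu> k" for j k
  proof -
    have 1: False if "j \<noteq> i" "\<mu> j = \<mu> i" for j
      using ia(2) ji[OF that(1), of b] e unfolding that(2)[symmetric] by (simp split: if_splits)
    show ?thesis
    proof (cases "j = i \<or> k = i")
      case True
      then show ?thesis using 1 that by metis
    next
      case False
      then show ?thesis using ji[of j k] ji[of k k] that e by (auto split: if_splits)
    qed
  qed
  define w where "w j = ?s (mon (\<mu> j) 1)" for j
  obtain B where B: "B \<subseteq> J \<inter> ?R" "pvs.independent B" "J \<inter> ?R \<subseteq> pvs.span B"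
    "card B = pvs.dim (J \<inter> ?R)" "finite B"
    by (rule finite_basis[of "J \<inter> ?R", OF _ RF(2)]) (use RF(1) in blast)
  have JR: "pvs.subspace (J \<inter> ?R)"
    by (rule pvs.subspaceI) (auto intro: J0 Jadd Jscale graded_add graded_pscale)
  have shear_comb: "(\<Sum>j\<in>UNIV. pscale (c j) (w j)) = ?s (\<Sum>j\<in>UNIV. pscale (c j) (mon (\<mu> j) 1))" for c
    by (simp add: w_def comm_hom_sum[OF comm_hom_shear] shear_pscale)
  have free_comb: "free_of i (\<Sum>j\<in>UNIV. pscale (c j) (mon (\<mu> j) 1))" for c :: "'n \<Rightarrow> 'k"
    by (intro free_of_sum free_of_pscale free_of_mon \<mu>i)
  have graded_comb: "(\<Sum>j\<in>UNIV. pscale (c j) (mon (\<mu> j) 1)) \<in> ?R" for c :: "'n \<Rightarrow> 'k"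
    by (intro graded_sum graded_pscale graded_mon \<mu>deg)
  \<comment> \<open>a basis of \<open>J \<inter> R\<^sub>e\<close> together with the \<open>n\<close> sheared monomials is a basis of \<open>R\<^sub>e\<close>\<close>
  let ?I = "B <+> (UNIV :: 'n set)"
  let ?w = "case_sum (\<lambda>x. x) w"
  have split: "(\<Sum>y\<in>?I. pscale (c y) (?w y)) =
      (\<Sum>x\<in>B. pscale (c (Inl x)) x) + (\<Sum>j\<in>UNIV. pscale (c (Inr j)) (w j))" for c
    using B(5) by (simp add: sum.Plus)
  have BJ: "(\<Sum>x\<in>B. pscale (c x) x) \<in> J \<inter> ?R" for c
    using B(1) by (intro pvs.subspace_sum[OF JR] pvs.subspace_scale[OF JR]) auto
  have ind: "indep_family ?w ?I"
    unfolding indep_family_def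
  proof (intro allI impI)
    fix c assume "(\<Sum>y\<in>?I. pscale (c y) (?w y)) = 0"
    then have z: "(\<Sum>x\<in>B. pscale (c (Inl x)) x) + (\<Sum>j\<in>UNIV. pscale (c (Inr j)) (w j)) = 0"
      unfolding split .
    let ?y = "\<Sum>j\<in>UNIV. pscale (c (Inr j)) (mon (\<mu> j) 1)"
    have x: "(\<Sum>x\<in>B. pscale (c (Inl x)) x) \<in> J"
      using BJ[of "\<lambda>x. c (Inl x)"] by (rule IntD1)
    have "?s ?y = 0 - (\<Sum>x\<in>B. pscale (c (Inl x)) x)"
      using z unfolding shear_comb by (simp add: eq_neg_iff_add_eq_0 add.commute)
    then have "?s ?y \<in> J" using Jminus[OF J0 x] by (rule ssubst)
    then have y0: "?y = 0" by (rule free0) (rule free_comb)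
    have "c (Inr k) = 0" for k
    proof -
      have "coef ?y (\<mu> k) = (\<Sum>j\<in>UNIV. if j = k then c (Inr k) else 0)"
        unfolding lookup_sum
        by (rule sum.cong) (auto simp: lookup_pscale lookup_single when_def dest: \<mu>inj)
      then show ?thesis using y0 by simp
    qed
    moreover have "(\<Sum>x\<in>B. pscale (c (Inl x)) x) = 0"
      using z unfolding shear_comb y0 by (simp add: hs)
    then have "\<forall>x\<in>B. c (Inl x) = 0"
      using pvs.independentD[OF B(2) B(5) subset_refl, of "\<lambda>x. c (Inl x)"] by blast
    ultimately show "\<forall>y\<in>?I. c y = 0" by auto
  qed
  have finI: "finite ?I" using B(5) by simp
  have wR: "?w ` ?I \<subseteq> ?R"
    using B(1) by (auto simp: w_def intro!: shear_graded graded_mon \<mu>deg)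
  have cardI: "pvs.dim ?R \<le> card ?I"
    using dim B(4,5) by (simp add: card_Plus)
  have decomp: "\<exists>x\<in>J \<inter> ?R. \<exists>y\<in>?R. free_of i y \<and> p = x + ?s y" if p: "p \<in> ?R" for p
  proof -
    obtain c where "p = (\<Sum>y\<in>?I. pscale (c y) (?w y))"
      by (rule indep_family_expand[OF ind finI wR RF cardI p])
    then have "p = (\<Sum>x\<in>B. pscale (c (Inl x)) x) + ?s (\<Sum>j\<in>UNIV. pscale (c (Inr j)) (mon (\<mu> j) 1))"
      unfolding split shear_comb .
    then show ?thesis using BJ[of "\<lambda>x. c (Inl x)"] free_comb[of "\<lambda>j. c (Inr j)"]
        graded_comb[of "\<lambda>j. c (Inr j)"] by blast
  qed
  \<comment> \<open>multiplication by \<open>x\<^sub>i\<close> modulo \<open>J\<close>, on the forms \<open>y\<^sub>a\<^bsup>e-1\<^esup>\<close> and \<open>y\<^sub>b\<^bsup>e-1\<^esup>\<close>\<close>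
  let ?p = "\<lambda>k. mon (mon k (e - 1)) 1 :: ('n, 'k) mpol"
  have pe: "var i * ?s (?p k) \<in> ?R" for k
    using graded_mult[OF graded_var shear_graded[OF graded_mon[OF mdeg_mon]], of i i v k "e - 1" 1] e by simp
  have pfree: "free_of i (?p a)" "free_of i (?p b)"
    using ab by (auto intro!: free_of_mon simp: lookup_single when_def)
  obtain x1 u1 where u1: "x1 \<in> J" "u1 \<in> ?R" "free_of i u1" "var i * ?s (?p a) = x1 + ?s u1"
    using decomp[OF pe] by blast
  obtain x2 u2 where u2: "x2 \<in> J" "u2 \<in> ?R" "free_of i u2" "var i * ?s (?p b) = x2 + ?s u2"
    using decomp[OF pe] by blast
  have "?p b * u1 - ?p a * u2 = 0"
  proof (rule free0)
    have s1: "?s u1 = var i * ?s (?p a) - x1" and s2: "?s u2 = var i * ?s (?p b) - x2"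
      using u1(4) u2(4) by simp_all
    have "?s (?p b * u1 - ?p a * u2) = ?s (?p a) * x2 - ?s (?p b) * x1"
      unfolding hs s1 s2 by (simp add: algebra_simps)
    then show "?s (?p b * u1 - ?p a * u2) \<in> J" using Jminus Jmult u1(1) u2(1) by simp
    show "free_of i (?p b * u1 - ?p a * u2)"
      using pfree u1(3) u2(3) by (intro free_of_diff free_of_mult)
  qed
  then have cross: "?p b * u1 = ?p a * u2" by simp
  have div: "mon a (e - 1) + (m - mon a (e - 1)) = m" if m: "m \<in> Poly_Mapping.keys u1" for m
  proof -
    have "coef (?p a * u2) (mon b (e - 1) + m) \<noteq> 0"
      unfolding cross[symmetric] coef_mon_mult using m by (simp add: in_keys_iff)
    then obtain m' where "mon b (e - 1) + m = mon a (e - 1) + m'"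
      using coef_mon_mult_zero by metis
    then have "coef (mon b (e - 1) + m) a = coef (mon a (e - 1) + m') a" by simp
    then have "e - 1 \<le> coef m a" using ab by (simp add: lookup_add lookup_single when_def)
    then have "coef (mon a (e - 1)) k \<le> coef m k" for k
      by (cases "a = k") (simp_all add: lookup_single when_def)
    then show ?thesis by (rule exponent_le_split[symmetric])
  qed
  define \<beta> where "\<beta> = (\<Sum>m\<in>Poly_Mapping.keys u1. mon (m - mon a (e - 1)) (coef u1 m))"
  have u1\<beta>: "u1 = ?p a * \<beta>"
  proof -
    have "(\<Sum>m\<in>Poly_Mapping.keys u1. ?p a * mon (m - mon a (e - 1)) (coef u1 m))
        = (\<Sum>m\<in>Poly_Mapping.keys u1. mon m (coef u1 m))"
      by (rule sum.cong[OF refl]) (simp add: mult_single div[simplified])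
    then show ?thesis unfolding \<beta>_def sum_distrib_left using poly_mapping_sum_monomials[of u1] by simp
  qed
  have \<beta>1: "\<beta> \<in> graded 1"
    unfolding \<beta>_def
  proof (rule graded_sum, rule graded_mon)
    fix m assume m: "m \<in> Poly_Mapping.keys u1"
    then have "mdeg m = e" using u1(2) by (auto simp: graded_def)
    then have "e - 1 + mdeg (m - mon a (e - 1)) = e"
      using arg_cong[where f = mdeg, OF div[OF m]] by (simp only: mdeg_add mdeg_mon)
    then show "mdeg (m - mon a (e - 1)) = 1" using e by simp
  qed
  have \<beta>free: "free_of i \<beta>"
    unfolding \<beta>_def
    by (intro free_of_sum free_of_mon) (use u1(3) in \<open>auto simp: free_of_def lookup_minus\<close>)
  define l where "l = var i - ?s \<beta>"
  have l1: "l \<in> graded 1"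
    unfolding l_def by (intro graded_minus graded_var shear_graded \<beta>1)
  have l0: "l \<noteq> 0"
  proof
    assume "l = 0"
    then have eq: "var i = ?s \<beta>" by (simp add: l_def)
    have "kill_var i (var i :: ('n, 'k) mpol) = 0"
      by (simp add: kill_var_var)
    then have "\<beta> = 0" using kill[OF \<beta>free] unfolding eq by simp
    then have "coef (var i :: ('n, 'k) mpol) (expo i) = 0" unfolding eq by (simp add: hs)
    then show False by simp
  qed
  have pl: "?s (?p a) * l \<in> J"
  proof -
    have "?s (?p a) * l = x1"
      using u1(4) unfolding l_def u1\<beta> hs by (simp add: algebra_simps)
    then show ?thesis using u1(1) by simp
  qed
  have "l ^ e \<in> ?R" using graded_power[OF l1, of e] by simp
  then obtain x h where h: "x \<in> J" "free_of i h" "l ^ e = x + ?s h"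
    using decomp by blast
  have "?p a * h = 0"
  proof (rule free0)
    have sh: "?s h = l ^ e - x" using h(3) by simp
    have "l ^ e = l * l ^ (e - 1)" using e by (metis One_nat_def Suc_1 Suc_le_D diff_Suc_1 power_Suc)
    then have "?s (?p a * h) = l ^ (e - 1) * (?s (?p a) * l) - ?s (?p a) * x"
      unfolding hs sh by (simp add: algebra_simps)
    then show "?s (?p a * h) \<in> J" using pl h(1) Jminus Jmult by simp
    show "free_of i (?p a * h)" by (intro free_of_mult pfree h)
  qed
  then have "coef h m = 0" for m using coef_mon_mult[of "mon a (e - 1)" 1 h m] by simp
  then have "h = 0" by (intro poly_mapping_eqI) simp
  then have "l ^ e \<in> J" using h by (simp add: hs)
  then show ?thesis using l1 l0 by blast
qed

text \<open>If \<open>f\<close> is not reduced, the gradient ideal contains no nonzero sheared form. As its piece of degree \<open>T - 1\<close>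
has codimension \<open>n\<close>, it contains the power of a linear form, against avoidance.\<close>

theorem reduced_if_gradient_generic_avoiding:
  fixes f :: "('n::finite, 'k::field_char_0) mpol"
  assumes n: "CARD('n) \<ge> 3" and d: "d \<ge> 3" and f: "f \<in> graded d" "f \<noteq> 0"
    and gen: "gradient_generic d f" and avoid: "veronese_avoidance d f"
  shows "reduced_hypersurface f"
proof (rule ccontr)
  assume "\<not> reduced_hypersurface f"
  then obtain g r where g: "f dvd g ^ r" "\<not> f dvd g" using f(2) by (auto simp: reduced_hypersurface_def)
  obtain a where a: "peval f a \<noteq> 0" using exists_nonzero_value[OF f] by blast
  have "\<exists>i. a i \<noteq> 0"
  proof (rule ccontr)
    assume "\<not> ?thesis"
    then have "a = (\<lambda>j. 0 * a j)" by auto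
    then have "peval f a = 0 ^ d * peval f a" using peval_scale[OF f(1), of 0 a] by metis
    then show False using a d by (simp add: zero_power)
  qed
  then obtain i where i: "a i \<noteq> 0" by blast
  \<comment> \<open>rescale the point to make its \<open>i\<close>-th coordinate \<open>1\<close>\<close>
  define v where "v j = inverse (a i) * a j" for j
  have v: "v i = 1" "peval f v \<noteq> 0"
    using i a peval_scale[OF f(1), of "inverse (a i)" a] by (simp_all add: v_def[abs_def])
  let ?e = "Tdeg TYPE('n) d - 1"
  have "3 * 1 \<le> CARD('n) * (d - 2)" using n d by (intro mult_le_mono) auto
  then have e: "?e \<ge> 2" by (simp add: Tdeg_def)
  have "pvs.dim (graded ?e :: ('n, 'k) mpol set) \<le> pvs.dim (gradient_ideal f \<inter> graded ?e) + CARD('n)"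
    using gen by (simp add: gradient_generic_def proj_codim_def gradient_piece_def)
  then obtain l where l: "l \<in> graded 1" "l \<noteq> 0" "l ^ ?e \<in> gradient_ideal f"
    using shear_complement_contains_linear_power[where v = v and i = i and e = ?e, OF gradient_ideal_closed v(1)
        nonreduced_gradient_ideal_shear[OF f(1) v(2,1) g]] n e by blast
  have "l ^ ?e \<in> graded ?e" using graded_power[OF l(1), of ?e] by simp
  then have "pt (l ^ ?e) \<in> proj (gradient_piece ?e f)"
    using l(3) power_form_nonzero[OF l(1,2)] by (auto simp: proj_def gradient_piece_def)
  moreover have "pt (l ^ ?e) \<in> veronese ?e" using l by (auto simp: veronese_def)
  ultimately show False using avoid unfolding veronese_avoidance_def by blast
qed

section \<open>Inverse systems and powers of linear forms\<close>

definition homogeneous_component :: "nat \<Rightarrow> ('n, 'k::comm_ring_1) mpol \<Rightarrow> ('n, 'k) mpol" where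
  "homogeneous_component e q = (\<Sum>m\<in>{m\<in>Poly_Mapping.keys q. mdeg m = e}. mon m (coef q m))"

lemma coef_homogeneous_component: "coef (homogeneous_component e q) m = (if mdeg m = e then coef q m else 0)"
proof -
  have "coef (homogeneous_component e q) m =
      (\<Sum>k\<in>{k\<in>Poly_Mapping.keys q. mdeg k = e}. if k = m then coef q m else 0)"
    unfolding homogeneous_component_def lookup_sum
    by (rule sum.cong) (auto simp: lookup_single when_def)
  then show ?thesis by (auto simp: in_keys_iff)
qed

lemma homogeneous_component_add: "homogeneous_component e (p + q) = homogeneous_component e p + homogeneous_component e q"
  by (rule poly_mapping_eqI) (simp add: coef_homogeneous_component lookup_add)

lemma homogeneous_component_graded:
  assumes "p \<in> graded d"
  shows "homogeneous_component e p = (if e = d then p else 0)"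
  by (rule poly_mapping_eqI) (use graded_coef_zero[OF assms] in \<open>auto simp: coef_homogeneous_component\<close>)

text \<open>Indices \<open>(\<beta>, i)\<close> of the forms \<open>x\<^sup>\<beta> \<partial>\<^sub>i f\<close> of degree \<open>e\<close>, for \<open>f\<close> of degree \<open>d\<close>.\<close>

definition gradient_gens :: "nat \<Rightarrow> nat \<Rightarrow> (('n \<Rightarrow>\<^sub>0 nat) \<times> 'n) set" where
  "gradient_gens d e = {(\<beta>, i). mdeg \<beta> + (d - 1) = e}"

definition gradient_gen :: "('n, 'k::comm_ring_1) mpol \<Rightarrow> ('n \<Rightarrow>\<^sub>0 nat) \<times> 'n \<Rightarrow> ('n, 'k) mpol" where
  "gradient_gen f = (\<lambda>(\<beta>, i). mon \<beta> 1 * pd i f)"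

lemma gradient_gen_graded:
  assumes "f \<in> graded d" "y \<in> gradient_gens d e"
  shows "gradient_gen f y \<in> graded e"
proof -
  obtain \<beta> i where y: "y = (\<beta>, i)" by fastforce
  have "mon \<beta> 1 * pd i f \<in> graded (mdeg \<beta> + (d - 1))"
    by (intro graded_mult graded_mon refl pd_graded assms)
  then show ?thesis using assms(2) by (simp add: y gradient_gen_def gradient_gens_def)
qed

text \<open>The homogeneous component of degree \<open>e\<close> of a combination \<open>\<Sum> r\<^sub>i \<partial>\<^sub>i f\<close> only involves the components of the
\<open>r\<^sub>i\<close> of degree \<open>e - (d - 1)\<close>.\<close>

lemma gradient_piece_eq_span:
  fixes f :: "('n::finite, 'k::field) mpol"
  assumes f: "f \<in> graded d"
  shows "gradient_piece e f = pvs.span (gradient_gen f ` gradient_gens d e)"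
proof
  let ?W = "gradient_gen f ` gradient_gens d e"
  have "homogeneous_component e q \<in> pvs.span ?W" if "q \<in> gradient_ideal f" for q
    using that unfolding gradient_ideal_def ideal_gen_def
  proof (induction rule: module.span_induct_alt[OF module_times, consumes 1])
    case 1
    then show ?case by (simp add: homogeneous_component_def pvs.span_zero)
  next
    case (2 r x q)
    then obtain i where x: "x = pd i f" by blast
    have "homogeneous_component e (r * pd i f) \<in> pvs.span ?W"
    proof (induction r rule: mpol_induct)
      case zero
      then show ?case by (simp add: homogeneous_component_def pvs.span_zero)
    next
      case (add m c r)
      have "mon m c * pd i f \<in> graded (mdeg m + (d - 1))"
        by (intro graded_mult graded_mon refl pd_graded f)
      then have hc: "homogeneous_component e (mon m c * pd i f) = (if e = mdeg m + (d - 1) then mon m c * pd i f else 0)"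
        by (rule homogeneous_component_graded)
      have "homogeneous_component e (mon m c * pd i f) \<in> pvs.span ?W"
      proof (cases "e = mdeg m + (d - 1)")
        case True
        then have "(m, i) \<in> gradient_gens d e" by (simp add: gradient_gens_def)
        then have "gradient_gen f (m, i) \<in> pvs.span ?W" by (intro pvs.span_base imageI)
        then have "pscale c (mon m 1 * pd i f) \<in> pvs.span ?W"
          by (intro pvs.span_scale) (simp add: gradient_gen_def)
        then show ?thesis using True unfolding hc by (simp add: pscale_def mult.assoc[symmetric] mult_single)
      next
        case False
        then show ?thesis unfolding hc by (simp add: pvs.span_zero)
      qed
      then show ?case using add by (simp add: distrib_right homogeneous_component_add pvs.span_add)
    qed
    then show ?case using 2 by (simp add: x homogeneous_component_add pvs.span_add)
  qed
  then show "gradient_piece e f \<subseteq> pvs.span ?W"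
    unfolding gradient_piece_def using homogeneous_component_graded[of _ e e] by fastforce
  have "gradient_gen f y \<in> gradient_ideal f" for y
    unfolding gradient_gen_def case_prod_beta
    by (rule gradient_ideal_closed(3))
      (auto simp: gradient_ideal_def ideal_gen_def intro: module.span_base[OF module_times])
  then show "pvs.span ?W \<subseteq> gradient_piece e f"
    by (intro pvs.span_minimal subspace_gradient_piece)
      (auto simp: gradient_piece_def gradient_gen_graded[OF f])
qed

text \<open>The coefficient of \<open>x\<^sup>\<alpha>\<close> in \<open>x\<^sup>\<beta> \<partial>\<^sub>i f\<close>, as a linear form in the coefficients of \<open>f\<close>.\<close>

definition gradient_entry :: "('n \<Rightarrow>\<^sub>0 nat) \<Rightarrow> ('n \<Rightarrow>\<^sub>0 nat) \<times> 'n \<Rightarrow> ('n \<Rightarrow>\<^sub>0 nat, 'k::comm_ring_1) mpol" where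
  "gradient_entry \<alpha> = (\<lambda>(\<beta>, i). if \<exists>m. \<alpha> = \<beta> + m
     then mon (expo (\<alpha> - \<beta> + expo i)) (of_nat (Suc (coef (\<alpha> - \<beta>) i))) else 0)"

lemma gradient_entry_graded: "gradient_entry \<alpha> y \<in> graded 1"
  by (auto simp: gradient_entry_def graded_mon split: prod.split)

lemma peval_gradient_entry: "peval (gradient_entry \<alpha> y) (coef f) = coef (gradient_gen f y) \<alpha>"
proof -
  obtain \<beta> i where y: "y = (\<beta>, i)" by fastforce
  show ?thesis
  proof (cases "\<exists>m. \<alpha> = \<beta> + m")
    case True
    then obtain m where m: "\<alpha> = \<beta> + m" by blast
    then show ?thesis
      by (simp add: y gradient_entry_def gradient_gen_def coef_mon_mult coef_pd peval_single)
  next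
    case False
    then show ?thesis
      using coef_mon_mult_zero[of \<alpha> \<beta> 1 "pd i f"]
      by (auto simp: y gradient_entry_def gradient_gen_def peval_def)
  qed
qed

definition mfact :: "('n::finite \<Rightarrow>\<^sub>0 nat) \<Rightarrow> 'k::field_char_0" where
  "mfact \<alpha> = (\<Prod>v\<in>UNIV. fact (coef \<alpha> v))"

lemma mfact_nonzero [simp]: "mfact \<alpha> \<noteq> 0" by (simp add: mfact_def)

lemma mfact_add_expo: "mfact (\<alpha> + expo j) = of_nat (Suc (coef \<alpha> j)) * mfact \<alpha>"
proof -
  have "mfact (\<alpha> + expo j) = (\<Prod>v\<in>UNIV. (if v = j then of_nat (Suc (coef \<alpha> j)) else 1) * fact (coef \<alpha> v))"
    unfolding mfact_def
    by (rule prod.cong) (auto simp: lookup_add lookup_single when_def simp del: of_nat_Suc)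
  then show ?thesis by (simp add: prod.distrib mfact_def del: of_nat_Suc)
qed

definition linear_form :: "('n::finite \<Rightarrow> 'k::comm_ring_1) \<Rightarrow> ('n, 'k) mpol" where
  "linear_form \<mu> = (\<Sum>j\<in>UNIV. cst (\<mu> j) * var j)"

lemma linear_form_graded: "linear_form \<mu> \<in> graded 1"
  unfolding linear_form_def using graded_mult[OF graded_cst graded_var] by (intro graded_sum) simp

lemma coef_linear_form: "coef (linear_form \<mu>) (expo j) = \<mu> j"
proof -
  have "coef (linear_form \<mu>) (expo j) = (\<Sum>i\<in>UNIV. if i = j then \<mu> j else 0)"
    unfolding linear_form_def lookup_sum
  proof (rule sum.cong[OF refl])
    fix i
    have "i = j" if "expo i = expo j" using arg_cong[OF that, of "\<lambda>m. coef m i"]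
      by (auto simp: lookup_single when_def split: if_splits)
    then show "coef (cst (\<mu> i) * var i) (expo j) = (if i = j then \<mu> j else 0)"
      by (auto simp: mult_single lookup_single when_def)
  qed
  then show ?thesis by simp
qed

lemma linear_form_exhaust:
  assumes "l \<in> graded 1"
  obtains \<mu> where "l = linear_form \<mu>"
proof -
  have "l = linear_form (\<lambda>j. coef l (expo j))"
  proof (rule poly_mapping_eqI)
    fix m
    show "coef l m = coef (linear_form (\<lambda>j. coef l (expo j))) m"
    proof (cases "mdeg m = 1")
      case True
      then have "mdeg m = Suc 0" by simp
      then obtain j m' where "m = m' + expo j" "mdeg m' = 0" by (rule mdeg_pos_obtain)
      then have "m = expo j" by (simp add: mdeg_eq_zero_iff)
      then show ?thesis by (simp add: coef_linear_form)
    next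
      case False
      then show ?thesis using graded_coef_zero[OF assms] graded_coef_zero[OF linear_form_graded] by metis
    qed
  qed
  then show ?thesis by (rule that)
qed

lemma peval_mon_add: "peval (mon (a + b) 1) \<mu> = peval (mon a 1) \<mu> * peval (mon b 1) \<mu>"
  by (simp add: peval_single monom_eval_add)

text \<open>The multinomial theorem, by induction on \<open>e\<close>: multiplication by \<open>l\<close> adds up one contribution for each variable in
\<open>\<alpha>\<close>.\<close>

lemma coef_linear_form_power:
  fixes \<mu> :: "'n::finite \<Rightarrow> 'k::field_char_0"
  assumes "mdeg \<alpha> = e"
  shows "mfact \<alpha> * coef (linear_form \<mu> ^ e) \<alpha> = fact e * peval (mon \<alpha> 1) \<mu>"
  using assms
proof (induction e arbitrary: \<alpha>)
  case 0
  then have "\<alpha> = 0" by (simp add: mdeg_eq_zero_iff)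
  then show ?case by (simp add: mfact_def peval_one)
next
  case (Suc e)
  let ?l = "linear_form \<mu>"
  have t: "mfact \<alpha> * (\<mu> j * coef (var j * ?l ^ e) \<alpha>) = of_nat (coef \<alpha> j) * (fact e * peval (mon \<alpha> 1) \<mu>)" for j
  proof (cases "coef \<alpha> j = 0")
    case True
    then have "\<alpha> \<noteq> expo j + m" for m by (auto simp: lookup_add)
    then have "coef (var j * ?l ^ e) \<alpha> = 0" by (rule coef_mon_mult_zero)
    then show ?thesis using True by simp
  next
    case False
    then have "\<alpha> = (\<alpha> - expo j) + expo j" by (intro exponent_split) simp
    then obtain \<gamma> where \<gamma>: "\<alpha> = \<gamma> + expo j" by blast
    then have "mdeg \<gamma> = e" using Suc.prems by simp
    then have IH: "mfact \<gamma> * coef (?l ^ e) \<gamma> = fact e * peval (mon \<gamma> 1) \<mu>" by (rule Suc.IH)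
    have "coef (var j * ?l ^ e) \<alpha> = coef (?l ^ e) \<gamma>"
      using coef_mon_mult[of "expo j" 1 "?l ^ e" \<gamma>] by (simp add: \<gamma> add.commute)
    then have "mfact \<alpha> * (\<mu> j * coef (var j * ?l ^ e) \<alpha>) =
        of_nat (Suc (coef \<gamma> j)) * \<mu> j * (mfact \<gamma> * coef (?l ^ e) \<gamma>)"
      by (simp only: \<gamma> mfact_add_expo mult_ac)
    also have "\<dots> = of_nat (Suc (coef \<gamma> j)) * (fact e * (peval (mon \<gamma> 1) \<mu> * \<mu> j))"
      unfolding IH by (simp only: mult_ac)
    also have "peval (mon \<gamma> 1) \<mu> * \<mu> j = peval (mon \<alpha> 1) \<mu>"
      by (simp only: \<gamma> peval_mon_add peval_var)
    also have "Suc (coef \<gamma> j) = coef \<alpha> j" by (simp add: \<gamma> lookup_add)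
    finally show ?thesis .
  qed
  have "coef (?l ^ Suc e) \<alpha> = (\<Sum>j\<in>UNIV. \<mu> j * coef (var j * ?l ^ e) \<alpha>)"
    by (simp add: linear_form_def sum_distrib_right lookup_sum mult.assoc)
      (simp add: coef_mon_mult[of 0, simplified])
  then have "mfact \<alpha> * coef (?l ^ Suc e) \<alpha> = (\<Sum>j\<in>UNIV. of_nat (coef \<alpha> j) * (fact e * peval (mon \<alpha> 1) \<mu>))"
    by (simp add: sum_distrib_left t)
  also have "\<dots> = of_nat (Suc e) * (fact e * peval (mon \<alpha> 1) \<mu>)"
    using Suc.prems by (simp only: sum_distrib_right[symmetric] of_nat_sum[symmetric] mdeg_eq_sum)
  finally show ?case by (simp add: fact_Suc mult_ac del: of_nat_Suc)
qed

text \<open>Macaulay's inverse system. A function \<open>\<Psi>\<close> on the monomials of degree \<open>N\<close> stands for the form with coefficients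
\<open>\<Psi> \<gamma> / \<gamma>!\<close>; its partial derivative with respect to \<open>x\<^sup>\<beta>\<close> has the coefficients
\<open>\<Psi> (\<alpha> + \<beta>) / \<alpha>!\<close>. All derivatives of degree \<open>e\<close> are required to lie in \<open>J\<close>. Only the
values of \<open>\<Psi>\<close> in degree \<open>N\<close> matter.\<close>

definition inverse_system ::
    "nat \<Rightarrow> ('n::finite, 'k::field_char_0) mpol set \<Rightarrow> nat \<Rightarrow> (('n \<Rightarrow>\<^sub>0 nat) \<Rightarrow> 'k) \<Rightarrow> bool" where
  "inverse_system e J N \<Psi> \<longleftrightarrow> (\<forall>\<beta>. mdeg \<beta> + e = N \<longrightarrow>
     (\<exists>p\<in>J. \<forall>\<alpha>. mdeg \<alpha> = e \<longrightarrow> \<Psi> (\<alpha> + \<beta>) = mfact \<alpha> * coef p \<alpha>))"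

definition trivial_inverse_system :: "nat \<Rightarrow> ('n::finite, 'k::field_char_0) mpol set \<Rightarrow> nat \<Rightarrow> bool" where
  "trivial_inverse_system e J N \<longleftrightarrow>
     (\<forall>\<Psi>. inverse_system e J N \<Psi> \<longrightarrow> (\<forall>\<gamma>. mdeg \<gamma> = N \<longrightarrow> \<Psi> \<gamma> = 0))"

text \<open>The function \<open>\<gamma> \<mapsto> \<mu>\<^sup>\<gamma>\<close> stands for a multiple of \<open>l\<^sup>N\<close>, whose derivatives of degree \<open>e\<close> are multiples of
\<open>l\<^sup>e\<close>.\<close>

lemma trivial_inverse_system_imp_no_linear_powers:
  fixes J :: "('n::finite, 'k::field_char_0) mpol set"
  assumes J: "pvs.subspace J" and N: "0 < N" and triv: "trivial_inverse_system e J N"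
    and l: "l \<in> graded 1" "l ^ e \<in> J"
  shows "l = 0"
proof -
  obtain \<mu> where \<mu>: "l = linear_form \<mu>" using linear_form_exhaust[OF l(1)] by blast
  have "inverse_system e J N (\<lambda>\<gamma>. peval (mon \<gamma> 1) \<mu>)"
    unfolding inverse_system_def
  proof (intro allI impI bexI)
    fix \<beta> show "pscale (peval (mon \<beta> 1) \<mu> / fact e) (l ^ e) \<in> J"
      by (rule pvs.subspace_scale[OF J l(2)])
    fix \<alpha> :: "'n \<Rightarrow>\<^sub>0 nat" assume "mdeg \<alpha> = e"
    then have "mfact \<alpha> * coef (l ^ e) \<alpha> = fact e * peval (mon \<alpha> 1) \<mu>"
      unfolding \<mu> by (rule coef_linear_form_power)
    then have "mfact \<alpha> * coef (l ^ e) \<alpha> * (peval (mon \<beta> 1) \<mu> / fact e) = peval (mon \<alpha> 1) \<mu> * peval (mon \<beta> 1) \<mu>"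
      by simp
    then show "peval (mon (\<alpha> + \<beta>) 1) \<mu> = mfact \<alpha> * coef (pscale (peval (mon \<beta> 1) \<mu> / fact e) (l ^ e)) \<alpha>"
      unfolding peval_mon_add lookup_pscale by (simp only: mult_ac)
  qed
  then have "peval (mon (mon j N) 1) \<mu> = 0" for j
    using triv mdeg_mon[of j N] unfolding trivial_inverse_system_def by blast
  then have "\<mu> j = 0" for j using N by (simp add: peval_single)
  then show ?thesis unfolding \<mu> linear_form_def by simp
qed

definition monomial_pairing :: "('n, 'k::field) mpol \<Rightarrow> (('n \<Rightarrow>\<^sub>0 nat) \<Rightarrow> 'k) \<Rightarrow> 'k" where
  "monomial_pairing a \<Psi> = (\<Sum>m\<in>Poly_Mapping.keys a. coef a m * \<Psi> m)"

lemma monomial_pairing_superset: "finite A \<Longrightarrow> Poly_Mapping.keys a \<subseteq> A \<Longrightarrow> monomial_pairing a \<Psi> = (\<Sum>m\<in>A. coef a m * \<Psi> m)"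
  unfolding monomial_pairing_def by (rule sum.mono_neutral_left) (auto simp: in_keys_iff)

lemma monomial_pairing_add: "monomial_pairing (p + q) \<Psi> = monomial_pairing p \<Psi> + monomial_pairing q \<Psi>"
proof -
  let ?A = "Poly_Mapping.keys p \<union> Poly_Mapping.keys q"
  show ?thesis
    using monomial_pairing_superset[of ?A p] monomial_pairing_superset[of ?A q] monomial_pairing_superset[of ?A "p + q"] Poly_Mapping.keys_add[of p q]
    by (simp add: lookup_add algebra_simps sum.distrib)
qed

lemma monomial_pairing_mon: "monomial_pairing (mon m c) \<Psi> = c * \<Psi> m"
  by (cases "c = 0") (simp_all add: monomial_pairing_def)

lemma monomial_pairing_mon_mult: "monomial_pairing (mon m c * p) \<Psi> = c * monomial_pairing p (\<lambda>\<alpha>. \<Psi> (m + \<alpha>))"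
proof (induction p rule: mpol_induct)
  case zero
  then show ?case by (simp add: monomial_pairing_def)
next
  case (add m' c' p)
  then show ?case by (simp add: distrib_left monomial_pairing_add mult_single monomial_pairing_mon)
qed

lemma inverse_system_shift:
  assumes "inverse_system e J (mdeg m + N) \<Psi>"
  shows "inverse_system e J N (\<lambda>\<alpha>. \<Psi> (m + \<alpha>))"
  unfolding inverse_system_def
proof (intro allI impI)
  fix \<beta> :: "'a \<Rightarrow>\<^sub>0 nat" assume "mdeg \<beta> + e = N"
  then have "mdeg (\<beta> + m) + e = mdeg m + N" by simp
  then obtain p where "p \<in> J" "\<forall>\<alpha>. mdeg \<alpha> = e \<longrightarrow> \<Psi> (\<alpha> + (\<beta> + m)) = mfact \<alpha> * coef p \<alpha>"
    using assms unfolding inverse_system_def by blast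
  then show "\<exists>p\<in>J. \<forall>\<alpha>. mdeg \<alpha> = e \<longrightarrow> \<Psi> (m + (\<alpha> + \<beta>)) = mfact \<alpha> * coef p \<alpha>"
    by (intro bexI[of _ p]) (auto simp: add_ac)
qed

definition annihilator :: "nat \<Rightarrow> ('n::finite, 'k::field_char_0) mpol set \<Rightarrow> (nat \<times> ('n, 'k) mpol) set" where
  "annihilator e J = {(N, a). a \<in> graded N \<and> (\<forall>\<Psi>. inverse_system e J N \<Psi> \<longrightarrow> monomial_pairing a \<Psi> = 0)}"

lemma graded_ideal_annihilator: "graded_ideal (annihilator e J)"
  unfolding graded_ideal_def
proof (intro conjI allI impI)
  fix N p m c assume p: "(N, p) \<in> annihilator e J"
  then have "mon m c * p \<in> graded (mdeg m + N)"
    by (auto simp: annihilator_def intro: graded_mult graded_mon)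
  moreover have "monomial_pairing (mon m c * p) \<Psi> = 0" if "inverse_system e J (mdeg m + N) \<Psi>" for \<Psi>
    using p inverse_system_shift[OF that] by (auto simp: annihilator_def monomial_pairing_mon_mult)
  ultimately show "(mdeg m + N, mon m c * p) \<in> annihilator e J" by (simp add: annihilator_def)
qed (auto simp: annihilator_def monomial_pairing_add monomial_pairing_def[of 0] intro: graded_add)

lemma functional_vanishing_on_subspace:
  fixes J :: "('n, 'k::field) mpol set"
  assumes J: "pvs.subspace J" and q: "q \<notin> J"
  obtains \<phi> where "Vector_Spaces.linear pscale (*) \<phi>" "\<forall>p\<in>J. \<phi> p = 0" "\<phi> q = (1::'k)"
proof -
  have "vector_space ((*) :: 'k \<Rightarrow> 'k \<Rightarrow> 'k)"
    by unfold_locales (simp_all add: distrib_left distrib_right)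
  then have vp: "vector_space_pair (pscale :: 'k \<Rightarrow> ('n, 'k) mpol \<Rightarrow> ('n, 'k) mpol) ((*) :: 'k \<Rightarrow> 'k \<Rightarrow> 'k)"
    by (intro vector_space_pair.intro pvs.vector_space_axioms)
  obtain B where B: "B \<subseteq> J" "pvs.independent B" "J \<subseteq> pvs.span B" "card B = pvs.dim J"
    by (rule pvs.basis_exists)
  have "pvs.span B \<subseteq> J" by (rule pvs.span_minimal[OF B(1) J])
  then have "q \<notin> pvs.span B" using q by blast
  then have ind: "pvs.independent (insert q B)" by (rule pvs.independent_insertI) (rule B(2))
  have "\<exists>\<phi>. Vector_Spaces.linear pscale (*) \<phi> \<and> (\<forall>x\<in>insert q B. \<phi> x = (if x = q then 1 else 0 :: 'k))"
    using vector_space_pair.linear_independent_extend[OF vp ind, of "\<lambda>x. if x = q then 1 else 0"] by simp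
  then obtain \<phi> where \<phi>: "Vector_Spaces.linear pscale (*) \<phi>" "\<forall>x\<in>insert q B. \<phi> x = (if x = q then 1 else 0 :: 'k)"
    by (elim exE conjE)
  have "\<phi> p = 0" if "p \<in> J" for p
  proof (rule vector_space_pair.linear_eq_0_on_span[OF vp \<phi>(1), of B])
    show "p \<in> pvs.span B" using that B(3) by blast
    show "\<phi> b = 0" if "b \<in> B" for b using \<phi>(2) that B(1) q by auto
  qed
  then show ?thesis using that \<phi> by simp
qed

text \<open>Otherwise the annihilator of the inverse system contains no \<open>R\<^sub>N\<close>, so it has a common zero \<open>\<mu>\<close>; let
\<open>l = \<Sum> \<mu>\<^sub>j x\<^sub>j\<close>. If \<open>l\<^sup>e\<close> were not in \<open>J\<close>, a linear functional \<open>\<phi>\<close> would vanish on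
\<open>J\<close> but not at \<open>l\<^sup>e\<close>. Read as a form \<open>a\<close> of degree \<open>e\<close>, the functional annihilates the inverse
system, whose piece of degree \<open>e\<close> is \<open>J\<close>; so \<open>a(\<mu>) = 0\<close>. But \<open>a(\<mu>)\<close> is \<open>\<phi>(l\<^sup>e) / e!\<close>.\<close>

lemma no_linear_powers_imp_trivial_inverse_system:
  fixes J :: "('n::finite, 'k::{alg_closed_field, field_char_0}) mpol set"
  assumes J: "pvs.subspace J" "J \<subseteq> graded e"
    and nopow: "\<And>l. l \<in> graded 1 \<Longrightarrow> l ^ e \<in> J \<Longrightarrow> l = 0"
  shows "\<exists>N\<ge>e. trivial_inverse_system e J N"
proof (rule ccontr)
  assume neg: "\<not> ?thesis"
  have "proper_in_all_degrees (annihilator e J)"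
    unfolding proper_in_all_degrees_def
  proof
    fix N
    show "\<exists>p\<in>graded N. (N, p) \<notin> annihilator e J"
    proof (cases "N < e")
      case True
      \<comment> \<open>no shift of \<open>\<Psi>\<close> reaches degree \<open>e\<close>, so every \<open>\<Psi>\<close> belongs to the inverse system\<close>
      then have "inverse_system e J N (\<lambda>_. 1)" by (simp add: inverse_system_def)
      then show ?thesis
        by (intro bexI[of _ "mon (mon undefined N) 1"]) (auto simp: annihilator_def monomial_pairing_mon graded_mon)
    next
      case False
      then obtain \<Psi> \<gamma> where "inverse_system e J N \<Psi>" "mdeg \<gamma> = N" "\<Psi> \<gamma> \<noteq> 0"
        using neg unfolding trivial_inverse_system_def by (meson not_less)
      then show ?thesis
        by (intro bexI[of _ "mon \<gamma> 1"]) (auto simp: annihilator_def monomial_pairing_mon graded_mon)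
    qed
  qed
  then obtain \<mu> i where \<mu>: "\<mu> i \<noteq> 0" "\<And>N F. (N, F) \<in> annihilator e J \<Longrightarrow> peval F \<mu> = 0"
    using homogeneous_nullstellensatz[OF graded_ideal_annihilator] by blast
  let ?l = "linear_form \<mu>" and ?M = "{\<alpha> :: 'n \<Rightarrow>\<^sub>0 nat. mdeg \<alpha> = e}"
  have "?l \<noteq> 0" using coef_linear_form[of \<mu> i] \<mu>(1) by auto
  then have "?l ^ e \<notin> J" using nopow linear_form_graded by blast
  then obtain \<phi> where \<phi>: "Vector_Spaces.linear pscale (*) \<phi>" "\<forall>p\<in>J. \<phi> p = 0" "\<phi> (?l ^ e) = (1::'k)"
    by (rule functional_vanishing_on_subspace[OF J(1)])
  have expand: "\<phi> p = (\<Sum>\<alpha>\<in>?M. coef p \<alpha> * \<phi> (mon \<alpha> 1))" if p: "p \<in> graded e" for p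
  proof -
    have "p = (\<Sum>m\<in>Poly_Mapping.keys p. pscale (coef p m) (mon m 1))"
      using poly_mapping_sum_monomials[of p] by (simp add: pscale_def mult_single)
    also have "\<dots> = (\<Sum>\<alpha>\<in>?M. pscale (coef p \<alpha>) (mon \<alpha> 1))"
      by (rule sum.mono_neutral_left) (use p in \<open>auto simp: graded_def in_keys_iff\<close>)
    finally have "\<phi> p = \<phi> (\<Sum>\<alpha>\<in>?M. pscale (coef p \<alpha>) (mon \<alpha> 1))" by simp
    also have "\<dots> = (\<Sum>\<alpha>\<in>?M. coef p \<alpha> * \<phi> (mon \<alpha> 1))"
      using \<phi>(1) unfolding linear_iff_module_hom
      by (simp add: module_hom.sum module_hom.scale)
    finally show ?thesis .
  qed
  \<comment> \<open>dividing by \<open>\<alpha>!\<close> compensates the factor in the definition of the inverse system\<close>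
  define a where "a = (\<Sum>\<alpha>\<in>?M. mon \<alpha> (\<phi> (mon \<alpha> 1) / mfact \<alpha>))"
  have a: "a \<in> graded e" unfolding a_def by (intro graded_sum graded_mon) simp
  have ca: "coef a \<alpha> = \<phi> (mon \<alpha> 1) / mfact \<alpha>" if "mdeg \<alpha> = e" for \<alpha>
  proof -
    have "coef a \<alpha> = (\<Sum>m\<in>?M. if m = \<alpha> then \<phi> (mon \<alpha> 1) / mfact \<alpha> else 0)"
      unfolding a_def lookup_sum by (rule sum.cong) (auto simp: lookup_single when_def)
    then show ?thesis using that by simp
  qed
  have keys: "Poly_Mapping.keys a \<subseteq> ?M" using a by (auto simp: graded_def)
  have "monomial_pairing a \<Psi> = 0" if \<Psi>: "inverse_system e J e \<Psi>" for \<Psi>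
  proof -
    have "mdeg (0 :: 'n \<Rightarrow>\<^sub>0 nat) + e = e" by simp
    then obtain p where p: "p \<in> J" "\<forall>\<alpha>. mdeg \<alpha> = e \<longrightarrow> \<Psi> (\<alpha> + 0) = mfact \<alpha> * coef p \<alpha>"
      using \<Psi> unfolding inverse_system_def by blast
    have "monomial_pairing a \<Psi> = (\<Sum>\<alpha>\<in>?M. coef p \<alpha> * \<phi> (mon \<alpha> 1))"
      unfolding monomial_pairing_superset[OF finite_monomials keys] by (rule sum.cong) (use p(2) in \<open>auto simp: ca\<close>)
    also have "\<dots> = \<phi> p" using expand p(1) J(2) by auto
    finally show ?thesis using \<phi>(2) p(1) by simp
  qed
  then have "(e, a) \<in> annihilator e J" using a by (simp add: annihilator_def)
  then have "peval a \<mu> = 0" by (rule \<mu>(2))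
  also have "peval a \<mu> = (\<Sum>\<alpha>\<in>?M. coef a \<alpha> * peval (mon \<alpha> 1) \<mu>)"
    using peval_superset[OF finite_monomials keys] by (simp add: peval_single)
  also have "\<dots> = (\<Sum>\<alpha>\<in>?M. inverse (fact e) * (coef (?l ^ e) \<alpha> * \<phi> (mon \<alpha> 1)))"
  proof (rule sum.cong[OF refl])
    fix \<alpha> assume "\<alpha> \<in> ?M"
    then have \<alpha>: "mdeg \<alpha> = e" by simp
    have "peval (mon \<alpha> 1) \<mu> = inverse (fact e) * (mfact \<alpha> * coef (?l ^ e) \<alpha>)"
      unfolding coef_linear_form_power[OF \<alpha>] by simp
    then show "coef a \<alpha> * peval (mon \<alpha> 1) \<mu> = inverse (fact e) * (coef (?l ^ e) \<alpha> * \<phi> (mon \<alpha> 1))"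
      by (simp add: ca[OF \<alpha>])
  qed
  also have "\<dots> = inverse (fact e) * \<phi> (?l ^ e)"
    using expand graded_power[OF linear_form_graded, of \<mu> e] by (simp add: sum_distrib_left)
  finally show False using \<phi>(3) by simp
qed

section \<open>The Zariski topology\<close>

lemma gradient_gen_comb_graded:
  assumes "f \<in> graded d" "Y \<subseteq> gradient_gens d e"
  shows "(\<Sum>y\<in>Y. pscale (c y) (gradient_gen f y)) \<in> graded e"
  using assms by (intro graded_sum graded_pscale gradient_gen_graded) auto

lemma gradient_gen_in_piece:
  fixes f :: "('n::finite, 'k::field) mpol"
  assumes "f \<in> graded d" "y \<in> gradient_gens d e"
  shows "gradient_gen f y \<in> gradient_piece e f"
  unfolding gradient_piece_eq_span[OF assms(1)] using assms(2) by (intro pvs.span_base imageI)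

lemma gradient_gen_comb_in_piece:
  fixes f :: "('n::finite, 'k::field) mpol"
  assumes "f \<in> graded d" "Y \<subseteq> gradient_gens d e"
  shows "(\<Sum>y\<in>Y. pscale (c y) (gradient_gen f y)) \<in> gradient_piece e f"
  using assms gradient_gen_in_piece
  by (intro pvs.subspace_sum[OF subspace_gradient_piece] pvs.subspace_scale[OF subspace_gradient_piece]) blast

lemma gradient_piece_subset_span:
  fixes f :: "('n::finite, 'k::field) mpol"
  shows "gradient_piece e f \<subseteq> pvs.span ((\<lambda>m. mon m (1::'k)) ` {m :: 'n \<Rightarrow>\<^sub>0 nat. mdeg m = e})"
  using graded_subset_span_monomials[of e] by (auto simp: gradient_piece_def)

lemma gradient_piece_indep_gens:
  fixes f :: "('n::finite, 'k::field) mpol"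
  assumes f: "f \<in> graded d"
  obtains Y where "Y \<subseteq> gradient_gens d e" "finite Y" "card Y = pvs.dim (gradient_piece e f)"
    "indep_family (gradient_gen f) Y"
  by (rule indep_family_exists[OF gradient_piece_subset_span _ gradient_piece_eq_span[OF f]]) auto

lemma card_indep_gens_le_dim:
  fixes f :: "('n::finite, 'k::field) mpol"
  assumes "f \<in> graded d" "Y \<subseteq> gradient_gens d e" "finite Y" "indep_family (gradient_gen f) Y"
  shows "card Y \<le> pvs.dim (gradient_piece e f)"
  by (rule indep_family_card_le_dim[OF assms(4,3) _ gradient_piece_subset_span])
    (use gradient_gen_in_piece[OF assms(1)] assms(2) in auto)

lemma indep_family_iff_full_col_rank:
  assumes f: "f \<in> graded d" and Y: "Y \<subseteq> gradient_gens d e"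
  shows "indep_family (gradient_gen f) Y \<longleftrightarrow>
    full_col_rank {\<alpha>. mdeg \<alpha> = e} Y (\<lambda>\<alpha> y. peval (gradient_entry \<alpha> y) (coef f))"
proof -
  have "(\<Sum>y\<in>Y. pscale (c y) (gradient_gen f y)) = 0 \<longleftrightarrow>
      (\<forall>\<alpha>\<in>{\<alpha>. mdeg \<alpha> = e}. (\<Sum>y\<in>Y. coef (gradient_gen f y) \<alpha> * c y) = 0)" (is "?p = 0 \<longleftrightarrow> ?R") for c
  proof -
    have co: "coef ?p \<alpha> = (\<Sum>y\<in>Y. coef (gradient_gen f y) \<alpha> * c y)" for \<alpha>
      by (simp add: lookup_sum lookup_pscale mult.commute)
    have "?p = 0 \<longleftrightarrow> (\<forall>\<alpha>. mdeg \<alpha> = e \<longrightarrow> coef ?p \<alpha> = 0)"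
    proof
      assume z: "\<forall>\<alpha>. mdeg \<alpha> = e \<longrightarrow> coef ?p \<alpha> = 0"
      show "?p = 0"
      proof (rule poly_mapping_eqI)
        fix \<alpha>
        show "coef ?p \<alpha> = coef 0 \<alpha>"
          using z graded_coef_zero[OF gradient_gen_comb_graded[OF f Y, of c], of \<alpha>]
          by (cases "mdeg \<alpha> = e") simp_all
      qed
    qed simp
    then show ?thesis unfolding co by blast
  qed
  then show ?thesis unfolding indep_family_def full_col_rank_def peval_gradient_entry by simp
qed

text \<open>Generators that are independent at \<open>f0\<close> remain so nearby.\<close>

lemma gradient_dim_lower_semicontinuous:
  fixes f0 :: "('n::finite, 'k::field) mpol"
  assumes f0: "f0 \<in> graded d"
  shows "\<exists>H h. H \<in> graded h \<and> peval H (coef f0) \<noteq> 0 \<and>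
    (\<forall>f\<in>graded d. peval H (coef f) \<noteq> 0 \<longrightarrow>
       pvs.dim (gradient_piece e f0) \<le> pvs.dim (gradient_piece e f))"
proof -
  obtain Y where Y: "Y \<subseteq> gradient_gens d e" "finite Y" "card Y = pvs.dim (gradient_piece e f0)"
    "indep_family (gradient_gen f0) Y"
    by (rule gradient_piece_indep_gens[OF f0])
  obtain H h where "H \<in> graded h" "peval H (coef f0) \<noteq> 0"
    "\<forall>b. peval H b \<noteq> 0 \<longrightarrow> full_col_rank {\<alpha>. mdeg \<alpha> = e} Y (\<lambda>\<alpha> y. peval (gradient_entry \<alpha> y) b)"
    using full_col_rank_open[OF Y(2), of "{\<alpha>. mdeg \<alpha> = e}" gradient_entry "\<lambda>_. 1" "coef f0"]
      indep_family_iff_full_col_rank[OF f0 Y(1)] Y(4) gradient_entry_graded by blast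
  then show ?thesis
    using indep_family_iff_full_col_rank[OF _ Y(1)] card_indep_gens_le_dim[OF _ Y(1,2)] Y(3)
    by (intro exI[of _ H] exI[of _ h]) auto
qed

text \<open>Take generators \<open>Y\<close> of the gradient piece that form a basis at \<open>f0\<close>. The unknowns are the values of \<open>\<Psi>\<close>
and, for every \<open>\<beta>\<close>, the coordinates of the element of \<open>J\<close> that the shift of \<open>\<Psi>\<close> by \<open>\<beta>\<close> must be
equal to; the defining equations of the inverse system are linear in them. At \<open>f0\<close> the only solution is \<open>0\<close>,
and this persists nearby. There the generators \<open>Y\<close> are still independent (put \<open>\<Psi> = 0\<close>), so they are still a
basis if the dimension is the same, and then the equations describe the inverse system.\<close>

lemma trivial_inverse_system_open:
  fixes f0 :: "('n::finite, 'k::field_char_0) mpol"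
  assumes f0: "f0 \<in> graded d" and N: "e \<le> N" and triv: "trivial_inverse_system e (gradient_piece e f0) N"
  shows "\<exists>H h. H \<in> graded h \<and> peval H (coef f0) \<noteq> 0 \<and>
    (\<forall>f\<in>graded d. peval H (coef f) \<noteq> 0 \<longrightarrow>
       pvs.dim (gradient_piece e f0) \<le> pvs.dim (gradient_piece e f) \<and>
       (pvs.dim (gradient_piece e f) = pvs.dim (gradient_piece e f0) \<longrightarrow>
          trivial_inverse_system e (gradient_piece e f) N))"
proof -
  obtain Y where Y: "Y \<subseteq> gradient_gens d e" "finite Y" "card Y = pvs.dim (gradient_piece e f0)"
    "indep_family (gradient_gen f0) Y"
    by (rule gradient_piece_indep_gens[OF f0])
  let ?B = "{\<beta> :: 'n \<Rightarrow>\<^sub>0 nat. mdeg \<beta> + e = N}"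
  let ?M = "{\<gamma> :: 'n \<Rightarrow>\<^sub>0 nat. mdeg \<gamma> = N}"
  let ?X = "{\<alpha> :: 'n \<Rightarrow>\<^sub>0 nat. mdeg \<alpha> = e} \<times> ?B"
  let ?C = "?M <+> (?B \<times> Y)"
  \<comment> \<open>row \<open>(\<alpha>, \<beta>)\<close> is the equation \<open>\<Psi> (\<alpha> + \<beta>) = \<alpha>! \<Sum>\<^sub>y c\<^sub>\<beta>\<^sub>y g\<^sub>y(\<alpha>)\<close>, with \<open>g\<^sub>y\<close> the generators; column
    \<open>Inl \<gamma>\<close> is the unknown \<open>\<Psi> \<gamma>\<close> and column \<open>Inr (\<beta>, y)\<close> the unknown \<open>c\<^sub>\<beta>\<^sub>y\<close>\<close>
  define E :: "('n \<Rightarrow>\<^sub>0 nat) \<times> ('n \<Rightarrow>\<^sub>0 nat) \<Rightarrow>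
      ('n \<Rightarrow>\<^sub>0 nat) + ('n \<Rightarrow>\<^sub>0 nat) \<times> ('n \<Rightarrow>\<^sub>0 nat) \<times> 'n \<Rightarrow> ('n \<Rightarrow>\<^sub>0 nat, 'k) mpol"
    where "E = (\<lambda>(\<alpha>, \<beta>). case_sum (\<lambda>\<gamma>. if \<gamma> = \<alpha> + \<beta> then 1 else 0)
      (\<lambda>(\<beta>', y). if \<beta>' = \<beta> then cst (- mfact \<alpha>) * gradient_entry \<alpha> y else 0))"
  have finB: "finite ?B"
    by (rule finite_subset[OF _ finite_monomials[of "N - e"]]) auto
  have finC: "finite ?C" using finB Y(2) by simp
  have Egr: "E x y \<in> graded (case y of Inl _ \<Rightarrow> 0 | Inr _ \<Rightarrow> 1)" for x y
    using graded_cst[of 1] graded_mult[OF graded_cst gradient_entry_graded]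
    by (auto simp: E_def split: sum.split prod.split)
  have row: "(\<Sum>y\<in>?C. peval (E (\<alpha>, \<beta>) y) (coef f) * c y) =
      c (Inl (\<alpha> + \<beta>)) - mfact \<alpha> * coef (\<Sum>y\<in>Y. pscale (c (Inr (\<beta>, y))) (gradient_gen f y)) \<alpha>"
    if "mdeg \<alpha> = e" "\<beta> \<in> ?B" for \<alpha> \<beta> f c
  proof -
    have "(\<Sum>\<gamma>\<in>?M. peval (E (\<alpha>, \<beta>) (Inl \<gamma>)) (coef f) * c (Inl \<gamma>))
        = (\<Sum>\<gamma>\<in>?M. if \<gamma> = \<alpha> + \<beta> then c (Inl (\<alpha> + \<beta>)) else 0)"
      by (rule sum.cong) (auto simp: E_def peval_one comm_homD(4)[OF comm_hom_peval])
    also have "\<dots> = c (Inl (\<alpha> + \<beta>))" using that by (simp add: add.commute)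
    finally have 1: "(\<Sum>\<gamma>\<in>?M. peval (E (\<alpha>, \<beta>) (Inl \<gamma>)) (coef f) * c (Inl \<gamma>)) = c (Inl (\<alpha> + \<beta>))" .
    have "(\<Sum>z\<in>?B \<times> Y. peval (E (\<alpha>, \<beta>) (Inr z)) (coef f) * c (Inr z))
        = (\<Sum>\<beta>'\<in>?B. \<Sum>y\<in>Y. peval (E (\<alpha>, \<beta>) (Inr (\<beta>', y))) (coef f) * c (Inr (\<beta>', y)))"
      by (simp add: sum.cartesian_product)
    also have "\<dots> = (\<Sum>\<beta>'\<in>?B. if \<beta>' = \<beta> then
        (\<Sum>y\<in>Y. - mfact \<alpha> * (coef (gradient_gen f y) \<alpha> * c (Inr (\<beta>, y)))) else 0)"
      by (rule sum.cong)
        (auto simp: E_def peval_mult peval_gradient_entry comm_homD(4)[OF comm_hom_peval] mult.assoc)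
    also have "\<dots> = (\<Sum>y\<in>Y. - mfact \<alpha> * (coef (gradient_gen f y) \<alpha> * c (Inr (\<beta>, y))))"
      using that(2) finB by simp
    also have "\<dots> = - mfact \<alpha> * coef (\<Sum>y\<in>Y. pscale (c (Inr (\<beta>, y))) (gradient_gen f y)) \<alpha>"
      by (simp add: lookup_sum lookup_pscale sum_distrib_left mult.commute mult.left_commute)
    finally have 2: "(\<Sum>z\<in>?B \<times> Y. peval (E (\<alpha>, \<beta>) (Inr z)) (coef f) * c (Inr z)) =
        - mfact \<alpha> * coef (\<Sum>y\<in>Y. pscale (c (Inr (\<beta>, y))) (gradient_gen f y)) \<alpha>" .
    show ?thesis using finB Y(2) by (simp add: sum.Plus 1 2)
  qed
  have "full_col_rank ?X ?C (\<lambda>x y. peval (E x y) (coef f0))"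
    unfolding full_col_rank_def
  proof (intro allI impI)
    fix c assume c: "\<forall>x\<in>?X. (\<Sum>y\<in>?C. peval (E x y) (coef f0) * c y) = 0"
    let ?p = "\<lambda>\<beta>. \<Sum>y\<in>Y. pscale (c (Inr (\<beta>, y))) (gradient_gen f0 y)"
    have eq: "c (Inl (\<alpha> + \<beta>)) = mfact \<alpha> * coef (?p \<beta>) \<alpha>" if "mdeg \<alpha> = e" "\<beta> \<in> ?B" for \<alpha> \<beta>
      using c row[OF that, of f0 c] that by auto
    have inv: "inverse_system e (gradient_piece e f0) N (\<lambda>\<gamma>. c (Inl \<gamma>))"
      unfolding inverse_system_def
    proof (intro allI impI bexI)
      fix \<beta> \<alpha> :: "'n \<Rightarrow>\<^sub>0 nat" assume "mdeg \<beta> + e = N" "mdeg \<alpha> = e"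
      then show "c (Inl (\<alpha> + \<beta>)) = mfact \<alpha> * coef (?p \<beta>) \<alpha>" by (intro eq) simp_all
    qed (rule gradient_gen_comb_in_piece[OF f0 Y(1)])
    have \<gamma>: "c (Inl \<gamma>) = 0" if "\<gamma> \<in> ?M" for \<gamma>
      using triv[unfolded trivial_inverse_system_def, rule_format, OF inv, of \<gamma>] that by simp
    have "c (Inr (\<beta>, y)) = 0" if \<beta>: "\<beta> \<in> ?B" and y: "y \<in> Y" for \<beta> y
    proof -
      have "coef (?p \<beta>) \<alpha> = 0" for \<alpha>
      proof (cases "mdeg \<alpha> = e")
        case True
        then have "\<alpha> + \<beta> \<in> ?M" using \<beta> by simp
        then show ?thesis using eq[OF True \<beta>] \<gamma> by simp
      next
        case False
        then show ?thesis by (rule graded_coef_zero[OF gradient_gen_comb_graded[OF f0 Y(1)]])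
      qed
      then have "?p \<beta> = 0" by (intro poly_mapping_eqI) simp
      then show ?thesis
        using Y(4) y unfolding indep_family_def by (elim allE[of _ "\<lambda>y. c (Inr (\<beta>, y))"]) simp
    qed
    then show "\<forall>y\<in>?C. c y = 0" using \<gamma> by auto
  qed
  from full_col_rank_open[where E = E, OF finC Egr this]
  obtain H h where H: "H \<in> graded h" "peval H (coef f0) \<noteq> 0"
    "\<And>b. peval H b \<noteq> 0 \<Longrightarrow> full_col_rank ?X ?C (\<lambda>x y. peval (E x y) b)"
    by blast
  have "pvs.dim (gradient_piece e f0) \<le> pvs.dim (gradient_piece e f) \<and>
       (pvs.dim (gradient_piece e f) = pvs.dim (gradient_piece e f0) \<longrightarrow>
          trivial_inverse_system e (gradient_piece e f) N)"
    if f: "f \<in> graded d" and Hf: "peval H (coef f) \<noteq> 0" for f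
  proof -
    have full: "\<forall>y\<in>?C. c y = 0"
      if "\<And>\<alpha> \<beta>. mdeg \<alpha> = e \<Longrightarrow> \<beta> \<in> ?B \<Longrightarrow> c (Inl (\<alpha> + \<beta>)) =
        mfact \<alpha> * coef (\<Sum>y\<in>Y. pscale (c (Inr (\<beta>, y))) (gradient_gen f y)) \<alpha>" for c
    proof -
      have "\<forall>x\<in>?X. (\<Sum>y\<in>?C. peval (E x y) (coef f) * c y) = 0"
        using row[of _ _ f c] that by auto
      then show ?thesis using H(3)[OF Hf] unfolding full_col_rank_def by blast
    qed
    have ind: "indep_family (gradient_gen f) Y"
      unfolding indep_family_def
    proof (intro allI impI ballI)
      fix c y assume c: "(\<Sum>y\<in>Y. pscale (c y) (gradient_gen f y)) = 0" and y: "y \<in> Y"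
      have z: "\<forall>y\<in>?C. case_sum (\<lambda>_. 0) (\<lambda>(\<beta>, y). c y) y = 0"
        by (rule full) (simp add: c)
      have "Inr (mon undefined (N - e), y) \<in> ?C" by (rule InrI) (use y N in simp)
      from bspec[OF z this] show "c y = 0" by simp
    qed
    have "trivial_inverse_system e (gradient_piece e f) N"
      if dim: "pvs.dim (gradient_piece e f) = pvs.dim (gradient_piece e f0)"
      unfolding trivial_inverse_system_def
    proof (intro allI impI)
      fix \<Psi> :: "('n \<Rightarrow>\<^sub>0 nat) \<Rightarrow> 'k" and \<gamma> :: "'n \<Rightarrow>\<^sub>0 nat"
      assume "inverse_system e (gradient_piece e f) N \<Psi>" and \<gamma>: "mdeg \<gamma> = N"
      then have "\<forall>\<beta>. \<exists>p. \<beta> \<in> ?B \<longrightarrow> p \<in> gradient_piece e f \<and>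
          (\<forall>\<alpha>. mdeg \<alpha> = e \<longrightarrow> \<Psi> (\<alpha> + \<beta>) = mfact \<alpha> * coef p \<alpha>)"
        unfolding inverse_system_def by blast
      then obtain p where p: "\<And>\<beta>. \<beta> \<in> ?B \<Longrightarrow> p \<beta> \<in> gradient_piece e f"
        "\<And>\<alpha> \<beta>. \<beta> \<in> ?B \<Longrightarrow> mdeg \<alpha> = e \<Longrightarrow> \<Psi> (\<alpha> + \<beta>) = mfact \<alpha> * coef (p \<beta>) \<alpha>"
        by metis
      have "\<exists>c. q = (\<Sum>y\<in>Y. pscale (c y) (gradient_gen f y))" if q: "q \<in> gradient_piece e f" for q
      proof -
        obtain c where "q = (\<Sum>y\<in>Y. pscale (c y) (gradient_gen f y))"
          by (rule indep_family_expand[OF ind Y(2) _ gradient_piece_subset_span[of e f] _ _ q])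
            (use gradient_gen_in_piece[OF f] Y(1) dim Y(3) in auto)
        then show ?thesis by blast
      qed
      then have "\<forall>\<beta>. \<exists>c. \<beta> \<in> ?B \<longrightarrow> p \<beta> = (\<Sum>y\<in>Y. pscale (c y) (gradient_gen f y))"
        using p(1) by blast
      then obtain c where c: "\<And>\<beta>. \<beta> \<in> ?B \<Longrightarrow> p \<beta> = (\<Sum>y\<in>Y. pscale (c \<beta> y) (gradient_gen f y))"
        by metis
      have z: "\<forall>y\<in>?C. case_sum \<Psi> (\<lambda>(\<beta>, y). c \<beta> y) y = 0"
        by (rule full) (simp add: p(2) c[symmetric])
      have "Inl \<gamma> \<in> ?C" by (rule InlI) (simp add: \<gamma>)
      from bspec[OF z this] show "\<Psi> \<gamma> = 0" by simp
    qed
    then show ?thesis using card_indep_gens_le_dim[OF f Y(1,2) ind] Y(3) by simp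
  qed
  then show ?thesis using H(1,2) by blast
qed

definition basic_open :: "nat \<Rightarrow> ('n \<Rightarrow>\<^sub>0 nat, 'k::field) mpol \<Rightarrow> ('n, 'k) mpol set set" where
  "basic_open d H = proj (graded d) - zero_locus d {H}"

lemma openin_basic_open: "H \<in> graded h \<Longrightarrow> openin (zariski d) (basic_open d H)"
  unfolding openin_zariski basic_open_def
  by (intro exI[of _ "{H}"]) (auto simp: coord_forms_def)

lemma pt_in_basic_open:
  assumes "H \<in> graded h" "f \<in> graded d" "f \<noteq> 0"
  shows "pt f \<in> basic_open d H \<longleftrightarrow> peval H (coef f) \<noteq> 0"
proof -
  have "{H} \<subseteq> coord_forms" using assms(1) by (auto simp: coord_forms_def)
  moreover have "pt f \<in> proj (graded d)" using assms by (auto simp: proj_def)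
  ultimately show ?thesis using pt_in_zero_locus[OF assms(2,3), of "{H}"] by (auto simp: basic_open_def)
qed

lemma basic_open_obtain:
  assumes "H \<in> graded h" "p \<in> basic_open d H"
  obtains f where "f \<in> graded d" "f \<noteq> 0" "p = pt f" "peval H (coef f) \<noteq> 0"
proof -
  have "p \<in> proj (graded d)" using assms(2) by (simp add: basic_open_def)
  then obtain f where f: "f \<in> graded d" "f \<noteq> 0" "p = pt f" by (auto simp: proj_def)
  then show ?thesis using that pt_in_basic_open[OF assms(1) f(1,2)] assms(2) by blast
qed

lemma closedin_gradient_dim_le:
  "closedin (zariski d)
    {pt f | f :: ('n::finite, 'k::field) mpol. f \<in> graded d \<and> f \<noteq> 0 \<and> pvs.dim (gradient_piece e f) \<le> r}"
    (is "closedin _ ?Z")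
proof -
  let ?O = "{pt f | f :: ('n, 'k) mpol. f \<in> graded d \<and> f \<noteq> 0 \<and> r < pvs.dim (gradient_piece e f)}"
  have "openin (zariski d) ?O"
  proof (subst openin_subopen, intro ballI)
    fix p assume "p \<in> ?O"
    then obtain f0 where f0: "p = pt f0" "f0 \<in> graded d" "f0 \<noteq> 0" "r < pvs.dim (gradient_piece e f0)"
      by blast
    obtain H h where H: "H \<in> graded h" "peval H (coef f0) \<noteq> 0"
      "\<And>f. f \<in> graded d \<Longrightarrow> peval H (coef f) \<noteq> 0 \<Longrightarrow>
         pvs.dim (gradient_piece e f0) \<le> pvs.dim (gradient_piece e f)"
      using gradient_dim_lower_semicontinuous[OF f0(2)] by blast
    have "basic_open d H \<subseteq> ?O"
    proof
      fix q assume "q \<in> basic_open d H"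
      then obtain f where f: "f \<in> graded d" "f \<noteq> 0" "q = pt f" "peval H (coef f) \<noteq> 0"
        by (rule basic_open_obtain[OF H(1)])
      then show "q \<in> ?O" using H(3)[OF f(1,4)] f0(4) less_le_trans by blast
    qed
    moreover have "p \<in> basic_open d H" using pt_in_basic_open[OF H(1) f0(2,3)] H(2) f0(1) by simp
    ultimately show "\<exists>T. openin (zariski d) T \<and> p \<in> T \<and> T \<subseteq> ?O"
      using openin_basic_open[OF H(1)] by blast
  qed
  moreover have "?Z = topspace (zariski d) - ?O"
    unfolding topspace_zariski
  proof (intro equalityI subsetI)
    fix p assume "p \<in> ?Z"
    then obtain f where f: "p = pt f" "f \<in> graded d" "f \<noteq> 0" "pvs.dim (gradient_piece e f) \<le> r" by blast
    have "p \<notin> ?O"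
    proof
      assume "p \<in> ?O"
      then obtain g where g: "p = pt g" "g \<noteq> 0" "r < pvs.dim (gradient_piece e g)" by blast
      then have "gradient_piece e g = gradient_piece e f" using gradient_piece_cong f by metis
      then show False using g f by simp
    qed
    then show "p \<in> proj (graded d) - ?O" using f by (auto simp: proj_def)
  next
    fix p assume p: "p \<in> proj (graded d) - ?O"
    then obtain f where f: "f \<in> graded d" "f \<noteq> 0" "p = pt f" by (auto simp: proj_def)
    then have "\<not> r < pvs.dim (gradient_piece e f)" using p by blast
    then show "p \<in> ?Z" using f by auto
  qed
  ultimately show ?thesis by (simp add: closedin_def) blast
qed

lemma veronese_avoidance_iff_no_powers:
  fixes f :: "('n::finite, 'k::field_char_0) mpol"
  shows "veronese_avoidance d f \<longleftrightarrow>
    (\<forall>l\<in>graded 1. l ^ (Tdeg TYPE('n) d - 1) \<in> gradient_piece (Tdeg TYPE('n) d - 1) f \<longrightarrow> l = 0)"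
    (is "_ \<longleftrightarrow> ?R")
proof -
  let ?e = "Tdeg TYPE('n) d - 1"
  show ?thesis
  proof
    assume av: "veronese_avoidance d f"
    show ?R
    proof (intro ballI impI, rule ccontr)
      fix l :: "('n, 'k) mpol" assume l: "l \<in> graded 1" "l ^ ?e \<in> gradient_piece ?e f" "l \<noteq> 0"
      then have "pt (l ^ ?e) \<in> proj (gradient_piece ?e f) \<inter> veronese ?e"
        using power_form_nonzero[OF l(1,3), of ?e] by (auto simp: proj_def veronese_def)
      then show False using av unfolding veronese_avoidance_def by blast
    qed
  next
    assume R: ?R
    show "veronese_avoidance d f"
      unfolding veronese_avoidance_def
    proof (rule ccontr)
      assume "proj (gradient_piece ?e f) \<inter> veronese ?e \<noteq> {}"
      then obtain g l where g: "g \<in> gradient_piece ?e f" "g \<noteq> 0" "pt (l ^ ?e) = pt g" "l \<in> graded 1" "l \<noteq> 0"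
        unfolding proj_def veronese_def by blast
      then obtain c where "l ^ ?e = pscale c g"
        using pt_eq_iff[OF power_form_nonzero[OF g(4,5)] g(2)] by blast
      then have "l ^ ?e \<in> gradient_piece ?e f"
        using pvs.subspace_scale[OF subspace_gradient_piece g(1)] by simp
      then show False using R g(4,5) by blast
    qed
  qed
qed

lemma gradient_generic_iff_dim:
  fixes f :: "('n::finite, 'k::field) mpol"
  shows "gradient_generic d f \<longleftrightarrow>
    pvs.dim (gradient_piece (Tdeg TYPE('n) d - 1) f) + CARD('n)
      = pvs.dim (graded (Tdeg TYPE('n) d - 1) :: ('n, 'k) mpol set)"
proof -
  have "0 < CARD('n)" by simp
  then show ?thesis unfolding gradient_generic_def proj_codim_def by linarith
qed

lemma locally_open_in_closed:
  assumes Z: "closedin X Z" and AZ: "A \<subseteq> Z"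
    and nbhd: "\<And>p. p \<in> A \<Longrightarrow> \<exists>V. openin X V \<and> p \<in> V \<and> V \<inter> Z \<subseteq> A"
  obtains U where "openin X U" "A = U \<inter> Z"
proof (rule that)
  let ?U = "\<Union>{V. openin X V \<and> V \<inter> Z \<subseteq> A}"
  show "openin X ?U" by (rule openin_Union) blast
  show "A = ?U \<inter> Z" using AZ nbhd by blast
qed

lemma Int_eq_between: "A = U \<inter> Z \<Longrightarrow> A \<subseteq> C \<Longrightarrow> C \<subseteq> Z \<Longrightarrow> A = U \<inter> C"
  by blast

text \<open>With \<open>A\<close> as in the introduction and \<open>Z\<close> the closed set of points where the gradient piece has dimension at most
\<open>m - n\<close>, every point of \<open>A\<close> has a neighbourhood whose intersection with \<open>Z\<close> lies in \<open>A\<close>.\<close>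

theorem corollary3p3:
  fixes d :: nat
  assumes "CARD('n::finite) \<ge> 3" and "d \<ge> 3"
  shows "locally_closedin (zariski d)
           (VA_space d :: ('n, 'k::{alg_closed_field, field_char_0}) mpol set set) \<and>
         (VA_space d :: ('n, 'k) mpol set set) = {p \<in> C_space d. gamma d p \<in> Omega_space d} \<and>
         openin (subtopology (zariski d) (C_space d))
           {pt f | f :: ('n, 'k) mpol. f \<in> graded d \<and> f \<noteq> 0 \<and>
              gradient_generic d f \<and> veronese_avoidance d f}"
proof -
  let ?e = "Tdeg TYPE('n) d - 1"
  let ?A = "{pt f | f :: ('n, 'k) mpol. f \<in> graded d \<and> f \<noteq> 0 \<and>
              gradient_generic d f \<and> veronese_avoidance d f}"
  let ?r = "pvs.dim (graded ?e :: ('n, 'k) mpol set) - CARD('n)"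
  let ?Z = "{pt f | f :: ('n, 'k) mpol. f \<in> graded d \<and> f \<noteq> 0 \<and> pvs.dim (gradient_piece ?e f) \<le> ?r}"
  have "3 * 1 \<le> CARD('n) * (d - 2)" using assms by (intro mult_le_mono) auto
  then have e: "0 < ?e" by (simp add: Tdeg_def)
  have CZ: "C_space d \<subseteq> ?Z"
    unfolding C_space_def gradient_generic_iff_dim by fastforce
  have AC: "?A \<subseteq> C_space d" unfolding C_space_def by blast
  have nbhd: "\<exists>V. openin (zariski d) V \<and> p \<in> V \<and> V \<inter> ?Z \<subseteq> ?A" if p: "p \<in> ?A" for p
  proof -
    obtain f0 where f0: "p = pt f0" "f0 \<in> graded d" "f0 \<noteq> 0" "gradient_generic d f0" "veronese_avoidance d f0"
      using p by blast
    have r: "pvs.dim (gradient_piece ?e f0) = ?r"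
      "?r + CARD('n) = pvs.dim (graded ?e :: ('n, 'k) mpol set)"
      using f0(4) unfolding gradient_generic_iff_dim by linarith+
    obtain N where N: "?e \<le> N" "trivial_inverse_system ?e (gradient_piece ?e f0) N"
      using no_linear_powers_imp_trivial_inverse_system[OF subspace_gradient_piece, of ?e f0 ?e]
        f0(5) unfolding veronese_avoidance_iff_no_powers gradient_piece_def by blast
    obtain H h where H: "H \<in> graded h" "peval H (coef f0) \<noteq> 0"
      "\<And>f. f \<in> graded d \<Longrightarrow> peval H (coef f) \<noteq> 0 \<Longrightarrow>
         pvs.dim (gradient_piece ?e f0) \<le> pvs.dim (gradient_piece ?e f) \<and>
         (pvs.dim (gradient_piece ?e f) = pvs.dim (gradient_piece ?e f0) \<longrightarrow>
            trivial_inverse_system ?e (gradient_piece ?e f) N)"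
      using trivial_inverse_system_open[OF f0(2) N] by blast
    have "basic_open d H \<inter> ?Z \<subseteq> ?A"
    proof
      fix q assume q: "q \<in> basic_open d H \<inter> ?Z"
      then obtain f where f: "f \<in> graded d" "f \<noteq> 0" "q = pt f" "pvs.dim (gradient_piece ?e f) \<le> ?r"
        by blast
      then have "peval H (coef f) \<noteq> 0" using q pt_in_basic_open[OF H(1) f(1,2)] by blast
      then have dim: "pvs.dim (gradient_piece ?e f) = ?r"
        and triv: "trivial_inverse_system ?e (gradient_piece ?e f) N"
        using H(3)[OF f(1)] f(4) r(1) by auto
      have "gradient_generic d f" unfolding gradient_generic_iff_dim dim by (rule r(2))
      moreover have "veronese_avoidance d f"
        unfolding veronese_avoidance_iff_no_powers
        using trivial_inverse_system_imp_no_linear_powers[OF subspace_gradient_piece _ triv] N(1) e by auto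
      ultimately show "q \<in> ?A" using f(1-3) by blast
    qed
    moreover have "p \<in> basic_open d H" using pt_in_basic_open[OF H(1) f0(2,3)] H(2) f0(1) by simp
    ultimately show ?thesis using openin_basic_open[OF H(1)] by blast
  qed
  obtain U where U: "openin (zariski d) U" "?A = U \<inter> ?Z"
    by (rule locally_open_in_closed[OF closedin_gradient_dim_le subset_trans[OF AC CZ] nbhd])
  have VA: "VA_space d = ?A"
    unfolding VA_space_def Veronese_Avoiding_def
    using reduced_if_gradient_generic_avoiding[OF assms] by blast
  have "locally_closedin (zariski d) ?A"
    unfolding locally_closedin_def
    by (intro exI[of _ U] exI[of _ ?Z] conjI U closedin_gradient_dim_le)
  moreover have "openin (subtopology (zariski d) (C_space d)) ?A"
    unfolding openin_subtopology
  proof (intro exI[of _ U] conjI U(1))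
    show "?A = U \<inter> C_space d" using U(2) AC CZ by (rule Int_eq_between)
  qed
  moreover have "?A = {p \<in> C_space d. gamma d p \<in> Omega_space d}"
  proof -
    have "gamma d (pt f) \<in> Omega_space d \<longleftrightarrow> veronese_avoidance d f"
      if "pt f \<in> C_space d" "f \<noteq> 0" for f :: "('n, 'k) mpol"
      using gamma_in_G_space[OF that(1)] gamma_pt[OF that(2), of d]
      by (simp add: Omega_space_def Sigma_space_def veronese_avoidance_def)
    then show ?thesis unfolding C_space_def by blast
  qed
  ultimately show ?thesis unfolding VA by blast
qed

end
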